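(* Let $\alpha\in(0,\tfrac12]$, $s=p^{1-\alpha}$, and $A=\sqrt{p^{\alpha-\frac12+\delta}/n}$ where $0<\delta<\tfrac1{10}$ and $\alpha-\tfrac12+2\delta<0$. Assume either $\mathbf X\in\mathrm{SubG}(\sigma^2)$ with $n/(p^{7/5}\log p)\to\infty$, or $\mathbf X\in\mathcal O_n(p)$ with $n\ge p$. Then $$\lim_{p\to\infty}\frac{\log\mathrm{Risk}(s,A)}{p^{2\delta}}=-\frac1{16}.$$
   Context: Setting: for each $p$ one observes $(\mathbf y,\mathbf X)$ with $\mathbf y=\mathbf X\boldsymbol\beta+\boldsymbol\varepsilon$, where $\boldsymbol\varepsilon\sim\mathcal N(0,I_n)$, $\mathbf X$ is an $n\times p$ real matrix independent of $\boldsymbol\varepsilon$, $\boldsymbol\beta\in\mathbb R^p$ is unknown, and $n=n(p)\to\infty$ as $p\to\infty$. Design classes: $\mathbf X\in\mathrm{SubG}(\sigma^2)$ means the rows of $\mathbf X$ are i.i.d. centered isotropic ($\mathbb E[xx^T]=I_p$) sub-Gaussian random vectors with sub-Gaussian parameter $\sigma^2$ (for every unit $u$ and $t\in\mathbb R$, $\log\mathbb E e^{t\langle u,x\rangle}\le\sigma^2t^2/2$), and $\mathbf X^T\mathbf X$ is almost surely positive definite; $\mathbf X\in\mathcal O_n(p)$ means $\mathbf X^T\mathbf X=nI_p$. For an integer $s$ and $A>0$, $\Xi(s,A)=\{\boldsymbol\beta\in\mathbb R^p:|\mathrm{supp}(\boldsymbol\beta)|=s,\ |\beta_i|\ge A\text{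 for }i\in\mathrm{supp}(\boldsymbol\beta)\}$. A test $T$ is a measurable $[0,1]$-valued function of $(\mathbf y,\mathbf X)$; $\mathbb P_{\boldsymbol\beta},\mathbb E_{\boldsymbol\beta}$ denote the law/expectation of $(\mathbf y,\mathbf X)$ (including the randomness of $\mathbf X$) under parameter $\boldsymbol\beta$, and $\mathbb P_0,\mathbb E_0$ those under $\boldsymbol\beta=0$. $\mathrm{Risk}(T,s,A)=\mathbb E_0[T]+\sup_{\boldsymbol\beta\in\Xi(s,A)}\mathbb E_{\boldsymbol\beta}[1-T]$ and $\mathrm{Risk}(s,A)=\inf_T\mathrm{Risk}(T,s,A)$. The sparsity is $s=p^{1-\alpha}$ (rounded to an integer) with $\alpha$ fixed; all limits are as $p\to\infty$. *)

theory Defs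
  imports "HOL-Probability.Probability"
begin

text \<open>A vector in R^m is an extensional function on {..<m}; an n x p real matrix is an
extensional function on {..<n} x {..<p}, entry (i,j) = row i, column j.\<close>

definition vec_space :: "nat \<Rightarrow> (nat \<Rightarrow> real) measure" where
  "vec_space m = PiM {..<m} (\<lambda>_. borel)"

definition mat_space :: "nat \<Rightarrow> nat \<Rightarrow> (nat \<times> nat \<Rightarrow> real) measure" where
  "mat_space n p = PiM ({..<n} \<times> {..<p}) (\<lambda>_. borel)"

definition gauss :: "nat \<Rightarrow> (nat \<Rightarrow> real) measure" where
  "gauss n = PiM {..<n} (\<lambda>_. density lborel (\<lambda>x. ennreal (std_normal_density x)))"

definition obs :: "nat \<Rightarrow> nat \<Rightarrow> (nat \<times> nat \<Rightarrow> real) \<Rightarrow> (nat \<Rightarrow> real) \<Rightarrow> (nat \<Rightarrow> real) \<Rightarrow> (nat \<Rightarrow> real)" where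
  "obs n p X \<beta> \<epsilon> = (\<lambda>i\<in>{..<n}. (\<Sum>j<p. X (i, j) * \<beta> j) + \<epsilon> i)"

definition tests :: "nat \<Rightarrow> nat \<Rightarrow> ((nat \<Rightarrow> real) \<times> (nat \<times> nat \<Rightarrow> real) \<Rightarrow> real) set" where
  "tests n p = {T. T \<in> borel_measurable (vec_space n \<Otimes>\<^sub>M mat_space n p) \<and>
                   (\<forall>z\<in>space (vec_space n \<Otimes>\<^sub>M mat_space n p). 0 \<le> T z \<and> T z \<le> 1)}"

text \<open>E_beta[f(y,X)], where X has law D (a probability measure on n x p matrices) and
  eps ~ N(0,I_n) is independent of X.\<close>
definition Ebeta :: "(nat \<times> nat \<Rightarrow> real) measure \<Rightarrow> nat \<Rightarrow> nat \<Rightarrow> (nat \<Rightarrow> real)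
     \<Rightarrow> ((nat \<Rightarrow> real) \<times> (nat \<times> nat \<Rightarrow> real) \<Rightarrow> real) \<Rightarrow> real" where
  "Ebeta D n p \<beta> f = (\<integral>X. (\<integral>\<epsilon>. f (obs n p X \<beta> \<epsilon>, X) \<partial>gauss n) \<partial>D)"

definition Xi :: "nat \<Rightarrow> nat \<Rightarrow> real \<Rightarrow> (nat \<Rightarrow> real) set" where
  "Xi p s A = {\<beta>. (\<forall>j\<ge>p. \<beta> j = 0) \<and> card {i. \<beta> i \<noteq> 0} = s \<and> (\<forall>i. \<beta> i \<noteq> 0 \<longrightarrow> \<bar>\<beta> i\<bar> \<ge> A)}"

definition RiskT :: "(nat \<times> nat \<Rightarrow> real) measure \<Rightarrow> nat \<Rightarrow> nat
     \<Rightarrow> ((nat \<Rightarrow> real) \<times> (nat \<times> nat \<Rightarrow> real) \<Rightarrow> real) \<Rightarrow> nat \<Rightarrow> real \<Rightarrow> real" where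
  "RiskT D n p T s A = Ebeta D n p (\<lambda>_. 0) T + (SUP \<beta>\<in>Xi p s A. Ebeta D n p \<beta> (\<lambda>z. 1 - T z))"

definition Risk :: "(nat \<times> nat \<Rightarrow> real) measure \<Rightarrow> nat \<Rightarrow> nat \<Rightarrow> nat \<Rightarrow> real \<Rightarrow> real" where
  "Risk D n p s A = (INF T\<in>tests n p. RiskT D n p T s A)"

definition gram :: "nat \<Rightarrow> (nat \<times> nat \<Rightarrow> real) \<Rightarrow> nat \<Rightarrow> nat \<Rightarrow> real" where
  "gram n X j k = (\<Sum>i<n. X (i, j) * X (i, k))"

definition pos_def :: "nat \<Rightarrow> (nat \<Rightarrow> nat \<Rightarrow> real) \<Rightarrow> bool" where
  "pos_def p M \<longleftrightarrow> (\<forall>v. (\<exists>j<p. v j \<noteq> 0) \<longrightarrow> (\<Sum>j<p. \<Sum>k<p. v j * M j k * v k) > 0)"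

definition iid_rows :: "nat \<Rightarrow> nat \<Rightarrow> (nat \<Rightarrow> real) measure \<Rightarrow> (nat \<times> nat \<Rightarrow> real) measure" where
  "iid_rows n p R = distr (PiM {..<n} (\<lambda>_. R)) (mat_space n p)
                       (\<lambda>rows. \<lambda>(i, j)\<in>{..<n} \<times> {..<p}. rows i j)"

definition subg_row :: "nat \<Rightarrow> real \<Rightarrow> (nat \<Rightarrow> real) measure \<Rightarrow> bool" where
  "subg_row p \<sigma>2 R \<longleftrightarrow>
     prob_space R \<and> sets R = sets (vec_space p) \<and>
     (\<forall>j<p. integrable R (\<lambda>x. x j) \<and> (\<integral>x. x j \<partial>R) = 0) \<and>
     (\<forall>j<p. \<forall>k<p. integrable R (\<lambda>x. x j * x k) \<and>
                   (\<integral>x. x j * x k \<partial>R) = (if j = k then 1 else 0)) \<and>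
     (\<forall>u t. (\<forall>j\<ge>p. u j = 0) \<longrightarrow> (\<Sum>j<p. (u j)\<^sup>2) = 1 \<longrightarrow>
        integrable R (\<lambda>x. exp (t * (\<Sum>j<p. u j * x j))) \<and>
        ln (\<integral>x. exp (t * (\<Sum>j<p. u j * x j)) \<partial>R) \<le> \<sigma>2 * t\<^sup>2 / 2)"

definition SubG :: "nat \<Rightarrow> nat \<Rightarrow> real \<Rightarrow> (nat \<times> nat \<Rightarrow> real) measure \<Rightarrow> bool" where
  "SubG n p \<sigma>2 D \<longleftrightarrow>
     (\<exists>R. subg_row p \<sigma>2 R \<and> D = iid_rows n p R) \<and>
     (AE X in D. pos_def p (gram n X))"

definition Orth :: "nat \<Rightarrow> nat \<Rightarrow> (nat \<times> nat \<Rightarrow> real) measure \<Rightarrow> bool" where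
  "Orth n p D \<longleftrightarrow> prob_space D \<and> sets D = sets (mat_space n p) \<and>
     (AE X in D. \<forall>j<p. \<forall>k<p. gram n X j k = (if j = k then real n else 0))"

end

theory Submission
  imports Defs
begin

text \<open>
  Let \<open>S\<close> be the squared norm of the projection of \<open>y\<close> onto the column space of \<open>X\<close>, a (noncentral)
  chi-square variable with \<open>p\<close> degrees of freedom given \<open>X\<close>; put \<open>\<Lambda> = p powr (1/2 + \<delta>)\<close> and
  \<open>x = \<Lambda>\<^sup>2 / p = p powr (2 * \<delta>)\<close>. The test that rejects for \<open>S > p + \<Lambda> / 2\<close> has both errors at most
  \<open>exp (- x / 16 + o(x))\<close>, by Chernoff's bound with \<open>t = \<Lambda> / (4 * p)\<close>.

  Conversely the risk dominates \<open>E\<^sub>0 (min 1 L)\<close>, where \<open>L\<close> is the likelihood ratio of the mixture over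
  vectors with one entry \<open>A\<close> or \<open>-A\<close> in each of \<open>s\<close> disjoint blocks. Let \<open>Q\<close> have density
  \<open>w = (1 - 2 * t) powr (p / 2) * exp (t * S)\<close>, which lies halfway between the hypotheses. Under \<open>Q\<close> the statistic \<open>S\<close>
  concentrates around \<open>p + \<Lambda> / 2\<close>, and \<open>V = L * exp (- 2 * t * S)\<close> has \<open>E V\<^sup>2 \<le> (E V)\<^sup>2 * exp (o(x))\<close>. By a
  Paley--Zygmund argument both \<open>1 / w\<close> and \<open>L / w\<close> are at least \<open>exp (- x / 16 - o(x))\<close> with \<open>Q\<close>-probability \<open>exp (- o(x))\<close>.

  The design enters only through \<open>E exp (c \<langle>X\<beta>, X\<beta>'\<rangle> - d (|X\<beta>|\<^sup>2 + |X\<beta>'|\<^sup>2))\<close>. For sub-Gaussian rows this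
  factorises over the rows, and the second-order expansion of each factor costs only \<open>O((n |\<beta>|\<^sup>2)\<^sup>2 / n)\<close> in the exponent.
\<close>

section \<open>Gaussian integrals\<close>

text \<open>The constant 1/16 is a Gaussian tail. Under the null \<open>S\<close> has variance
  \<open>2 * p\<close>, the weakest alternatives raise its mean by about \<open>\<Lambda>\<close>,
  and a threshold halfway between costs
  \<open>(\<Lambda> / 2)\<^sup>2 / (2 * (2 * p)) = x / 16\<close>. A second moment under the null is
  too crude to match this: for an orthogonal design \<open>E\<^sub>0 L\<^sup>2\<close> is only
  bounded by about \<open>exp (x / 2)\<close>, so Paley--Zygmund would give the exponent
  \<open>- x / 2\<close>. Most of the fluctuation of \<open>L\<close> is that of \<open>S\<close>,
  because \<open>L\<close> behaves to leading order like a constant times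
  \<open>exp (2 * t * S)\<close>. Dividing this factor out leaves a variable that is nearly constant
  on the exponential scale, and tilting by half of it makes \<open>1 / w\<close> and
  \<open>L / w\<close> equally large. All errors are compared with \<open>x\<close>: the terms in
  \<open>p * t\<close> cancel, \<open>p * t\<^sup>2 = x / 16\<close> decides the constant, and
  \<open>p * t ^ 3 = x * t / 16\<close> is negligible because \<open>t\<close> tends to 0.\<close>

lemma prob_space_std_normal: "prob_space std_normal_distribution"
  by (rule prob_space_normal_density) simp

lemma product_sigma_finite_std_normal: "product_sigma_finite (\<lambda>_::'i. std_normal_distribution)"
  by (intro product_sigma_finite.intro prob_space_imp_sigma_finite prob_space_std_normal)

lemma prob_space_gauss: "prob_space (gauss n)"
  unfolding gauss_def by (intro prob_space_PiM prob_space_std_normal)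

lemma sets_gauss [measurable_cong, simp]: "sets (gauss n) = sets (vec_space n)"
  unfolding gauss_def vec_space_def by (intro sets_PiM_cong) auto

lemma space_vec_space [simp]: "space (vec_space n) = {..<n} \<rightarrow>\<^sub>E UNIV"
  by (simp add: vec_space_def space_PiM)

lemma measurable_vec_component [measurable]:
  "i < n \<Longrightarrow> (\<lambda>x. x i) \<in> borel_measurable (vec_space n)"
  unfolding vec_space_def by (rule measurable_component_singleton) auto

lemma measurable_gauss_component [measurable]:
  "i < n \<Longrightarrow> (\<lambda>x. x i) \<in> borel_measurable (gauss n)"
  using measurable_vec_component by (simp cong: measurable_cong_sets)

lemma space_gauss [simp]: "space (gauss n) = {..<n} \<rightarrow>\<^sub>E UNIV"
  using sets_eq_imp_space_eq[OF sets_gauss[of n]] by simp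

text \<open>Completing the square with \<open>v = 1 - 2*t\<close> turns the integrand into a
  constant times the normal density of mean \<open>h/v\<close> and variance
  \<open>1/v\<close>.\<close>

lemma has_bochner_integral_std_normal_exp_quadratic:
  fixes t h :: real
  assumes "t < 1/2"
  shows "has_bochner_integral std_normal_distribution (\<lambda>x. exp (t * x\<^sup>2 + h * x))
           (exp (h\<^sup>2 / (2 * (1 - 2*t))) / sqrt (1 - 2*t))"
proof -
  define v where "v = 1 - 2*t"
  have v: "v > 0" using assms by (simp add: v_def)
  define K where "K = exp (h\<^sup>2 / (2 * v)) / sqrt v"
  have eq: "std_normal_density x *\<^sub>R exp (t * x\<^sup>2 + h * x) = K * normal_density (h/v) (1 / sqrt v) x" for x
  proof -
    have "- x\<^sup>2/2 + (t * x\<^sup>2 + h * x) = h\<^sup>2 / (2 * v) + (- ((x - h/v)\<^sup>2 / (2 * (1 / sqrt v)\<^sup>2)))"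
      using v by (simp add: power_divide field_simps power2_eq_square) (simp add: v_def algebra_simps)
    then have "exp (- x\<^sup>2/2) * exp (t * x\<^sup>2 + h * x) = exp (h\<^sup>2 / (2 * v)) * exp (- ((x - h/v)\<^sup>2 / (2 * (1 / sqrt v)\<^sup>2)))"
      by (simp flip: exp_add)
    then show ?thesis
      using v by (simp add: normal_density_def K_def real_sqrt_divide real_sqrt_mult power_divide field_simps)
  qed
  have "has_bochner_integral lborel (\<lambda>x. normal_density (h/v) (1 / sqrt v) x) 1"
    using v by (simp add: has_bochner_integral_iff)
  then have "has_bochner_integral lborel (\<lambda>x. K * normal_density (h/v) (1 / sqrt v) x) (K * 1)"
    by (intro has_bochner_integral_mult_right) auto
  then have "has_bochner_integral lborel (\<lambda>x. std_normal_density x *\<^sub>R exp (t * x\<^sup>2 + h * x)) K"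
    unfolding eq by simp
  then show ?thesis
    unfolding K_def v_def by (intro has_bochner_integral_density) auto
qed

text \<open>The imaginary part of \<open>w\<close> is handled by the characteristic function of the
  standard normal law, the real part by translating the line by \<open>h\<close>. Complex exponents
  are needed because the linearisation below has an imaginary coefficient for negative
  \<open>t\<close>.\<close>

lemma has_bochner_integral_std_normal_cexp:
  fixes w :: complex
  shows "has_bochner_integral std_normal_distribution (\<lambda>x. exp (w * complex_of_real x)) (exp (w\<^sup>2 / 2))"
proof -
  define h s where "h = Re w" and "s = Im w"
  have w: "w = complex_of_real h + \<i> * complex_of_real s" by (simp add: h_def s_def complex_eq_iff)
  have "has_bochner_integral lborel (\<lambda>x. std_normal_density x *\<^sub>R iexp (s * x)) (exp (- (s\<^sup>2)/2))"
  proof -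
    interpret real_distribution std_normal_distribution by (rule real_dist_normal_dist)
    have i: "integrable std_normal_distribution (\<lambda>x. iexp (s * x))"
      by (rule integrable_const_bound[where B=1]) auto
    have "(\<integral>x. iexp (s * x) \<partial>std_normal_distribution) = exp (- (s\<^sup>2)/2)"
      using fun_cong[OF char_std_normal_distribution, of s] by (simp add: char_def exp_of_real)
    with i show ?thesis
      by (simp add: has_bochner_integral_iff integrable_density integral_density)
  qed
  then have "has_bochner_integral lborel (\<lambda>x. std_normal_density (-h + 1 * x) *\<^sub>R iexp (s * (-h + 1 * x))) (exp (- (s\<^sup>2)/2))"
    by (subst (asm) lborel_has_bochner_integral_real_affine_iff[where c=1 and t="-h"]) auto
  then have "has_bochner_integral lborel (\<lambda>x. exp (h\<^sup>2/2 + \<i> * s * h) * (std_normal_density (-h + 1 * x) *\<^sub>R iexp (s * (-h + 1 * x)))) 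
     (exp (h\<^sup>2/2 + \<i> * s * h) * exp (- (s\<^sup>2)/2))"
    by (intro has_bochner_integral_mult_right) auto
  also have "(\<lambda>x. exp (h\<^sup>2/2 + \<i> * s * h) * (std_normal_density (-h + 1 * x) *\<^sub>R iexp (s * (-h + 1 * x))))
      = (\<lambda>x. std_normal_density x *\<^sub>R exp (w * complex_of_real x))"
  proof
    fix x :: real
    have "exp (h\<^sup>2/2 + \<i> * s * h) * (exp (complex_of_real (-((-h+x)\<^sup>2/2))) * iexp (s * (-h + x)))
      = exp (complex_of_real (- x\<^sup>2 / 2)) * exp (w * complex_of_real x)"
      unfolding exp_add[symmetric] w
      by (rule arg_cong[where f=exp]) (simp add: algebra_simps power2_eq_square add_divide_distrib diff_divide_distrib)
    then show "exp (h\<^sup>2/2 + \<i> * s * h) * (std_normal_density (-h + 1 * x) *\<^sub>R iexp (s * (-h + 1 * x)))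
       = std_normal_density x *\<^sub>R exp (w * complex_of_real x)"
      by (simp add: std_normal_density_def scaleR_conv_of_real exp_of_real[symmetric] mult_ac)
  qed
  also have "exp (h\<^sup>2/2 + \<i> * s * h) * exp (- (s\<^sup>2)/2) = exp (w\<^sup>2 / 2)"
    unfolding exp_of_real[symmetric] exp_add[symmetric] w
    by (rule arg_cong[where f=exp]) (simp add: algebra_simps power2_eq_square add_divide_distrib diff_divide_distrib)
  finally show ?thesis by (intro has_bochner_integral_density) auto
qed

lemma gauss_nn_integral_prod:
  assumes "\<And>i. i < n \<Longrightarrow> f i \<in> borel_measurable borel"
  shows "(\<integral>\<^sup>+x. (\<Prod>i<n. f i (x i)) \<partial>gauss n) = (\<Prod>i<n. \<integral>\<^sup>+x. f i x \<partial>std_normal_distribution)"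
  unfolding gauss_def by (rule product_sigma_finite.product_nn_integral_prod[OF product_sigma_finite_std_normal]) (use assms in auto)

lemma has_bochner_integral_gauss_prod:
  fixes f :: "nat \<Rightarrow> real \<Rightarrow> 'a::{real_normed_field,banach,second_countable_topology}"
  assumes "\<And>i. i < n \<Longrightarrow> has_bochner_integral std_normal_distribution (f i) (c i)"
  shows "has_bochner_integral (gauss n) (\<lambda>x. \<Prod>i<n. f i (x i)) (\<Prod>i<n. c i)"
proof -
  have 1: "integrable std_normal_distribution (f i)" "integral\<^sup>L std_normal_distribution (f i) = c i" if "i < n" for i
    using assms[OF that] by (auto simp: has_bochner_integral_iff)
  show ?thesis
    unfolding has_bochner_integral_iff gauss_def
    using product_sigma_finite.product_integrable_prod[OF product_sigma_finite_std_normal, of "{..<n}" f] product_sigma_finite.product_integral_prod[OF product_sigma_finite_std_normal, of "{..<n}" f] 1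
    by simp
qed

lemma gauss_mgf:
  fixes b :: "nat \<Rightarrow> real"
  shows "has_bochner_integral (gauss n) (\<lambda>x. exp (\<Sum>i<n. b i * x i)) (exp ((\<Sum>i<n. (b i)\<^sup>2) / 2))"
proof -
  have "has_bochner_integral std_normal_distribution (\<lambda>x. exp (b i * x)) (exp ((b i)\<^sup>2/2))" for i
    using has_bochner_integral_std_normal_exp_quadratic[of 0 "b i"] by simp
  from has_bochner_integral_gauss_prod[OF this, of n]
  show ?thesis by (simp add: exp_sum sum_divide_distrib)
qed

lemma gauss_cmgf:
  fixes w :: "nat \<Rightarrow> complex"
  shows "has_bochner_integral (gauss n) (\<lambda>x. exp (\<Sum>i<n. w i * complex_of_real (x i))) (exp ((\<Sum>i<n. (w i)\<^sup>2) / 2))"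
  using has_bochner_integral_gauss_prod[OF has_bochner_integral_std_normal_cexp, of n w]
  by (simp add: exp_sum sum_divide_distrib)

definition orthonormal :: "nat \<Rightarrow> nat \<Rightarrow> (nat \<Rightarrow> nat \<Rightarrow> real) \<Rightarrow> bool" where
  "orthonormal n p u \<longleftrightarrow> (\<forall>k<p. \<forall>l<p. (\<Sum>i<n. u k i * u l i) = (if k = l then 1 else 0))"

abbreviation inner_vec :: "nat \<Rightarrow> (nat \<Rightarrow> real) \<Rightarrow> (nat \<Rightarrow> real) \<Rightarrow> real" where
  "inner_vec n u v \<equiv> (\<Sum>i<n. u i * v i)"

text \<open>The identity is bilinear, with \<open>(w k)\<^sup>2\<close> and not its modulus. This is
  the form that \<open>gauss_cmgf\<close> produces, so complex weights are covered together with
  real ones.\<close>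

lemma orthonormal_sum_sq:
  fixes w :: "nat \<Rightarrow> 'a::{real_normed_field}"
  assumes "orthonormal n p u"
  shows "(\<Sum>i<n. (\<Sum>k<p. w k * of_real (u k i))\<^sup>2) = (\<Sum>k<p. (w k)\<^sup>2)"
proof -
  have "(\<Sum>i<n. (\<Sum>k<p. w k * of_real (u k i))\<^sup>2)
      = (\<Sum>i<n. \<Sum>k<p. \<Sum>l<p. w k * w l * of_real (u k i * u l i))"
    by (simp add: power2_eq_square sum_product mult_ac)
  also have "\<dots> = (\<Sum>k<p. \<Sum>l<p. \<Sum>i<n. w k * w l * of_real (u k i * u l i))"
    by (subst sum.swap) (simp add: sum.swap[of _ "{..<p}" "{..<n}"])
  also have "\<dots> = (\<Sum>k<p. \<Sum>l<p. w k * w l * of_real (\<Sum>i<n. u k i * u l i))"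
    by (simp add: sum_distrib_left)
  also have "\<dots> = (\<Sum>k<p. \<Sum>l<p. w k * w l * (if k = l then 1 else 0))"
    using assms unfolding orthonormal_def by (intro sum.cong refl) auto
  also have "\<dots> = (\<Sum>k<p. (w k)\<^sup>2)"
    by (simp add: power2_eq_square if_distrib cong: if_cong)
  finally show ?thesis .
qed

lemma orthonormal_std_basis: "orthonormal p p (\<lambda>k i. if k = i then 1 else 0)"
proof -
  have "(if k = i then 1 else 0) * (if l = i then 1 else (0::real)) = (if k = i then (if k = l then 1 else 0) else 0)"
    for k l i :: nat by auto
  then show ?thesis unfolding orthonormal_def by auto
qed

lemma sum_swap_inner:
  fixes w :: "nat \<Rightarrow> 'a::{real_normed_field}"
  shows "(\<Sum>k<p. w k * of_real (inner_vec n (u k) x)) = (\<Sum>i<n. (\<Sum>k<p. w k * of_real (u k i)) * of_real (x i))"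
  by (simp add: sum_distrib_left sum_distrib_right mult_ac) (rule sum.swap)

text \<open>
  Writing \<open>exp (t z\<^sup>2)\<close> as a Gaussian average of \<open>exp (c g z)\<close> with \<open>c\<^sup>2 = 2 * t\<close> and exchanging the integrals gives a right-hand
  side that does not depend on the orthonormal system. So the value can be read off from the standard basis, and no
  rotation invariance of the Gaussian measure is needed. For \<open>t < 0\<close> the coefficient \<open>c\<close> is imaginary.
\<close>

lemma gauss_linearize_pos:
  fixes t c :: real and h :: "nat \<Rightarrow> real"
  assumes u: "orthonormal n p u" and c: "c\<^sup>2 = 2 * t"
  shows "(\<integral>\<^sup>+x. exp (\<Sum>k<p. t * (inner_vec n (u k) x)\<^sup>2 + h k * inner_vec n (u k) x) \<partial>gauss n)
       = (\<integral>\<^sup>+g. exp ((\<Sum>k<p. (h k + c * g k)\<^sup>2) / 2) \<partial>gauss p)"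
proof -
  interpret n: prob_space "gauss n" by (rule prob_space_gauss)
  interpret p: prob_space "gauss p" by (rule prob_space_gauss)
  interpret P: pair_sigma_finite "gauss n" "gauss p" ..
  have "(\<integral>\<^sup>+x. exp (\<Sum>k<p. t * (inner_vec n (u k) x)\<^sup>2 + h k * inner_vec n (u k) x) \<partial>gauss n)
     = (\<integral>\<^sup>+x. (\<integral>\<^sup>+g. exp (\<Sum>k<p. (h k + c * g k) * inner_vec n (u k) x) \<partial>gauss p) \<partial>gauss n)"
  proof (intro nn_integral_cong)
    fix x :: "nat \<Rightarrow> real"
    have hb: "has_bochner_integral (gauss p) (\<lambda>g. exp (\<Sum>k<p. h k * inner_vec n (u k) x) * exp (\<Sum>k<p. (c * inner_vec n (u k) x) * g k))
        (exp (\<Sum>k<p. h k * inner_vec n (u k) x) * exp ((\<Sum>k<p. (c * inner_vec n (u k) x)\<^sup>2) / 2))"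
      by (intro has_bochner_integral_mult_right gauss_mgf)
    have 1: "exp (\<Sum>k<p. h k * inner_vec n (u k) x) * exp (\<Sum>k<p. (c * inner_vec n (u k) x) * g k)
       = exp (\<Sum>k<p. (h k + c * g k) * inner_vec n (u k) x)" for g
      unfolding exp_add[symmetric] sum.distrib[symmetric]
      by (intro arg_cong[where f=exp] sum.cong) (auto simp: algebra_simps)
    have 2: "exp (\<Sum>k<p. h k * inner_vec n (u k) x) * exp ((\<Sum>k<p. (c * inner_vec n (u k) x)\<^sup>2) / 2)
       = exp (\<Sum>k<p. t * (inner_vec n (u k) x)\<^sup>2 + h k * inner_vec n (u k) x)"
      unfolding exp_add[symmetric] sum_divide_distrib sum.distrib[symmetric]
      by (intro arg_cong[where f=exp] sum.cong) (auto simp: power_mult_distrib c)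
    show "ennreal (exp (\<Sum>k<p. t * (inner_vec n (u k) x)\<^sup>2 + h k * inner_vec n (u k) x))
        = (\<integral>\<^sup>+g. exp (\<Sum>k<p. (h k + c * g k) * inner_vec n (u k) x) \<partial>gauss p)"
      using hb unfolding 1 2 has_bochner_integral_iff by (subst nn_integral_eq_integral) auto
  qed
  also have "\<dots> = (\<integral>\<^sup>+g. (\<integral>\<^sup>+x. exp (\<Sum>k<p. (h k + c * g k) * inner_vec n (u k) x) \<partial>gauss n) \<partial>gauss p)"
    by (rule P.Fubini'[symmetric]) (auto simp: case_prod_beta)
  also have "\<dots> = (\<integral>\<^sup>+g. exp ((\<Sum>k<p. (h k + c * g k)\<^sup>2) / 2) \<partial>gauss p)"
  proof (intro nn_integral_cong)
    fix g :: "nat \<Rightarrow> real"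
    show "(\<integral>\<^sup>+x. exp (\<Sum>k<p. (h k + c * g k) * inner_vec n (u k) x) \<partial>gauss n) = exp ((\<Sum>k<p. (h k + c * g k)\<^sup>2) / 2)"
      using gauss_mgf[of n "\<lambda>i. \<Sum>k<p. (h k + c * g k) * u k i"]
        sum_swap_inner[of "\<lambda>k. h k + c * g k" u _ n p] orthonormal_sum_sq[OF u, of "\<lambda>k. h k + c * g k"]
      by (subst nn_integral_eq_integral) (auto simp: has_bochner_integral_iff)
  qed
  finally show ?thesis .
qed

lemma gauss_linearize_neg:
  fixes t :: real and c :: complex and h :: "nat \<Rightarrow> real"
  assumes u: "orthonormal n p u" and c: "c\<^sup>2 = 2 * of_real t" and c0: "Re c = 0"
  shows "(\<integral>x. complex_of_real (exp (\<Sum>k<p. t * (inner_vec n (u k) x)\<^sup>2 + h k * inner_vec n (u k) x)) \<partial>gauss n)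
       = (\<integral>g. exp ((\<Sum>k<p. (h k + c * g k)\<^sup>2) / 2) \<partial>gauss p)"
proof -
  interpret n: prob_space "gauss n" by (rule prob_space_gauss)
  interpret p: prob_space "gauss p" by (rule prob_space_gauss)
  interpret P: pair_sigma_finite "gauss n" "gauss p" ..
  have "(\<integral>x. complex_of_real (exp (\<Sum>k<p. t * (inner_vec n (u k) x)\<^sup>2 + h k * inner_vec n (u k) x)) \<partial>gauss n)
     = (\<integral>x. (\<integral>g. exp (\<Sum>k<p. (h k + c * g k) * inner_vec n (u k) x) \<partial>gauss p) \<partial>gauss n)"
  proof (intro Bochner_Integration.integral_cong refl)
    fix x :: "nat \<Rightarrow> real"
    define z where "z k = inner_vec n (u k) x" for k
    have hb: "has_bochner_integral (gauss p) (\<lambda>g. exp (\<Sum>k<p. complex_of_real (h k * z k)) * exp (\<Sum>k<p. (c * z k) * g k))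
        (exp (\<Sum>k<p. complex_of_real (h k * z k)) * exp ((\<Sum>k<p. (c * z k)\<^sup>2) / 2))"
      by (intro has_bochner_integral_mult_right gauss_cmgf)
    have 1: "exp (\<Sum>k<p. complex_of_real (h k * z k)) * exp (\<Sum>k<p. (c * z k) * g k)
       = exp (\<Sum>k<p. (h k + c * g k) * z k)" for g :: "nat \<Rightarrow> real"
      unfolding exp_add[symmetric] sum.distrib[symmetric]
      by (intro arg_cong[where f=exp] sum.cong) (auto simp: algebra_simps)
    have 2: "exp (\<Sum>k<p. complex_of_real (h k * z k)) * exp ((\<Sum>k<p. (c * z k)\<^sup>2) / 2)
       = complex_of_real (exp (\<Sum>k<p. t * (z k)\<^sup>2 + h k * z k))"
      unfolding exp_add[symmetric] sum_divide_distrib sum.distrib[symmetric] exp_of_real[symmetric] of_real_sum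
      by (intro arg_cong[where f=exp] sum.cong) (auto simp: power_mult_distrib c simp del: of_real_sum)
    show "complex_of_real (exp (\<Sum>k<p. t * (inner_vec n (u k) x)\<^sup>2 + h k * inner_vec n (u k) x))
        = (\<integral>g. exp (\<Sum>k<p. (h k + c * g k) * inner_vec n (u k) x) \<partial>gauss p)"
      using hb[unfolded 1 2] unfolding has_bochner_integral_iff z_def by (simp del: of_real_sum)
  qed
  also have "\<dots> = (\<integral>g. (\<integral>x. exp (\<Sum>k<p. (h k + c * g k) * inner_vec n (u k) x) \<partial>gauss n) \<partial>gauss p)"
  proof (rule P.Fubini_integral[symmetric])
    let ?b = "\<lambda>i. \<Sum>k<p. h k * u k i"
    \<comment> \<open>As \<open>c\<close> is purely imaginary, the modulus does not depend on
      \<open>g\<close>. One Gaussian moment generating function therefore dominates the integrand on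
      the product space, which justifies Fubini.\<close>
    have nm: "norm (exp (\<Sum>k<p. (h k + c * g k) * inner_vec n (u k) x)) = exp (\<Sum>i<n. ?b i * x i)" for x g :: "nat \<Rightarrow> real"
    proof -
      have "Re (\<Sum>k<p. (h k + c * g k) * inner_vec n (u k) x) = (\<Sum>k<p. h k * inner_vec n (u k) x)"
        unfolding Re_sum by (intro sum.cong refl) (simp add: c0 del: of_real_sum)
      then show ?thesis using sum_swap_inner[of h u x n p] by simp
    qed
    have m: "(\<lambda>(x, g). exp (\<Sum>k<p. (h k + c * g k) * inner_vec n (u k) x)) \<in> borel_measurable (gauss n \<Otimes>\<^sub>M gauss p)"
      unfolding case_prod_beta by measurable
    show "integrable (gauss n \<Otimes>\<^sub>M gauss p) (\<lambda>(x, g). exp (\<Sum>k<p. (h k + c * g k) * inner_vec n (u k) x))"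
    proof (rule P.Fubini_integrable[OF m])
      show "integrable (gauss n) (\<lambda>x. \<integral>y. norm (case (x, y) of (x, g) \<Rightarrow> exp (\<Sum>k<p. (h k + c * g k) * inner_vec n (u k) x)) \<partial>gauss p)"
        using gauss_mgf[of n ?b] unfolding prod.case nm has_bochner_integral_iff by (simp add: p.prob_space)
      show "AE x in gauss n. integrable (gauss p) (\<lambda>y. case (x, y) of (x, g) \<Rightarrow> exp (\<Sum>k<p. (h k + c * g k) * inner_vec n (u k) x))"
      proof (rule AE_I2)
        fix x :: "nat \<Rightarrow> real"
        show "integrable (gauss p) (\<lambda>y. case (x, y) of (x, g) \<Rightarrow> exp (\<Sum>k<p. (h k + c * g k) * inner_vec n (u k) x))"
          unfolding prod.case
          by (rule p.integrable_const_bound[where B="exp (\<Sum>i<n. ?b i * x i)"]) (auto simp: nm simp del: norm_exp_eq_Re of_real_sum of_real_mult)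
      qed
    qed
  qed
  also have "\<dots> = (\<integral>g. exp ((\<Sum>k<p. (h k + c * g k)\<^sup>2) / 2) \<partial>gauss p)"
  proof (intro Bochner_Integration.integral_cong refl)
    fix g :: "nat \<Rightarrow> real"
    show "(\<integral>x. exp (\<Sum>k<p. (h k + c * g k) * inner_vec n (u k) x) \<partial>gauss n) = exp ((\<Sum>k<p. (h k + c * g k)\<^sup>2) / 2)"
      using gauss_cmgf[of n "\<lambda>i. \<Sum>k<p. (h k + c * g k) * of_real (u k i)"]
        sum_swap_inner[of "\<lambda>k. h k + c * g k" u _ n p] orthonormal_sum_sq[OF u, of "\<lambda>k. h k + c * g k"]
      by (auto simp: has_bochner_integral_iff)
  qed
  finally show ?thesis .
qed

lemma gauss_exp_quadratic:
  fixes t :: real and h :: "nat \<Rightarrow> real"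
  assumes u: "orthonormal n p u" and t: "t < 1/2"
  shows "has_bochner_integral (gauss n) (\<lambda>x. exp (\<Sum>k<p. t * (inner_vec n (u k) x)\<^sup>2 + h k * inner_vec n (u k) x))
           ((1 - 2*t) powr (- real p / 2) * exp ((\<Sum>k<p. (h k)\<^sup>2) / (2 * (1 - 2*t))))"
proof -
  let ?e = "\<lambda>k i::nat. if k = i then 1 else (0::real)"
  let ?F = "\<lambda>n u x. exp (\<Sum>k<p. t * (inner_vec n (u k) x)\<^sup>2 + h k * inner_vec n (u k) x)"
  let ?V = "(1 - 2*t) powr (- real p / 2) * exp ((\<Sum>k<p. (h k)\<^sup>2) / (2 * (1 - 2*t)))"
  have "has_bochner_integral (gauss p) (\<lambda>x. \<Prod>k<p. exp (t * (x k)\<^sup>2 + h k * x k)) (\<Prod>k<p. exp ((h k)\<^sup>2 / (2 * (1 - 2*t))) / sqrt (1 - 2*t))"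
    by (intro has_bochner_integral_gauss_prod has_bochner_integral_std_normal_exp_quadratic t)
  also have "(\<Prod>k<p. exp ((h k)\<^sup>2 / (2 * (1 - 2*t))) / sqrt (1 - 2*t)) = exp (\<Sum>k<p. (h k)\<^sup>2 / (2 * (1 - 2*t))) / sqrt (1 - 2*t) ^ p"
    by (simp add: exp_sum prod_dividef)
  also have "sqrt (1 - 2*t) ^ p = (1 - 2*t) powr (real p / 2)"
    using t by (simp add: powr_half_sqrt[symmetric] powr_powr flip: powr_realpow)
  finally have "has_bochner_integral (gauss p) (\<lambda>x. \<Prod>k<p. exp (t * (x k)\<^sup>2 + h k * x k)) ?V"
    by (simp add: powr_minus_divide sum_divide_distrib)
  moreover have "?F p ?e x = (\<Prod>k<p. exp (t * (x k)\<^sup>2 + h k * x k))" for x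
    unfolding exp_sum[OF finite_lessThan]
    by (intro prod.cong refl) (simp add: if_distrib[of "\<lambda>a. a * _"] cong: if_cong)
  ultimately have e: "has_bochner_integral (gauss p) (?F p ?e) ?V"
    by simp
  show ?thesis
  proof (cases "t \<ge> 0")
    case True
    then have c: "(sqrt (2*t))\<^sup>2 = 2 * t" by simp
    have "(\<integral>\<^sup>+x. ?F n u x \<partial>gauss n) = (\<integral>\<^sup>+x. ?F p ?e x \<partial>gauss p)"
      by (simp only: gauss_linearize_pos[OF u c] gauss_linearize_pos[OF orthonormal_std_basis c])
    also have "\<dots> = ennreal ?V"
      using e by (subst nn_integral_eq_integral) (auto simp: has_bochner_integral_iff)
    finally show ?thesis
      by (intro has_bochner_integral_nn_integral) auto
  next
    case False
    let ?c = "\<i> * complex_of_real (sqrt (-2*t))"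
    have c: "?c\<^sup>2 = 2 * of_real t" "Re ?c = 0"
      using False by (auto simp: power_mult_distrib simp flip: of_real_power)
    have "complex_of_real (\<integral>x. ?F n u x \<partial>gauss n) = complex_of_real (\<integral>x. ?F p ?e x \<partial>gauss p)"
      unfolding integral_complex_of_real[symmetric]
      by (simp only: gauss_linearize_neg[OF u c] gauss_linearize_neg[OF orthonormal_std_basis c])
    also have "(\<integral>x. ?F p ?e x \<partial>gauss p) = ?V"
      using e by (auto simp: has_bochner_integral_iff)
    finally have v: "(\<integral>x. ?F n u x \<partial>gauss n) = ?V" by (simp only: of_real_eq_iff)
    \<comment> \<open>The value of a Bochner integral does not entail integrability, so this is
      shown separately: for \<open>t < 0\<close> the quadratic term only lowers the
      exponent.\<close>
    have i: "integrable (gauss n) (?F n u)"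
    proof (rule Bochner_Integration.integrable_bound)
      show "integrable (gauss n) (\<lambda>x. exp (\<Sum>i<n. (\<Sum>k<p. h k * u k i) * x i))"
        using gauss_mgf[of n "\<lambda>i. \<Sum>k<p. h k * u k i"] by (simp add: has_bochner_integral_iff)
      show "AE x in gauss n. norm (?F n u x) \<le> norm (exp (\<Sum>i<n. (\<Sum>k<p. h k * u k i) * x i))"
      proof (rule AE_I2)
        fix x :: "nat \<Rightarrow> real"
        have "(\<Sum>k<p. t * (inner_vec n (u k) x)\<^sup>2 + h k * inner_vec n (u k) x) \<le> (\<Sum>k<p. h k * inner_vec n (u k) x)"
          using False by (intro sum_mono) (simp add: mult_nonpos_nonneg)
        then show "norm (?F n u x) \<le> norm (exp (\<Sum>i<n. (\<Sum>k<p. h k * u k i) * x i))"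
          using sum_swap_inner[of h u x n p] by simp
      qed
    qed measurable
    show ?thesis using v i by (simp add: has_bochner_integral_iff)
  qed
qed

section \<open>Translated Gaussian measures and the likelihood ratio\<close>

lemma emeasure_distr_nn_integral:
  assumes "T \<in> M \<rightarrow>\<^sub>M N" "A \<in> sets N"
  shows "emeasure (distr M N T) A = (\<integral>\<^sup>+x. indicator A (T x) \<partial>M)"
  using nn_integral_distr[OF assms(1), of "indicator A"] assms(2) by simp

lemma std_normal_shift:
  "distr std_normal_distribution borel (\<lambda>x. a + x) = density std_normal_distribution (\<lambda>x. ennreal (exp (a * x - a\<^sup>2/2)))"
proof (rule measure_eqI)
  fix A assume A: "A \<in> sets (distr std_normal_distribution borel (\<lambda>x. a + x))"
  then have [measurable]: "A \<in> sets borel" by simp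
  have "emeasure (distr std_normal_distribution borel (\<lambda>x. a + x)) A = (\<integral>\<^sup>+x. indicator A (a + x) \<partial>std_normal_distribution)"
    by (subst emeasure_distr_nn_integral) auto
  also have "\<dots> = (\<integral>\<^sup>+x. ennreal (std_normal_density x) * indicator A (a + x) \<partial>lborel)"
    by (subst nn_integral_density) auto
  also have "\<dots> = (\<integral>\<^sup>+x. ennreal (std_normal_density (x - a)) * indicator A x \<partial>lborel)"
    by (subst nn_integral_real_affine[where c=1 and t="a", of "\<lambda>x. ennreal (std_normal_density (x - a)) * indicator A x"]) auto
  also have "\<dots> = (\<integral>\<^sup>+x. ennreal (std_normal_density x) * (ennreal (exp (a * x - a\<^sup>2/2)) * indicator A x) \<partial>lborel)"
  proof (intro nn_integral_cong)
    fix x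
    have "std_normal_density (x - a) = std_normal_density x * exp (a * x - a\<^sup>2/2)"
      by (simp add: std_normal_density_def exp_add[symmetric] power2_diff diff_divide_distrib add_divide_distrib algebra_simps)
    then show "ennreal (std_normal_density (x - a)) * indicator A x = ennreal (std_normal_density x) * (ennreal (exp (a * x - a\<^sup>2/2)) * indicator A x)"
      by (simp add: ennreal_mult mult.assoc)
  qed
  also have "\<dots> = (\<integral>\<^sup>+x. ennreal (exp (a * x - a\<^sup>2/2)) * indicator A x \<partial>std_normal_distribution)"
    by (subst nn_integral_density) auto
  also have "\<dots> = emeasure (density std_normal_distribution (\<lambda>x. ennreal (exp (a * x - a\<^sup>2/2)))) A"
    by (subst emeasure_density) auto
  finally show "emeasure (distr std_normal_distribution borel (\<lambda>x. a + x)) A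
    = emeasure (density std_normal_distribution (\<lambda>x. ennreal (exp (a * x - a\<^sup>2/2)))) A" .
qed simp

lemma measurable_shift [measurable]:
  "(\<lambda>x. \<lambda>i\<in>{..<n}. \<mu> i + x i) \<in> vec_space n \<rightarrow>\<^sub>M vec_space n"
  unfolding vec_space_def by measurable

text \<open>Cameron--Martin formula. Both sides equal the product of the shifted one-dimensional
  laws, since both have its values on rectangles.\<close>

lemma gauss_shift:
  "distr (gauss n) (vec_space n) (\<lambda>x. \<lambda>i\<in>{..<n}. \<mu> i + x i)
     = density (gauss n) (\<lambda>x. ennreal (exp (inner_vec n \<mu> x - (\<Sum>i<n. (\<mu> i)\<^sup>2) / 2)))"
proof -
  let ?M = "\<lambda>i. distr std_normal_distribution borel (\<lambda>x. \<mu> i + x)"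
  have ps: "prob_space (?M i)" for i
    by (rule prob_space.prob_space_distr[OF prob_space_std_normal]) auto
  interpret M: product_sigma_finite ?M
    by (intro product_sigma_finite.intro prob_space_imp_sigma_finite ps)
  have s: "sets (PiM {..<n} ?M) = sets (vec_space n)"
    unfolding vec_space_def by (intro sets_PiM_cong) auto
  \<comment> \<open>Extensionality of \<open>x\<close> is essential: membership in
    \<open>Pi\<^sub>E\<close> also constrains the arguments outside \<open>{..<n}\<close>, which the
    product of indicators does not see.\<close>
  have ind: "indicator (Pi\<^sub>E {..<n} A) x = (\<Prod>i<n. indicator (A i) (x i) :: ennreal)"
    if ext: "x \<in> extensional {..<n}" for A and x :: "nat \<Rightarrow> real"
  proof (cases "x \<in> Pi\<^sub>E {..<n} A")
    case True then show ?thesis by (auto simp: PiE_iff)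
  next
    case False
    then obtain i where i: "i < n" "x i \<notin> A i" using ext by (auto simp: PiE_iff)
    then have "(\<Prod>i<n. indicator (A i) (x i) :: ennreal) = 0"
      by (intro prod_zero) (auto intro!: bexI[of _ i])
    then show ?thesis using False by simp
  qed
  have "distr (gauss n) (vec_space n) (\<lambda>x. \<lambda>i\<in>{..<n}. \<mu> i + x i) = PiM {..<n} ?M"
  proof (rule M.PiM_eqI)
    fix A assume A: "\<And>i. i \<in> {..<n} \<Longrightarrow> A i \<in> sets (?M i)"
    have [measurable]: "Pi\<^sub>E {..<n} A \<in> sets (vec_space n)"
      unfolding s[symmetric] using A by (intro sets_PiM_I_finite) auto
    have "emeasure (distr (gauss n) (vec_space n) (\<lambda>x. \<lambda>i\<in>{..<n}. \<mu> i + x i)) (Pi\<^sub>E {..<n} A)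
        = (\<integral>\<^sup>+x. indicator (Pi\<^sub>E {..<n} A) (\<lambda>i\<in>{..<n}. \<mu> i + x i) \<partial>gauss n)"
      by (subst emeasure_distr_nn_integral) auto
    also have "\<dots> = (\<integral>\<^sup>+x. (\<Prod>i<n. indicator (A i) (\<mu> i + x i)) \<partial>gauss n)"
      by (intro nn_integral_cong) (simp add: ind)
    also have "\<dots> = (\<Prod>i<n. \<integral>\<^sup>+x. indicator (A i) (\<mu> i + x) \<partial>std_normal_distribution)"
      by (rule gauss_nn_integral_prod) (use A in \<open>auto intro!: borel_measurable_indicator'\<close>)
    also have "\<dots> = (\<Prod>i<n. emeasure (?M i) (A i))"
    proof (rule prod.cong[OF refl])
      fix i assume "i \<in> {..<n}"
      then have [measurable]: "A i \<in> sets borel" using A[of i] by simp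
      show "(\<integral>\<^sup>+x. indicator (A i) (\<mu> i + x) \<partial>std_normal_distribution) = emeasure (?M i) (A i)"
        by (subst emeasure_distr_nn_integral) auto
    qed
    finally show "emeasure (distr (gauss n) (vec_space n) (\<lambda>x. \<lambda>i\<in>{..<n}. \<mu> i + x i)) (Pi\<^sub>E {..<n} A)
        = (\<Prod>i<n. emeasure (?M i) (A i))" .
  qed (auto simp: s)
  also have "PiM {..<n} ?M = density (gauss n) (\<lambda>x. ennreal (exp (inner_vec n \<mu> x - (\<Sum>i<n. (\<mu> i)\<^sup>2) / 2)))"
  proof (rule M.PiM_eqI[symmetric])
    fix A assume A: "\<And>i. i \<in> {..<n} \<Longrightarrow> A i \<in> sets (?M i)"
    have [measurable]: "Pi\<^sub>E {..<n} A \<in> sets (vec_space n)"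
      unfolding s[symmetric] using A by (intro sets_PiM_I_finite) auto
    have "emeasure (density (gauss n) (\<lambda>x. ennreal (exp (inner_vec n \<mu> x - (\<Sum>i<n. (\<mu> i)\<^sup>2) / 2)))) (Pi\<^sub>E {..<n} A)
        = (\<integral>\<^sup>+x. ennreal (exp (inner_vec n \<mu> x - (\<Sum>i<n. (\<mu> i)\<^sup>2) / 2)) * indicator (Pi\<^sub>E {..<n} A) x \<partial>gauss n)"
      by (subst emeasure_density) auto
    also have "\<dots> = (\<integral>\<^sup>+x. (\<Prod>i<n. ennreal (exp (\<mu> i * x i - (\<mu> i)\<^sup>2/2)) * indicator (A i) (x i)) \<partial>gauss n)"
    proof (intro nn_integral_cong)
      fix x assume "x \<in> space (gauss n)"
      then have "x \<in> extensional {..<n}" by (auto simp: PiE_iff)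
      moreover have "ennreal (exp (inner_vec n \<mu> x - (\<Sum>i<n. (\<mu> i)\<^sup>2) / 2)) = (\<Prod>i<n. ennreal (exp (\<mu> i * x i - (\<mu> i)\<^sup>2/2)))"
        by (simp add: prod_ennreal exp_sum[symmetric] sum_subtractf sum_divide_distrib)
      ultimately show "ennreal (exp (inner_vec n \<mu> x - (\<Sum>i<n. (\<mu> i)\<^sup>2) / 2)) * indicator (Pi\<^sub>E {..<n} A) x
        = (\<Prod>i<n. ennreal (exp (\<mu> i * x i - (\<mu> i)\<^sup>2/2)) * indicator (A i) (x i))"
        by (simp add: ind prod.distrib)
    qed
    also have "\<dots> = (\<Prod>i<n. \<integral>\<^sup>+x. ennreal (exp (\<mu> i * x - (\<mu> i)\<^sup>2/2)) * indicator (A i) x \<partial>std_normal_distribution)"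
      by (rule gauss_nn_integral_prod) (use A in auto)
    also have "\<dots> = (\<Prod>i<n. emeasure (?M i) (A i))"
      unfolding std_normal_shift using A by (intro prod.cong refl) (auto simp: emeasure_density)
    finally show "emeasure (density (gauss n) (\<lambda>x. ennreal (exp (inner_vec n \<mu> x - (\<Sum>i<n. (\<mu> i)\<^sup>2) / 2)))) (Pi\<^sub>E {..<n} A)
        = (\<Prod>i<n. emeasure (?M i) (A i))" .
  qed (auto simp: s)
  finally show ?thesis .
qed

definition mat_vec :: "nat \<Rightarrow> (nat \<times> nat \<Rightarrow> real) \<Rightarrow> (nat \<Rightarrow> real) \<Rightarrow> nat \<Rightarrow> real" where
  "mat_vec p X \<beta> i = (\<Sum>j<p. X (i, j) * \<beta> j)"

definition sq_norm :: "nat \<Rightarrow> (nat \<Rightarrow> real) \<Rightarrow> real" where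
  "sq_norm n v = (\<Sum>i<n. (v i)\<^sup>2)"

text \<open>Density of the law N(X\<beta>, I) with respect to N(0, I), at the observation
  \<open>y\<close>.\<close>

definition lik :: "nat \<Rightarrow> nat \<Rightarrow> (nat \<Rightarrow> real) \<Rightarrow> (nat \<times> nat \<Rightarrow> real) \<Rightarrow> (nat \<Rightarrow> real) \<Rightarrow> real" where
  "lik n p \<beta> X y = exp (inner_vec n (mat_vec p X \<beta>) y - sq_norm n (mat_vec p X \<beta>) / 2)"

lemma lik_pos [simp]: "lik n p \<beta> X y > 0"
  by (simp add: lik_def)

lemma measurable_lik [measurable]: "lik n p \<beta> X \<in> borel_measurable (vec_space n)"
  unfolding lik_def by measurable

text \<open>This moves \<open>\<beta>\<close> from the argument of \<open>f\<close> into a weight.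
  Afterwards all parameters are compared pointwise under the single measure
  \<open>gauss n\<close>.\<close>

lemma obs_change_of_measure:
  fixes f :: "(nat \<Rightarrow> real) \<Rightarrow> real"
  assumes [measurable]: "f \<in> borel_measurable (vec_space n)"
  shows "(\<integral>\<epsilon>. f (obs n p X \<beta> \<epsilon>) \<partial>gauss n) = (\<integral>y. lik n p \<beta> X y * f y \<partial>gauss n)"
proof -
  have "(\<integral>\<epsilon>. f (obs n p X \<beta> \<epsilon>) \<partial>gauss n)
      = integral\<^sup>L (distr (gauss n) (vec_space n) (\<lambda>x. \<lambda>i\<in>{..<n}. mat_vec p X \<beta> i + x i)) f"
    by (subst integral_distr) (auto simp: obs_def mat_vec_def)
  also have "\<dots> = (\<integral>y. lik n p \<beta> X y * f y \<partial>gauss n)"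
    unfolding gauss_shift lik_def sq_norm_def by (subst integral_density) auto
  finally show ?thesis .
qed

section \<open>Gram--Schmidt and the projection statistic\<close>

text \<open>An explicit recursion instead of a chosen basis, because a test has to be a measurable
  function of \<open>(y, X)\<close>. When a residual vanishes, division by zero makes the vector
  zero, so the function is total; full rank, which holds almost surely, excludes this case.\<close>

fun gram_schmidt :: "nat \<Rightarrow> (nat \<times> nat \<Rightarrow> real) \<Rightarrow> nat \<Rightarrow> nat \<Rightarrow> real" where
  "gram_schmidt n X k =
     (let r = (\<lambda>i. X (i, k) - (\<Sum>l<k. (\<Sum>i'<n. X (i', k) * gram_schmidt n X l i') * gram_schmidt n X l i))
      in (\<lambda>i. r i / sqrt (\<Sum>i'<n. (r i')\<^sup>2)))"

declare gram_schmidt.simps [simp del]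

definition gs_residual :: "nat \<Rightarrow> (nat \<times> nat \<Rightarrow> real) \<Rightarrow> nat \<Rightarrow> nat \<Rightarrow> real" where
  "gs_residual n X k i = X (i, k) - (\<Sum>l<k. (\<Sum>i'<n. X (i', k) * gram_schmidt n X l i') * gram_schmidt n X l i)"

lemma gram_schmidt_eq: "gram_schmidt n X k i = gs_residual n X k i / sqrt (\<Sum>i'<n. (gs_residual n X k i')\<^sup>2)"
  by (subst gram_schmidt.simps) (simp add: gs_residual_def Let_def)

lemma measurable_mat_component:
  "i < n \<Longrightarrow> j < p \<Longrightarrow> (\<lambda>X. X (i, j)) \<in> borel_measurable (mat_space n p)"
  unfolding mat_space_def by (rule measurable_component_singleton) auto

lemma measurable_gram_schmidt:
  "k < p \<Longrightarrow> i < n \<Longrightarrow> (\<lambda>X. gram_schmidt n X k i) \<in> borel_measurable (mat_space n p)"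
proof (induction k arbitrary: i rule: less_induct)
  case (less k)
  have [measurable]: "(\<lambda>X. X (i, k)) \<in> borel_measurable (mat_space n p)" if "i < n" for i
    using that less by (intro measurable_mat_component)
  have [measurable]: "(\<lambda>X. gram_schmidt n X l i) \<in> borel_measurable (mat_space n p)" if "l < k" "i < n" for l i
    using that less by auto
  have [measurable]: "(\<lambda>X. gs_residual n X k i) \<in> borel_measurable (mat_space n p)" if "i < n" for i
    unfolding gs_residual_def using that by measurable
  show ?case unfolding gram_schmidt_eq using \<open>i < n\<close> by measurable
qed

lemma pos_def_gram_imp:
  assumes "pos_def p (gram n X)" "j < p" "v j \<noteq> 0"
  shows "(\<Sum>i<n. (\<Sum>j<p. X (i, j) * v j)\<^sup>2) > 0"
proof -
  have "(\<Sum>i<n. (\<Sum>j<p. X (i, j) * v j)\<^sup>2) = (\<Sum>i<n. \<Sum>j<p. \<Sum>k<p. v j * (X (i, j) * X (i, k)) * v k)"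
    by (simp add: power2_eq_square sum_product mult_ac)
  also have "\<dots> = (\<Sum>j<p. \<Sum>k<p. v j * gram n X j k * v k)"
    unfolding gram_def sum_distrib_left sum_distrib_right
    by (subst sum.swap) (simp add: sum.swap[of _ "{..<p}" "{..<n}"])
  also have "\<dots> > 0" using assms unfolding pos_def_def by blast
  finally show ?thesis .
qed

text \<open>The earlier vectors combine only columns before \<open>k\<close>, so the residual at
  step \<open>k\<close> is \<open>X v\<close> with \<open>v k = 1\<close>. Positive definiteness
  then prevents it from vanishing, and the normalisation is genuine. This is why the triangular
  shape is carried through the induction.\<close>

lemma gram_schmidt_step:
  assumes pd: "pos_def p (gram n X)" and k: "k < p"
  shows "(\<exists>v. (\<forall>j>k. v j = 0) \<and> (\<forall>i. gram_schmidt n X k i = (\<Sum>j<p. X (i, j) * v j)))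
    \<and> (\<forall>l\<le>k. inner_vec n (gram_schmidt n X k) (gram_schmidt n X l) = (if l = k then 1 else 0))
    \<and> (\<Sum>i<n. (gs_residual n X k i)\<^sup>2) > 0"
  using k
proof (induction k rule: less_induct)
  case (less k)
  let ?u = "gram_schmidt n X"
  have IH: "(\<exists>v. (\<forall>j>l. v j = 0) \<and> (\<forall>i. ?u l i = (\<Sum>j<p. X (i, j) * v j)))"
     "m \<le> l \<Longrightarrow> inner_vec n (?u l) (?u m) = (if m = l then 1 else 0)" if "l < k" for l m
    using less.IH[OF that] less.prems that by auto
  have orth: "inner_vec n (?u l) (?u m) = (if l = m then 1 else 0)" if "l < k" "m < k" for l m
    using IH(2)[of l m] IH(2)[of m l] that by (cases "m \<le> l") (auto simp: mult.commute)
  obtain w where w: "\<And>l j. l < k \<Longrightarrow> j > l \<Longrightarrow> w l j = 0" "\<And>l i. l < k \<Longrightarrow> ?u l i = (\<Sum>j<p. X (i, j) * w l j)"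
    using IH(1) by metis
  define c where "c l = (\<Sum>i<n. X (i, k) * ?u l i)" for l
  define v where "v j = (if j = k then 1 else 0) - (\<Sum>l<k. c l * w l j)" for j
  have rv: "gs_residual n X k i = (\<Sum>j<p. X (i, j) * v j)" for i
  proof -
    have "(\<Sum>l<k. c l * ?u l i) = (\<Sum>l<k. \<Sum>j<p. c l * (X (i, j) * w l j))"
      by (intro sum.cong refl) (simp add: w(2) sum_distrib_left)
    also have "\<dots> = (\<Sum>j<p. X (i, j) * (\<Sum>l<k. c l * w l j))"
      by (subst sum.swap) (simp add: sum_distrib_left mult_ac)
    finally have "(\<Sum>l<k. c l * ?u l i) = (\<Sum>j<p. X (i, j) * (\<Sum>l<k. c l * w l j))" .
    moreover have "(\<Sum>j<p. X (i, j) * (if j = k then 1 else 0)) = (\<Sum>j<p. if j = k then X (i, k) else 0)"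
      by (intro sum.cong) auto
    then have "(\<Sum>j<p. X (i, j) * (if j = k then 1 else 0)) = X (i, k)"
      using less.prems by simp
    ultimately show ?thesis
      unfolding gs_residual_def v_def c_def[symmetric] right_diff_distrib sum_subtractf by simp
  qed
  have vk: "v k = 1" "\<And>j. j > k \<Longrightarrow> v j = 0" by (auto simp: v_def w(1))
  have pos: "(\<Sum>i<n. (gs_residual n X k i)\<^sup>2) > 0"
    unfolding rv by (rule pos_def_gram_imp[OF pd less.prems]) (simp add: vk)
  define N where "N = sqrt (\<Sum>i<n. (gs_residual n X k i)\<^sup>2)"
  have N: "N > 0" using pos by (simp add: N_def)
  have uk: "?u k i = gs_residual n X k i / N" for i by (simp add: gram_schmidt_eq N_def)
  have o1: "inner_vec n (?u k) (?u l) = 0" if l: "l < k" for l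
  proof -
    have "inner_vec n (gs_residual n X k) (?u l) = c l - (\<Sum>i<n. (\<Sum>m<k. c m * ?u m i) * ?u l i)"
      by (simp add: gs_residual_def c_def left_diff_distrib sum_subtractf)
    also have "(\<Sum>i<n. (\<Sum>m<k. c m * ?u m i) * ?u l i) = (\<Sum>m<k. c m * inner_vec n (?u m) (?u l))"
      unfolding sum_distrib_left sum_distrib_right by (subst sum.swap) (simp add: mult_ac)
    also have "\<dots> = c l" using l by (simp add: orth if_distrib cong: if_cong)
    finally show ?thesis unfolding uk by (simp add: sum_divide_distrib[symmetric])
  qed
  have o2: "inner_vec n (?u k) (?u k) = 1"
  proof -
    have "inner_vec n (?u k) (?u k) = (\<Sum>i<n. (gs_residual n X k i)\<^sup>2) / N\<^sup>2"
      unfolding uk by (simp add: sum_divide_distrib power2_eq_square)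
    then show ?thesis using pos by (simp add: N_def)
  qed
  show ?case
  proof (intro conjI)
    show "\<exists>v. (\<forall>j>k. v j = 0) \<and> (\<forall>i. ?u k i = (\<Sum>j<p. X (i, j) * v j))"
      by (rule exI[of _ "\<lambda>j. v j / N"]) (simp add: vk uk rv sum_divide_distrib)
    show "\<forall>l\<le>k. inner_vec n (?u k) (?u l) = (if l = k then 1 else 0)"
      using o1 o2 by auto
  qed (rule pos)
qed

lemma orthonormal_gram_schmidt:
  assumes pd: "pos_def p (gram n X)"
  shows "orthonormal n p (gram_schmidt n X)"
  unfolding orthonormal_def
proof (intro allI impI)
  fix k l assume "k < p" "l < p"
  then show "inner_vec n (gram_schmidt n X k) (gram_schmidt n X l) = (if k = l then 1 else 0)"
    using gram_schmidt_step[OF pd, of k] gram_schmidt_step[OF pd, of l]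
    by (cases "l \<le> k") (auto simp: mult.commute)
qed

text \<open>Solving the recursion for column \<open>j\<close> expresses it through the vectors with
  index at most \<open>j\<close>. Hence X\<beta> has coordinates in the orthonormal system, and its
  squared norm is that of the coordinates.\<close>

lemma gram_schmidt_span:
  assumes pd: "pos_def p (gram n X)"
  shows "\<exists>h. \<forall>i. (\<Sum>j<p. X (i, j) * \<beta> j) = (\<Sum>k<p. h k * gram_schmidt n X k i)"
proof -
  let ?u = "gram_schmidt n X"
  have "\<exists>d. \<forall>i. X (i, j) = (\<Sum>k<p. d k * ?u k i)" if j: "j < p" for j
  proof -
    define N where "N = sqrt (\<Sum>i<n. (gs_residual n X j i)\<^sup>2)"
    have N: "N > 0" using gram_schmidt_step[OF pd j] by (simp add: N_def)
    define c where "c l = (\<Sum>i<n. X (i, j) * ?u l i)" for l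
    define d where "d k = (if k < j then c k else 0) + (if k = j then N else 0)" for k
    have "X (i, j) = (\<Sum>k<p. d k * ?u k i)" for i
    proof -
      have "(\<Sum>k<p. d k * ?u k i) = (\<Sum>k<p. (if k < j then c k * ?u k i else 0)) + (\<Sum>k<p. (if k = j then N * ?u k i else 0))"
        unfolding sum.distrib[symmetric] d_def by (intro sum.cong refl) (auto simp: algebra_simps)
      also have "(\<Sum>k<p. (if k < j then c k * ?u k i else 0)) = (\<Sum>k<j. c k * ?u k i)"
        using j by (intro sum.mono_neutral_cong_right) auto
      also have "(\<Sum>k<p. (if k = j then N * ?u k i else 0)) = gs_residual n X j i"
        using j N by (simp add: gram_schmidt_eq N_def)
      finally show ?thesis by (simp add: gs_residual_def c_def)
    qed
    then show ?thesis by blast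
  qed
  then obtain d where d: "\<And>i j. j < p \<Longrightarrow> X (i, j) = (\<Sum>k<p. d j k * ?u k i)" by metis
  have "(\<Sum>j<p. X (i, j) * \<beta> j) = (\<Sum>k<p. (\<Sum>j<p. d j k * \<beta> j) * ?u k i)" for i
  proof -
    have "(\<Sum>j<p. X (i, j) * \<beta> j) = (\<Sum>j<p. \<Sum>k<p. d j k * ?u k i * \<beta> j)"
      by (intro sum.cong refl) (simp add: d sum_distrib_right)
    also have "\<dots> = (\<Sum>k<p. (\<Sum>j<p. d j k * \<beta> j) * ?u k i)"
      unfolding sum_distrib_right by (subst sum.swap) (simp add: mult_ac)
    finally show ?thesis .
  qed
  then show ?thesis by (intro exI allI)
qed

definition proj_sq :: "nat \<Rightarrow> nat \<Rightarrow> (nat \<times> nat \<Rightarrow> real) \<Rightarrow> (nat \<Rightarrow> real) \<Rightarrow> real" where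
  "proj_sq n p X y = (\<Sum>k<p. (inner_vec n (gram_schmidt n X k) y)\<^sup>2)"

lemma measurable_proj_sq [measurable]: "proj_sq n p X \<in> borel_measurable (vec_space n)"
  unfolding proj_sq_def by measurable

lemma measurable_proj_sq_pair [measurable]:
  "(\<lambda>z. proj_sq n p (snd z) (fst z)) \<in> borel_measurable (vec_space n \<Otimes>\<^sub>M mat_space n p)"
proof -
  have [measurable]: "(\<lambda>z. gram_schmidt n (snd z) k i) \<in> borel_measurable (vec_space n \<Otimes>\<^sub>M mat_space n p)"
    if "k < p" "i < n" for k i
    using measurable_compose[OF measurable_snd measurable_gram_schmidt[OF that]] .
  show ?thesis unfolding proj_sq_def by measurable
qed

lemma measurable_mat_vec [measurable]:
  "i < n \<Longrightarrow> (\<lambda>X. mat_vec p X \<beta> i) \<in> borel_measurable (mat_space n p)"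
  unfolding mat_vec_def
  by (intro borel_measurable_sum borel_measurable_times measurable_mat_component) auto

lemma measurable_sq_norm_mat_vec [measurable]:
  "(\<lambda>X. sq_norm n (mat_vec p X \<beta>)) \<in> borel_measurable (mat_space n p)"
  unfolding sq_norm_def by measurable

lemma measurable_lik_pair [measurable]:
  "(\<lambda>z. lik n p \<beta> (fst z) (snd z)) \<in> borel_measurable (mat_space n p \<Otimes>\<^sub>M vec_space n)"
proof -
  have [measurable]: "(\<lambda>z. mat_vec p (fst z) \<beta> i) \<in> borel_measurable (mat_space n p \<Otimes>\<^sub>M vec_space n)" if "i < n" for i
    using measurable_compose[OF measurable_fst measurable_mat_vec[OF that]] .
  show ?thesis unfolding lik_def sq_norm_def by measurable
qed

section \<open>Exponential moments of the projection statistic\<close>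

text \<open>X\<beta> lies in the column space, so the linear term, like the quadratic one, depends
  on \<open>y\<close> only through its coordinates in the Gram--Schmidt system.\<close>

lemma gauss_exp_proj:
  assumes pd: "pos_def p (gram n X)" and t: "t < 1/2"
  shows "has_bochner_integral (gauss n) (\<lambda>y. exp (t * proj_sq n p X y + inner_vec n (mat_vec p X \<beta>) y))
           ((1 - 2*t) powr (- real p / 2) * exp (sq_norm n (mat_vec p X \<beta>) / (2 * (1 - 2*t))))"
proof -
  obtain h where h: "\<And>i. (\<Sum>j<p. X (i, j) * \<beta> j) = (\<Sum>k<p. h k * gram_schmidt n X k i)"
    using gram_schmidt_span[OF pd, where \<beta>=\<beta>] by auto
  note orth = orthonormal_gram_schmidt[OF pd]
  have sq: "sq_norm n (mat_vec p X \<beta>) = (\<Sum>k<p. (h k)\<^sup>2)"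
    using orthonormal_sum_sq[OF orth, of h] by (simp add: sq_norm_def mat_vec_def h)
  have "(\<Sum>k<p. t * (inner_vec n (gram_schmidt n X k) y)\<^sup>2 + h k * inner_vec n (gram_schmidt n X k) y)
      = t * proj_sq n p X y + inner_vec n (mat_vec p X \<beta>) y" for y
    using sum_swap_inner[of h "gram_schmidt n X" y n p]
    by (simp add: proj_sq_def mat_vec_def h sum.distrib sum_distrib_left)
  with gauss_exp_quadratic[OF orth t, of h] show ?thesis unfolding sq by simp
qed

text \<open>Moment generating function of the noncentral chi-square law with \<open>p\<close>
  degrees of freedom and noncentrality \<open>sq_norm n (mat_vec p X \<beta>)\<close>.\<close>

lemma lik_exp_proj:
  assumes pd: "pos_def p (gram n X)" and t: "t < 1/2"
  shows "has_bochner_integral (gauss n) (\<lambda>y. lik n p \<beta> X y * exp (t * proj_sq n p X y))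
           ((1 - 2*t) powr (- real p / 2) * exp (t / (1 - 2*t) * sq_norm n (mat_vec p X \<beta>)))"
proof -
  let ?q = "sq_norm n (mat_vec p X \<beta>)"
  have "has_bochner_integral (gauss n) (\<lambda>y. exp (- ?q / 2) * exp (t * proj_sq n p X y + inner_vec n (mat_vec p X \<beta>) y))
           (exp (- ?q / 2) * ((1 - 2*t) powr (- real p / 2) * exp (?q / (2 * (1 - 2*t)))))"
    by (intro has_bochner_integral_mult_right gauss_exp_proj assms)
  also have "(\<lambda>y. exp (- ?q / 2) * exp (t * proj_sq n p X y + inner_vec n (mat_vec p X \<beta>) y))
     = (\<lambda>y. lik n p \<beta> X y * exp (t * proj_sq n p X y))"
    by (auto simp: lik_def exp_add[symmetric])
  also have "exp (- ?q / 2) * ((1 - 2*t) powr (- real p / 2) * exp (?q / (2 * (1 - 2*t))))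
     = (1 - 2*t) powr (- real p / 2) * exp (- ?q / 2 + ?q / (2 * (1 - 2*t)))"
    by (simp only: exp_add mult_ac)
  also have "- ?q / 2 + ?q / (2 * (1 - 2*t)) = t / (1 - 2*t) * ?q"
    using t by (simp add: field_simps)
  finally show ?thesis .
qed

lemma mat_vec_add: "mat_vec p X (\<lambda>j. \<beta> j + \<beta>' j) i = mat_vec p X \<beta> i + mat_vec p X \<beta>' i"
  by (simp add: mat_vec_def distrib_left sum.distrib)

lemma sq_norm_add: "sq_norm n (\<lambda>i. u i + v i) = sq_norm n u + sq_norm n v + 2 * inner_vec n u v"
  by (simp add: sq_norm_def power2_sum sum.distrib sum_distrib_left mult.assoc)

text \<open>A product of two likelihoods is again the exponential of an affine function of
  \<open>y\<close>, with direction X(\<beta> + \<beta>'), so the formula for one vector applies. The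
  tilt by \<open>- t\<close> shrinks the weight of the inner product from 1 to
  \<open>1 / (1 + 2*t)\<close>.\<close>

lemma lik_lik_exp_proj:
  assumes pd: "pos_def p (gram n X)" and t: "t > - 1/2"
  shows "has_bochner_integral (gauss n) (\<lambda>y. lik n p \<beta> X y * lik n p \<beta>' X y * exp (- t * proj_sq n p X y))
           ((1 + 2*t) powr (- real p / 2) * exp (1 / (1 + 2*t) * inner_vec n (mat_vec p X \<beta>) (mat_vec p X \<beta>')
               - t / (1 + 2*t) * (sq_norm n (mat_vec p X \<beta>) + sq_norm n (mat_vec p X \<beta>'))))"
proof -
  let ?a = "sq_norm n (mat_vec p X \<beta>)" and ?b = "sq_norm n (mat_vec p X \<beta>')"
  let ?i = "inner_vec n (mat_vec p X \<beta>) (mat_vec p X \<beta>')"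
  let ?s = "\<lambda>j. \<beta> j + \<beta>' j"
  have s: "sq_norm n (mat_vec p X ?s) = ?a + ?b + 2 * ?i"
    unfolding mat_vec_add[abs_def] by (rule sq_norm_add)
  have si: "inner_vec n (mat_vec p X ?s) y = inner_vec n (mat_vec p X \<beta>) y + inner_vec n (mat_vec p X \<beta>') y" for y
    by (simp add: mat_vec_add distrib_right sum.distrib)
  have "has_bochner_integral (gauss n) (\<lambda>y. exp (- (?a + ?b) / 2) * exp ((-t) * proj_sq n p X y + inner_vec n (mat_vec p X ?s) y))
           (exp (- (?a + ?b) / 2) * ((1 - 2*(-t)) powr (- real p / 2) * exp (sq_norm n (mat_vec p X ?s) / (2 * (1 - 2*(-t))))))"
    using t by (intro has_bochner_integral_mult_right gauss_exp_proj pd) simp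
  also have "(\<lambda>y. exp (- (?a + ?b) / 2) * exp ((-t) * proj_sq n p X y + inner_vec n (mat_vec p X ?s) y))
     = (\<lambda>y. lik n p \<beta> X y * lik n p \<beta>' X y * exp (- t * proj_sq n p X y))"
    unfolding si lik_def exp_add[symmetric] by (intro ext arg_cong[where f=exp]) (simp add: field_simps)
  also have "exp (- (?a + ?b) / 2) * ((1 - 2*(-t)) powr (- real p / 2) * exp (sq_norm n (mat_vec p X ?s) / (2 * (1 - 2*(-t)))))
     = (1 + 2*t) powr (- real p / 2) * (exp (- (?a + ?b) / 2) * exp ((?a + ?b + 2 * ?i) / (2 * (1 + 2*t))))"
    unfolding s by simp
  also have "exp (- (?a + ?b) / 2) * exp ((?a + ?b + 2 * ?i) / (2 * (1 + 2*t)))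
     = exp (1 / (1 + 2*t) * ?i - t / (1 + 2*t) * (?a + ?b))"
  proof -
    define w where "w = 1 / (1 + 2*t)"
    have w: "t / (1 + 2*t) = (1 - w) / 2" "x / (2 * (1 + 2*t)) = x * w / 2" for x
      using t by (auto simp: w_def field_simps)
    show ?thesis
      unfolding exp_add[symmetric] w w_def[symmetric] by (intro arg_cong[where f=exp]) (simp add: field_simps)
  qed
  finally show ?thesis .
qed

lemma lik_integral:
  "has_bochner_integral (gauss n) (lik n p \<beta> X) 1"
proof -
  let ?q = "sq_norm n (mat_vec p X \<beta>)"
  have "has_bochner_integral (gauss n) (\<lambda>y. exp (- ?q / 2) * exp (inner_vec n (mat_vec p X \<beta>) y)) (exp (- ?q / 2) * exp (?q / 2))"
    unfolding sq_norm_def by (intro has_bochner_integral_mult_right gauss_mgf)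
  moreover have "(\<lambda>y. exp (- ?q / 2) * exp (inner_vec n (mat_vec p X \<beta>) y)) = lik n p \<beta> X"
    by (auto simp: lik_def exp_add[symmetric])
  moreover have "exp (- ?q / 2) * exp (?q / 2) = 1" by (simp flip: exp_add)
  ultimately show ?thesis by simp
qed

section \<open>Upper bound on the minimax risk\<close>

text \<open>The common interface of the two design classes. \<open>\<nu>\<close> is the squared
  length of the signals and \<open>C\<close> the price in the exponent for a design that is not
  exactly orthogonal. The mean of the squared norm is needed exactly, for Jensen's inequality; the
  exponential moment only from above, with the witness \<open>m\<close> supplying integrability. The
  choice \<open>c = 0\<close> serves the type II error, \<open>c > 0\<close> the second moment of
  the mixture.\<close>

locale design =
  fixes n p :: nat and D :: "(nat \<times> nat \<Rightarrow> real) measure" and \<nu> C :: real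
  assumes prob_space_D: "prob_space D"
    and sets_D [measurable_cong]: "sets D = sets (mat_space n p)"
    and AE_pos_def: "AE X in D. pos_def p (gram n X)"
    and sq_norm_D: "\<And>\<beta>. sq_norm p \<beta> = \<nu> \<Longrightarrow>
        has_bochner_integral D (\<lambda>X. sq_norm n (mat_vec p X \<beta>)) (real n * \<nu>)"
    and mgf_D: "\<And>\<beta> \<beta>' c d. sq_norm p \<beta> = \<nu> \<Longrightarrow> sq_norm p \<beta>' = \<nu> \<Longrightarrow> 0 \<le> c \<Longrightarrow> c \<le> 1 \<Longrightarrow> 0 \<le> d \<Longrightarrow> d \<le> 1 \<Longrightarrow>
        \<exists>m. has_bochner_integral D (\<lambda>X. exp (c * inner_vec n (mat_vec p X \<beta>) (mat_vec p X \<beta>')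
              - d * (sq_norm n (mat_vec p X \<beta>) + sq_norm n (mat_vec p X \<beta>')))) m
          \<and> m \<le> exp (real n * (c * inner_vec p \<beta> \<beta>' - 2 * d * \<nu>) + C)"
begin

sublocale prob_space D by (rule prob_space_D)

sublocale G: prob_space "gauss n" by (rule prob_space_gauss)

lemma space_D: "space D = space (mat_space n p)"
  using sets_D by (rule sets_eq_imp_space_eq)

lemma measurable_section:
  assumes "f \<in> borel_measurable (vec_space n \<Otimes>\<^sub>M mat_space n p)" "X \<in> space D"
  shows "(\<lambda>y. f (y, X)) \<in> borel_measurable (vec_space n)"
  using measurable_compose[OF measurable_Pair2' assms(1)] assms(2) by (simp add: space_D)

lemma Ebeta_eq:
  assumes f: "f \<in> borel_measurable (vec_space n \<Otimes>\<^sub>M mat_space n p)"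
  shows "Ebeta D n p \<beta> f = (\<integral>X. (\<integral>y. lik n p \<beta> X y * f (y, X) \<partial>gauss n) \<partial>D)"
  unfolding Ebeta_def
  by (intro Bochner_Integration.integral_cong refl obs_change_of_measure[where f="\<lambda>y. f (y, _)"] measurable_section[OF f])

lemma integrable_lik_mult:
  assumes f: "f \<in> borel_measurable (vec_space n)" "\<And>y. y \<in> space (vec_space n) \<Longrightarrow> 0 \<le> f y \<and> f y \<le> 1"
  shows "integrable (gauss n) (\<lambda>y. lik n p \<beta> X y * f y)"
proof (rule Bochner_Integration.integrable_bound)
  show "integrable (gauss n) (lik n p \<beta> X)"
    using lik_integral by (auto simp: has_bochner_integral_iff)
  show "(\<lambda>y. lik n p \<beta> X y * f y) \<in> borel_measurable (gauss n)" using f(1) by measurable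
  show "AE y in gauss n. norm (lik n p \<beta> X y * f y) \<le> norm (lik n p \<beta> X y)"
    using f(2) by (intro AE_I2) (auto simp: abs_mult intro!: mult_right_le_one_le)
qed

lemma measurable_inner_integral:
  assumes f: "f \<in> borel_measurable (vec_space n \<Otimes>\<^sub>M mat_space n p)"
  shows "(\<lambda>X. \<integral>y. lik n p \<beta> X y * f (y, X) \<partial>gauss n) \<in> borel_measurable D"
proof -
  have [measurable]: "(\<lambda>z. f (snd z, fst z)) \<in> borel_measurable (mat_space n p \<Otimes>\<^sub>M vec_space n)"
    by (rule measurable_compose[OF _ f]) measurable
  show ?thesis
    by (rule G.borel_measurable_lebesgue_integral) (simp add: case_prod_beta)
qed

lemma inner_integral_bounds:
  assumes f: "f \<in> borel_measurable (vec_space n \<Otimes>\<^sub>M mat_space n p)"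
    and b: "\<And>z. z \<in> space (vec_space n \<Otimes>\<^sub>M mat_space n p) \<Longrightarrow> 0 \<le> f z \<and> f z \<le> 1"
    and X: "X \<in> space D"
  shows "0 \<le> (\<integral>y. lik n p \<beta> X y * f (y, X) \<partial>gauss n)" "(\<integral>y. lik n p \<beta> X y * f (y, X) \<partial>gauss n) \<le> 1"
    "integrable (gauss n) (\<lambda>y. lik n p \<beta> X y * f (y, X))"
proof -
  have b': "0 \<le> f (y, X) \<and> f (y, X) \<le> 1" if "y \<in> space (vec_space n)" for y
    using b[of "(y, X)"] that X by (auto simp: space_pair_measure space_D)
  show i: "integrable (gauss n) (\<lambda>y. lik n p \<beta> X y * f (y, X))"
    by (rule integrable_lik_mult[OF measurable_section[OF f X] b'])
  show "0 \<le> (\<integral>y. lik n p \<beta> X y * f (y, X) \<partial>gauss n)"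
    using b' by (intro integral_nonneg_AE AE_I2) (auto simp: less_imp_le)
  have "(\<integral>y. lik n p \<beta> X y * f (y, X) \<partial>gauss n) \<le> (\<integral>y. lik n p \<beta> X y \<partial>gauss n)"
    using b' lik_integral[of n p \<beta> X]
    by (intro integral_mono_AE i AE_I2) (auto simp: has_bochner_integral_iff mult_le_cancel_left1 less_imp_le)
  also have "\<dots> = 1" using lik_integral[of n p \<beta> X] by (simp add: has_bochner_integral_iff)
  finally show "(\<integral>y. lik n p \<beta> X y * f (y, X) \<partial>gauss n) \<le> 1" .
qed

lemma integrable_inner_integral:
  assumes f: "f \<in> borel_measurable (vec_space n \<Otimes>\<^sub>M mat_space n p)"
    and b: "\<And>z. z \<in> space (vec_space n \<Otimes>\<^sub>M mat_space n p) \<Longrightarrow> 0 \<le> f z \<and> f z \<le> 1"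
  shows "integrable D (\<lambda>X. \<integral>y. lik n p \<beta> X y * f (y, X) \<partial>gauss n)"
  using inner_integral_bounds[OF f b, where \<beta>=\<beta>]
  by (intro integrable_const_bound[where B=1] AE_I2 measurable_inner_integral f) auto

lemma Ebeta_bounds:
  assumes f: "f \<in> borel_measurable (vec_space n \<Otimes>\<^sub>M mat_space n p)"
    and b: "\<And>z. z \<in> space (vec_space n \<Otimes>\<^sub>M mat_space n p) \<Longrightarrow> 0 \<le> f z \<and> f z \<le> 1"
  shows "0 \<le> Ebeta D n p \<beta> f" "Ebeta D n p \<beta> f \<le> 1"
  unfolding Ebeta_eq[OF f]
  using inner_integral_bounds[OF f b, where \<beta>=\<beta>]
  by (auto intro!: integral_nonneg_AE integral_le_const AE_I2 integrable_inner_integral f b)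

lemma testsD:
  assumes "T \<in> tests n p"
  shows "T \<in> borel_measurable (vec_space n \<Otimes>\<^sub>M mat_space n p)"
    "\<And>z. z \<in> space (vec_space n \<Otimes>\<^sub>M mat_space n p) \<Longrightarrow> 0 \<le> T z \<and> T z \<le> 1"
    "(\<lambda>z. 1 - T z) \<in> borel_measurable (vec_space n \<Otimes>\<^sub>M mat_space n p)"
    "\<And>z. z \<in> space (vec_space n \<Otimes>\<^sub>M mat_space n p) \<Longrightarrow> 0 \<le> 1 - T z \<and> 1 - T z \<le> 1"
  using assms by (auto simp: tests_def)

lemma bdd_above_type2:
  assumes "T \<in> tests n p"
  shows "bdd_above ((\<lambda>\<beta>. Ebeta D n p \<beta> (\<lambda>z. 1 - T z)) ` B)"
  by (rule bdd_aboveI2[where M=1]) (rule Ebeta_bounds(2)[OF testsD(3,4)[OF assms]])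

text \<open>A member of \<open>Xi p s A\<close> is required because the supremum of the empty set of
  reals carries no information. The bound makes the infimum over all tests a genuine lower bound of
  its members.\<close>

lemma RiskT_nonneg:
  assumes T: "T \<in> tests n p" and ne: "\<beta> \<in> Xi p s A"
  shows "0 \<le> RiskT D n p T s A"
proof -
  have "0 \<le> Ebeta D n p \<beta> (\<lambda>z. 1 - T z)" by (rule Ebeta_bounds(1)[OF testsD(3,4)[OF T]])
  also have "\<dots> \<le> (SUP \<beta>\<in>Xi p s A. Ebeta D n p \<beta> (\<lambda>z. 1 - T z))"
    by (rule cSUP_upper[OF ne bdd_above_type2[OF T]])
  finally show ?thesis
    using Ebeta_bounds(1)[OF testsD(1,2)[OF T], of "\<lambda>_. 0"] by (simp add: RiskT_def)
qed

lemma mat_vec_scale: "mat_vec p X (\<lambda>j. c * \<beta> j) i = c * mat_vec p X \<beta> i"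
  by (simp add: mat_vec_def sum_distrib_left mult_ac)

lemma sq_norm_scale: "sq_norm k (\<lambda>i. c * v i) = c\<^sup>2 * sq_norm k v"
  by (simp add: sq_norm_def sum_distrib_left power_mult_distrib)

lemma sq_norm_nonneg: "0 \<le> sq_norm k v"
  by (simp add: sq_norm_def sum_nonneg)

text \<open>Vectors longer than \<open>\<nu>\<close> are scaled down to squared norm \<open>\<nu>\<close>, where \<open>mgf_D\<close> applies.\<close>

lemma exp_neg_sq_norm_bound:
  assumes \<beta>: "sq_norm p \<beta> \<ge> \<nu>" and \<nu>: "\<nu> > 0" and d: "0 \<le> d" "d \<le> 1"
  shows "integrable D (\<lambda>X. exp (- d * sq_norm n (mat_vec p X \<beta>)))"
    "(\<integral>X. exp (- d * sq_norm n (mat_vec p X \<beta>)) \<partial>D) \<le> exp (C - real n * d * \<nu>)"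
proof -
  let ?f = "\<lambda>X. exp (- d * sq_norm n (mat_vec p X \<beta>))"
  define c where "c = sqrt (\<nu> / sq_norm p \<beta>)"
  have c: "c\<^sup>2 = \<nu> / sq_norm p \<beta>" "c\<^sup>2 \<le> 1" using \<beta> \<nu> by (auto simp: c_def)
  let ?b = "\<lambda>j. c * \<beta> j"
  have b: "sq_norm p ?b = \<nu>" using c(1) \<beta> \<nu> by (simp add: sq_norm_scale)
  have le: "sq_norm n (mat_vec p X ?b) \<le> sq_norm n (mat_vec p X \<beta>)" for X
    unfolding mat_vec_scale[abs_def] sq_norm_scale
    using mult_right_mono[OF c(2) sq_norm_nonneg[of n "mat_vec p X \<beta>"]] by simp
  show i: "integrable D ?f"
    by (rule integrable_const_bound[where B=1]) (auto simp: d sq_norm_nonneg)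
  \<comment> \<open>With both vectors equal to \<open>?b\<close> the squared norm is counted twice,
    hence \<open>d/2\<close>; \<open>c = 0\<close> removes the inner product.\<close>
  obtain m where m: "has_bochner_integral D (\<lambda>X. exp (0 * inner_vec n (mat_vec p X ?b) (mat_vec p X ?b)
        - d/2 * (sq_norm n (mat_vec p X ?b) + sq_norm n (mat_vec p X ?b)))) m"
      "m \<le> exp (real n * (0 * inner_vec p ?b ?b - 2 * (d/2) * \<nu>) + C)"
    using mgf_D[OF b b, of 0 "d/2"] d by auto
  have "(\<integral>X. ?f X \<partial>D) \<le> (\<integral>X. exp (0 * inner_vec n (mat_vec p X ?b) (mat_vec p X ?b)
        - d/2 * (sq_norm n (mat_vec p X ?b) + sq_norm n (mat_vec p X ?b))) \<partial>D)"
    using m(1) le d by (intro integral_mono i) (auto simp: has_bochner_integral_iff intro: mult_left_mono)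
  also have "\<dots> \<le> exp (C - real n * d * \<nu>)"
    using m by (simp add: has_bochner_integral_iff algebra_simps)
  finally show "(\<integral>X. ?f X \<partial>D) \<le> exp (C - real n * d * \<nu>)" .
qed

lemma Xi_sq_norm:
  assumes "\<beta> \<in> Xi p s A" "A > 0"
  shows "sq_norm p \<beta> \<ge> real s * A\<^sup>2"
proof -
  have sub: "{i. \<beta> i \<noteq> 0} \<subseteq> {..<p}" using assms by (auto simp: Xi_def not_le[symmetric])
  have "real s * A\<^sup>2 = (\<Sum>i\<in>{i. \<beta> i \<noteq> 0}. A\<^sup>2)" using assms by (simp add: Xi_def)
  also have "\<dots> \<le> (\<Sum>i\<in>{i. \<beta> i \<noteq> 0}. (\<beta> i)\<^sup>2)"
  proof (rule sum_mono)
    fix i assume "i \<in> {i. \<beta> i \<noteq> 0}"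
    then have "A \<le> \<bar>\<beta> i\<bar>" using assms by (auto simp: Xi_def)
    then show "A\<^sup>2 \<le> (\<beta> i)\<^sup>2" using assms(2) by (metis less_imp_le power2_abs power_mono)
  qed
  also have "\<dots> \<le> sq_norm p \<beta>" unfolding sq_norm_def using sub by (intro sum_mono2) auto
  finally show ?thesis .
qed

lemma Xi_nonempty:
  assumes "s \<le> p" "A > 0"
  shows "(\<lambda>i. if i < s then A else 0) \<in> Xi p s A"
proof -
  have "{i. (if i < s then A else 0) \<noteq> 0} = {..<s}" using assms by auto
  then show ?thesis using assms by (auto simp: Xi_def)
qed

text \<open>Chernoff's bound for the test \<open>S > \<tau>\<close>, with parameter \<open>t\<close>
  under the null and \<open>- t\<close> under the alternative. The threshold stays free here and is
  chosen once the exponents are expanded.\<close>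

lemma Risk_le:
  assumes A: "A > 0" and s: "s \<le> p" "\<nu> = real s * A\<^sup>2" "\<nu> > 0" and t: "0 \<le> t" "t < 1/2"
  shows "Risk D n p s A \<le> exp (- t * \<tau>) * (1 - 2*t) powr (- real p / 2)
      + exp (t * \<tau>) * (1 + 2*t) powr (- real p / 2) * exp (C - real n * (t / (1 + 2*t)) * \<nu>)"
proof -
  define T :: "(nat \<Rightarrow> real) \<times> (nat \<times> nat \<Rightarrow> real) \<Rightarrow> real"
    where "T z = (if proj_sq n p (snd z) (fst z) > \<tau> then 1 else 0)" for z
  have T: "T \<in> tests n p" unfolding tests_def T_def by auto
  note TD = testsD[OF T]
  have "Risk D n p s A \<le> RiskT D n p T s A"
    unfolding Risk_def using RiskT_nonneg[OF _ Xi_nonempty[OF s(1) A]]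
    by (intro cINF_lower[OF _ T] bdd_belowI2)
  moreover have "Ebeta D n p (\<lambda>_. 0) T \<le> exp (- t * \<tau>) * (1 - 2*t) powr (- real p / 2)"
    unfolding Ebeta_eq[OF TD(1)]
  proof (rule integral_le_const[OF integrable_inner_integral[OF TD(1,2)]])
    show "AE X in D. (\<integral>y. lik n p (\<lambda>_. 0) X y * T (y, X) \<partial>gauss n) \<le> exp (- t * \<tau>) * (1 - 2*t) powr (- real p / 2)"
      using AE_pos_def
    proof eventually_elim
      case (elim X)
      have z: "mat_vec p X (\<lambda>_. 0) = (\<lambda>_. 0)" by (auto simp: mat_vec_def)
      have l: "lik n p (\<lambda>_. 0) X y = 1" for y by (simp add: lik_def z sq_norm_def)
      have hb: "has_bochner_integral (gauss n) (\<lambda>y. exp (- t * \<tau>) * (lik n p (\<lambda>_. 0) X y * exp (t * proj_sq n p X y)))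
            (exp (- t * \<tau>) * ((1 - 2*t) powr (- real p / 2) * exp (t / (1 - 2*t) * sq_norm n (mat_vec p X (\<lambda>_. 0)))))"
        by (intro has_bochner_integral_mult_right lik_exp_proj elim t)
      have "(\<integral>y. lik n p (\<lambda>_. 0) X y * T (y, X) \<partial>gauss n) \<le> (\<integral>y. exp (- t * \<tau>) * (lik n p (\<lambda>_. 0) X y * exp (t * proj_sq n p X y)) \<partial>gauss n)"
      proof (rule integral_mono_AE)
        show "integrable (gauss n) (\<lambda>y. lik n p (\<lambda>_. 0) X y * T (y, X))"
          by (rule integrable_lik_mult) (auto simp: T_def)
        have "T (y, X) \<le> exp (- t * \<tau>) * exp (t * proj_sq n p X y)" for y
        proof (cases "proj_sq n p X y > \<tau>")
          case True
          then have "0 \<le> - t * \<tau> + t * proj_sq n p X y" using t by (simp add: mult_left_mono)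
          then show ?thesis using True by (simp add: T_def flip: exp_add)
        qed (simp add: T_def)
        then show "AE y in gauss n. lik n p (\<lambda>_. 0) X y * T (y, X) \<le> exp (- t * \<tau>) * (lik n p (\<lambda>_. 0) X y * exp (t * proj_sq n p X y))"
          by (simp add: l)
      qed (use hb in \<open>auto simp: has_bochner_integral_iff\<close>)
      also have "\<dots> = exp (- t * \<tau>) * (1 - 2*t) powr (- real p / 2)"
        using hb by (simp add: has_bochner_integral_iff z sq_norm_def)
      finally show ?case .
    qed
  qed
  moreover have "(SUP \<beta>\<in>Xi p s A. Ebeta D n p \<beta> (\<lambda>z. 1 - T z))
     \<le> exp (t * \<tau>) * (1 + 2*t) powr (- real p / 2) * exp (C - real n * (t / (1 + 2*t)) * \<nu>)"
  proof (rule cSUP_least)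
    show "Xi p s A \<noteq> {}" using Xi_nonempty[OF s(1) A] by auto
    fix \<beta> assume \<beta>: "\<beta> \<in> Xi p s A"
    let ?d = "t / (1 + 2*t)" and ?K = "exp (t * \<tau>) * (1 + 2*t) powr (- real p / 2)"
    have d: "0 \<le> ?d" "?d \<le> 1" using t by (auto simp: field_simps)
    have b: "sq_norm p \<beta> \<ge> \<nu>" using Xi_sq_norm[OF \<beta> A] s(2) by simp
    note E = exp_neg_sq_norm_bound[OF b s(3) d]
    have "Ebeta D n p \<beta> (\<lambda>z. 1 - T z) \<le> (\<integral>X. ?K * exp (- ?d * sq_norm n (mat_vec p X \<beta>)) \<partial>D)"
      unfolding Ebeta_eq[OF TD(3)]
    proof (rule integral_mono_AE[OF integrable_inner_integral[OF TD(3,4)]])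
      show "AE X in D. (\<integral>y. lik n p \<beta> X y * (1 - T (y, X)) \<partial>gauss n) \<le> ?K * exp (- ?d * sq_norm n (mat_vec p X \<beta>))"
        using AE_pos_def
      proof eventually_elim
        case (elim X)
        have hb: "has_bochner_integral (gauss n) (\<lambda>y. exp (t * \<tau>) * (lik n p \<beta> X y * exp ((-t) * proj_sq n p X y)))
              (exp (t * \<tau>) * ((1 - 2*(-t)) powr (- real p / 2) * exp ((-t) / (1 - 2*(-t)) * sq_norm n (mat_vec p X \<beta>))))"
          using t by (intro has_bochner_integral_mult_right lik_exp_proj elim) auto
        have "(\<integral>y. lik n p \<beta> X y * (1 - T (y, X)) \<partial>gauss n) \<le> (\<integral>y. exp (t * \<tau>) * (lik n p \<beta> X y * exp ((-t) * proj_sq n p X y)) \<partial>gauss n)"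
        proof (rule integral_mono_AE)
          show "integrable (gauss n) (\<lambda>y. lik n p \<beta> X y * (1 - T (y, X)))"
            by (rule integrable_lik_mult) (auto simp: T_def)
          have "1 - T (y, X) \<le> exp (t * \<tau>) * exp ((-t) * proj_sq n p X y)" for y
          proof (cases "proj_sq n p X y > \<tau>")
            case False
            then have "0 \<le> t * \<tau> + (-t) * proj_sq n p X y" using t by (simp add: mult_left_mono)
            then show ?thesis using False by (simp add: T_def flip: exp_add)
          qed (simp add: T_def)
          then have "lik n p \<beta> X y * (1 - T (y, X)) \<le> lik n p \<beta> X y * (exp (t * \<tau>) * exp ((-t) * proj_sq n p X y))" for y
            by (intro mult_left_mono) (auto simp: less_imp_le)
          then show "AE y in gauss n. lik n p \<beta> X y * (1 - T (y, X)) \<le> exp (t * \<tau>) * (lik n p \<beta> X y * exp ((-t) * proj_sq n p X y))"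
            by (simp add: mult_ac)
        qed (use hb in \<open>auto simp: has_bochner_integral_iff\<close>)
        also have "\<dots> = ?K * exp (- ?d * sq_norm n (mat_vec p X \<beta>))"
          using hb by (simp add: has_bochner_integral_iff)
        finally show ?case .
      qed
      show "integrable D (\<lambda>X. ?K * exp (- ?d * sq_norm n (mat_vec p X \<beta>)))"
        using E(1) by (intro integrable_mult_right) auto
    qed
    also have "\<dots> = ?K * (\<integral>X. exp (- ?d * sq_norm n (mat_vec p X \<beta>)) \<partial>D)" by simp
    also have "\<dots> \<le> ?K * exp (C - real n * ?d * \<nu>)"
      using E(2) by (intro mult_left_mono) auto
    finally show "Ebeta D n p \<beta> (\<lambda>z. 1 - T z) \<le> ?K * exp (C - real n * ?d * \<nu>)" .
  qed
  ultimately show ?thesis by (simp add: RiskT_def)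
qed

end

section \<open>Lower bound on the minimax risk\<close>

text \<open>
  The pointwise form of the Paley--Zygmund argument: \<open>m\<close> plays the role of \<open>E\<^sub>Q V\<close>, the two terms with \<open>r\<close> pay for \<open>S\<close> leaving
  \<open>[lo, hi]\<close>, and the Cauchy--Schwarz inequality is replaced by \<open>V \<le> \<kappa> / 2 + V\<^sup>2 / (2 * \<kappa>)\<close>.
\<close>

lemma truncated_second_moment_ineq:
  fixes a t L S m \<kappa> r hi lo :: real
  assumes a: "a > 0" and t: "t \<ge> 0" and L: "L > 0" and m: "m > 0" and \<kappa>: "\<kappa> > 0" and r: "r \<ge> 0"
  defines "K \<equiv> min 1 (m / 2 * exp (2 * t * lo)) / (a * exp (t * hi))"
  shows "a * L * exp (- t * S) \<le> a * exp (t * S) * (m / 2)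
      + \<kappa> / 2 * (min 1 L / K + a * exp (t * S) * exp (r * (S - hi)) + a * exp (t * S) * exp (r * (lo - S)))
      + a * L\<^sup>2 * exp (- 3 * t * S) / (2 * \<kappa>)"
proof -
  define w where "w = a * exp (t * S)"
  define V where "V = L * exp (- 2 * t * S)"
  have w: "w > 0" using a by (simp add: w_def)
  have K: "K > 0" using a m by (simp add: K_def)
  have wV: "w * V = a * L * exp (- t * S)" "w * V\<^sup>2 = a * L\<^sup>2 * exp (- 3 * t * S)"
    unfolding w_def V_def by (simp_all add: power_mult_distrib exp_of_nat_mult[symmetric] mult_ac flip: exp_add)
  have "w * V \<le> w * (m/2) + \<kappa> / 2 * (min 1 L / K + w * exp (r * (S - hi)) + w * exp (r * (lo - S))) + w * V\<^sup>2 / (2 * \<kappa>)"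
  proof (cases "V \<le> m / 2")
    case True
    then have "w * V \<le> w * (m / 2)" using w by simp
    moreover have "0 \<le> \<kappa> / 2 * (min 1 L / K + w * exp (r * (S - hi)) + w * exp (r * (lo - S)))"
      using w \<kappa> K L by (intro mult_nonneg_nonneg add_nonneg_nonneg) auto
    moreover have "0 \<le> w * V\<^sup>2 / (2 * \<kappa>)" using w \<kappa> by simp
    ultimately show ?thesis by linarith
  next
    case False
    have "0 \<le> (\<kappa> - V)\<^sup>2 / (2 * \<kappa>)" using \<kappa> by simp
    then have "V \<le> \<kappa> / 2 + V\<^sup>2 / (2 * \<kappa>)"
      using \<kappa> by (simp add: power2_eq_square field_simps)
    then have 1: "w * V \<le> \<kappa> / 2 * w + w * V\<^sup>2 / (2 * \<kappa>)"
      using mult_left_mono[of V _ w] w by (fastforce simp: algebra_simps)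
    have "w \<le> min 1 L / K + w * exp (r * (S - hi)) + w * exp (r * (lo - S))"
    proof -
      consider "S > hi" | "S < lo" | "lo \<le> S" "S \<le> hi" by linarith
      then show ?thesis
      proof cases
        case 1
        then have "w * 1 \<le> w * exp (r * (S - hi))" using w r by (intro mult_left_mono) auto
        moreover have "0 \<le> min 1 L / K + w * exp (r * (lo - S))" using w K L by auto
        ultimately show ?thesis by linarith
      next
        case 2
        then have "w * 1 \<le> w * exp (r * (lo - S))" using w r by (intro mult_left_mono) auto
        moreover have "0 \<le> min 1 L / K + w * exp (r * (S - hi))" using w K L by auto
        ultimately show ?thesis by linarith
      next
        case 3
        \<comment> \<open>This case explains \<open>K\<close>: for \<open>S\<close> in
          \<open>[lo, hi]\<close> and \<open>V > m / 2\<close>, its numerator bounds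
          \<open>min 1 L\<close> from below and its denominator bounds \<open>w\<close> from
          above.\<close>
        have "L = V * exp (2 * t * S)" by (simp add: V_def flip: exp_add)
        moreover have "m / 2 * exp (2 * t * lo) \<le> V * exp (2 * t * S)"
          using False 3 t m by (intro mult_mono) (auto intro: mult_left_mono)
        ultimately have mL: "min 1 (m / 2 * exp (2 * t * lo)) \<le> min 1 L" by auto
        have "w \<le> a * exp (t * hi)" unfolding w_def using a t 3 by (auto intro!: mult_left_mono)
        then have "w * K \<le> a * exp (t * hi) * K" using K by simp
        also have "\<dots> = min 1 (m / 2 * exp (2 * t * lo))" using a by (simp add: K_def)
        finally have "w * K \<le> min 1 L" using mL by (rule order_trans)
        then have "w \<le> min 1 L / K" using K by (simp add: pos_le_divide_eq)
        moreover have "0 \<le> w * exp (r * (S - hi)) + w * exp (r * (lo - S))" using w by auto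
        ultimately show ?thesis by linarith
      qed
    qed
    then have "\<kappa> / 2 * w \<le> \<kappa> / 2 * (min 1 L / K + w * exp (r * (S - hi)) + w * exp (r * (lo - S)))"
      using \<kappa> by simp
    moreover have "0 \<le> w * (m/2)" using w m by simp
    ultimately show ?thesis using 1 by linarith
  qed
  then show ?thesis unfolding wV unfolding w_def .
qed

section \<open>Bayes risk of a finite mixture\<close>

lemma has_bochner_integral_cmult:
  fixes c :: real
  shows "has_bochner_integral M f x \<Longrightarrow> has_bochner_integral M (\<lambda>y. c * f y) (c * x)"
  by (rule has_bochner_integral_mult_right)

definition mix_lik :: "nat \<Rightarrow> nat \<Rightarrow> 'w set \<Rightarrow> ('w \<Rightarrow> nat \<Rightarrow> real) \<Rightarrow> (nat \<times> nat \<Rightarrow> real) \<Rightarrow> (nat \<Rightarrow> real) \<Rightarrow> real" where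
  "mix_lik n p \<Omega> b X y = (\<Sum>\<omega>\<in>\<Omega>. lik n p (b \<omega>) X y) / real (card \<Omega>)"

text \<open>For \<open>c = 1\<close> this is the second moment under the null of the mixture
  likelihood ratio for an orthogonal design. Tilting replaces 1 by a smaller
  \<open>c\<close>.\<close>

definition overlap :: "nat \<Rightarrow> nat \<Rightarrow> 'w set \<Rightarrow> ('w \<Rightarrow> nat \<Rightarrow> real) \<Rightarrow> real \<Rightarrow> real" where
  "overlap n p \<Omega> b c = (\<Sum>\<omega>\<in>\<Omega>. \<Sum>\<omega>'\<in>\<Omega>. exp (real n * (c * inner_vec p (b \<omega>) (b \<omega>')))) / (real (card \<Omega>))\<^sup>2"

context design
begin

context
  fixes \<Omega> :: "'w set" and b :: "'w \<Rightarrow> nat \<Rightarrow> real" and s :: nat and A :: real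
  assumes \<Omega>: "finite \<Omega>" "\<Omega> \<noteq> {}"
    and bXi: "\<And>\<omega>. \<omega> \<in> \<Omega> \<Longrightarrow> b \<omega> \<in> Xi p s A"
    and bsq: "\<And>\<omega>. \<omega> \<in> \<Omega> \<Longrightarrow> sq_norm p (b \<omega>) = \<nu>"
begin

lemma card_pos: "real (card \<Omega>) > 0"
  using \<Omega> by (simp add: card_gt_0_iff)

lemma mix_lik_pos: "mix_lik n p \<Omega> b X y > 0"
  unfolding mix_lik_def using \<Omega> card_pos by (intro divide_pos_pos sum_pos) auto

lemma measurable_mix_lik [measurable]: "mix_lik n p \<Omega> b X \<in> borel_measurable (vec_space n)"
  unfolding mix_lik_def by measurable

lemma measurable_bayes: "(\<lambda>X. \<integral>y. min 1 (mix_lik n p \<Omega> b X y) \<partial>gauss n) \<in> borel_measurable D"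
proof -
  have [measurable]: "(\<lambda>z. mix_lik n p \<Omega> b (fst z) (snd z)) \<in> borel_measurable (mat_space n p \<Otimes>\<^sub>M vec_space n)"
    unfolding mix_lik_def by measurable
  show ?thesis
    by (rule G.borel_measurable_lebesgue_integral) (simp add: case_prod_beta)
qed

lemma integrable_min: "integrable (gauss n) (\<lambda>y. min 1 (mix_lik n p \<Omega> b X y))"
  by (rule G.integrable_const_bound[where B=1]) (auto simp: mix_lik_pos less_imp_le)

lemma bayes_bounds: "0 \<le> (\<integral>y. min 1 (mix_lik n p \<Omega> b X y) \<partial>gauss n)" "(\<integral>y. min 1 (mix_lik n p \<Omega> b X y) \<partial>gauss n) \<le> 1"
  by (auto intro!: integral_nonneg_AE G.integral_le_const AE_I2 integrable_min simp: mix_lik_pos less_imp_le)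

lemma integrable_bayes: "integrable D (\<lambda>X. \<integral>y. min 1 (mix_lik n p \<Omega> b X y) \<partial>gauss n)"
  using bayes_bounds by (intro integrable_const_bound[where B=1] AE_I2 measurable_bayes) auto

text \<open>The supremum over \<open>Xi p s A\<close> dominates the average over
  \<open>\<Omega>\<close>, which turns the alternative into a single mixture. Then
  \<open>T + L * (1 - T) \<ge> min 1 L\<close> holds pointwise for any test value between 0 and
  1.\<close>

lemma RiskT_ge_bayes:
  assumes T: "T \<in> tests n p"
  shows "(\<integral>X. (\<integral>y. min 1 (mix_lik n p \<Omega> b X y) \<partial>gauss n) \<partial>D) \<le> RiskT D n p T s A"
proof -
  note TD = testsD[OF T]
  let ?J = "\<lambda>X. \<integral>y. lik n p (\<lambda>_. 0) X y * T (y, X) \<partial>gauss n"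
  let ?I = "\<lambda>\<omega> X. \<integral>y. lik n p (b \<omega>) X y * (1 - T (y, X)) \<partial>gauss n"
  have i: "integrable D ?J" "integrable D (?I \<omega>)" for \<omega>
    using integrable_inner_integral[OF TD(1,2)] integrable_inner_integral[OF TD(3,4)] by auto
  have "(\<Sum>\<omega>\<in>\<Omega>. Ebeta D n p (b \<omega>) (\<lambda>z. 1 - T z)) \<le> (\<Sum>\<omega>\<in>\<Omega>. (SUP \<beta>\<in>Xi p s A. Ebeta D n p \<beta> (\<lambda>z. 1 - T z)))"
    by (intro sum_mono cSUP_upper bdd_above_type2[OF T] bXi)
  then have "(\<Sum>\<omega>\<in>\<Omega>. Ebeta D n p (b \<omega>) (\<lambda>z. 1 - T z)) / real (card \<Omega>) \<le> (SUP \<beta>\<in>Xi p s A. Ebeta D n p \<beta> (\<lambda>z. 1 - T z))"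
    using card_pos by (simp add: divide_le_eq mult.commute)
  then have "Ebeta D n p (\<lambda>_. 0) T + (\<Sum>\<omega>\<in>\<Omega>. Ebeta D n p (b \<omega>) (\<lambda>z. 1 - T z)) / real (card \<Omega>) \<le> RiskT D n p T s A"
    by (simp add: RiskT_def)
  also have "Ebeta D n p (\<lambda>_. 0) T + (\<Sum>\<omega>\<in>\<Omega>. Ebeta D n p (b \<omega>) (\<lambda>z. 1 - T z)) / real (card \<Omega>)
     = (\<integral>X. ?J X + (\<Sum>\<omega>\<in>\<Omega>. ?I \<omega> X) / real (card \<Omega>) \<partial>D)"
    unfolding Ebeta_eq[OF TD(1)] Ebeta_eq[OF TD(3)] using i by simp
  finally have "(\<integral>X. ?J X + (\<Sum>\<omega>\<in>\<Omega>. ?I \<omega> X) / real (card \<Omega>) \<partial>D) \<le> RiskT D n p T s A" .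
  moreover have "(\<integral>X. (\<integral>y. min 1 (mix_lik n p \<Omega> b X y) \<partial>gauss n) \<partial>D) \<le> (\<integral>X. ?J X + (\<Sum>\<omega>\<in>\<Omega>. ?I \<omega> X) / real (card \<Omega>) \<partial>D)"
  proof (rule integral_mono_AE[OF integrable_bayes])
    show "AE X in D. (\<integral>y. min 1 (mix_lik n p \<Omega> b X y) \<partial>gauss n) \<le> ?J X + (\<Sum>\<omega>\<in>\<Omega>. ?I \<omega> X) / real (card \<Omega>)"
    proof (rule AE_I2)
      fix X assume X: "X \<in> space D"
      note j = inner_integral_bounds(3)[OF TD(1,2) X, of "\<lambda>_. 0"] inner_integral_bounds(3)[OF TD(3,4) X]
      have z: "mat_vec p X (\<lambda>_. 0) = (\<lambda>_. 0)" by (auto simp: mat_vec_def)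
      have l: "lik n p (\<lambda>_. 0) X y = 1" for y by (simp add: lik_def z sq_norm_def)
      have "?J X + (\<Sum>\<omega>\<in>\<Omega>. ?I \<omega> X) / real (card \<Omega>)
          = (\<integral>y. lik n p (\<lambda>_. 0) X y * T (y, X) + (\<Sum>\<omega>\<in>\<Omega>. lik n p (b \<omega>) X y * (1 - T (y, X))) / real (card \<Omega>) \<partial>gauss n)"
        using j by simp
      also have "\<dots> \<ge> (\<integral>y. min 1 (mix_lik n p \<Omega> b X y) \<partial>gauss n)"
      proof (rule integral_mono_AE[OF integrable_min])
        show "AE y in gauss n. min 1 (mix_lik n p \<Omega> b X y) \<le> lik n p (\<lambda>_. 0) X y * T (y, X) + (\<Sum>\<omega>\<in>\<Omega>. lik n p (b \<omega>) X y * (1 - T (y, X))) / real (card \<Omega>)"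
        proof (rule AE_I2)
          fix y assume "y \<in> space (gauss n)"
          then have T01: "0 \<le> T (y, X)" "T (y, X) \<le> 1"
            using TD(2)[of "(y, X)"] X by (auto simp: space_pair_measure space_D)
          have "min 1 (mix_lik n p \<Omega> b X y) * T (y, X) + min 1 (mix_lik n p \<Omega> b X y) * (1 - T (y, X)) \<le> 1 * T (y, X) + mix_lik n p \<Omega> b X y * (1 - T (y, X))"
            using T01 by (intro add_mono mult_right_mono) auto
          then have "min 1 (mix_lik n p \<Omega> b X y) \<le> T (y, X) + mix_lik n p \<Omega> b X y * (1 - T (y, X))" by (simp add: algebra_simps)
          then show "min 1 (mix_lik n p \<Omega> b X y) \<le> lik n p (\<lambda>_. 0) X y * T (y, X) + (\<Sum>\<omega>\<in>\<Omega>. lik n p (b \<omega>) X y * (1 - T (y, X))) / real (card \<Omega>)"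
            by (simp add: l mix_lik_def sum_distrib_right)
        qed
      qed (use j in auto)
      finally show "(\<integral>y. min 1 (mix_lik n p \<Omega> b X y) \<partial>gauss n) \<le> ?J X + (\<Sum>\<omega>\<in>\<Omega>. ?I \<omega> X) / real (card \<Omega>)" .
    qed
  qed (use i in auto)
  ultimately show ?thesis by linarith
qed

lemma Risk_ge_bayes: "(\<integral>X. (\<integral>y. min 1 (mix_lik n p \<Omega> b X y) \<partial>gauss n) \<partial>D) \<le> Risk D n p s A"
  unfolding Risk_def
proof (rule cINF_greatest)
  have "(\<lambda>_. 0) \<in> tests n p" by (simp add: tests_def)
  then show "tests n p \<noteq> {}" by auto
qed (rule RiskT_ge_bayes)

lemma overlap_pos: "overlap n p \<Omega> b c > 0"
  unfolding overlap_def using \<Omega> card_pos by (intro divide_pos_pos sum_pos) auto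

text \<open>\<open>truncated_second_moment_ineq\<close> integrated over \<open>y\<close> and then
  over \<open>X\<close>. The factor \<open>a\<close> normalises the tilted density;
  \<open>qhi\<close> and \<open>qlo\<close> are Chernoff bounds for \<open>S\<close> leaving
  \<open>[lo, hi]\<close>; \<open>m1\<close> bounds the mean of \<open>V\<close> from below and
  \<open>M2\<close> its second moment from above. In terms of the null measure these involve the
  tilts \<open>- t\<close> and \<open>- 3 * t\<close>, hence the factors \<open>1 + 2*t\<close> and
  \<open>1 + 6*t\<close>. The constant \<open>\<kappa>\<close> is fixed before integrating over
  \<open>X\<close>, so averaged moments suffice.\<close>

lemma Risk_ge:
  fixes t r hi lo :: real
  assumes t: "0 \<le> t" "t < 1/2" and r: "0 \<le> r" "t + r < 1/2" and C: "\<nu> \<ge> 0"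
  defines "a \<equiv> (1 - 2*t) powr (real p / 2)"
  defines "qhi \<equiv> a * exp (- r * hi) * (1 - 2*(t + r)) powr (- real p / 2)"
  defines "qlo \<equiv> a * exp (r * lo) * (1 - 2*(t - r)) powr (- real p / 2)"
  defines "m1 \<equiv> a * (1 + 2*t) powr (- real p / 2) * exp (- (t / (1 + 2*t)) * (real n * \<nu>))"
  defines "M2 \<equiv> a * (1 + 6*t) powr (- real p / 2) * exp (C - 6*t / (1 + 6*t) * (real n * \<nu>)) * overlap n p \<Omega> b (1 / (1 + 6*t))"
  defines "K \<equiv> min 1 (m1 / 2 * exp (2 * t * lo)) / (a * exp (t * hi))"
  shows "K * (m1\<^sup>2 / (4 * M2) - qhi - qlo) \<le> Risk D n p s A"
proof -
  let ?N = "real (card \<Omega>)"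
  let ?b = "\<lambda>\<omega> X. mat_vec p X (b \<omega>)"
  note N = card_pos
  have a: "a > 0" using t by (simp add: a_def)
  have m1: "m1 > 0" using a t by (simp add: m1_def)
  have M2: "M2 > 0" using a t overlap_pos by (simp add: M2_def)
  have K: "K > 0" using a m1 by (simp add: K_def)
  \<comment> \<open>Chosen so that the second-moment term becomes \<open>m1 / 4\<close>. Small
    values of \<open>V\<close> take \<open>m1 / 2\<close>, and \<open>m1 / 4\<close> remains for the
    Bayes risk and the two tails.\<close>
  define \<kappa> where "\<kappa> = 2 * M2 / m1"
  have \<kappa>: "\<kappa> > 0" using m1 M2 by (simp add: \<kappa>_def)
  define e where "e X = (\<integral>y. min 1 (mix_lik n p \<Omega> b X y) \<partial>gauss n)" for X
  define m1X where "m1X X = a * (1 + 2*t) powr (- real p / 2) * ((\<Sum>\<omega>\<in>\<Omega>. exp (- (t / (1 + 2*t)) * sq_norm n (?b \<omega> X))) / ?N)" for X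
  define h where "h \<omega> \<omega>' X = exp (1 / (1 + 6*t) * inner_vec n (?b \<omega> X) (?b \<omega>' X)
      - 3*t / (1 + 6*t) * (sq_norm n (?b \<omega> X) + sq_norm n (?b \<omega>' X)))" for \<omega> \<omega>' X
  define m2X where "m2X X = a * (1 + 6*t) powr (- real p / 2) * ((\<Sum>\<omega>\<in>\<Omega>. \<Sum>\<omega>'\<in>\<Omega>. h \<omega> \<omega>' X) / ?N\<^sup>2)" for X
  have ae: "AE X in D. m1X X \<le> m1 / 2 + \<kappa> / 2 * (e X / K + qhi + qlo) + m2X X / (2 * \<kappa>)"
    using AE_pos_def
  proof eventually_elim
    case (elim X)
    let ?S = "proj_sq n p X"
    have z: "mat_vec p X (\<lambda>_. 0) = (\<lambda>_. 0)" by (auto simp: mat_vec_def)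
    have l: "lik n p (\<lambda>_. 0) X y = 1" for y by (simp add: lik_def z sq_norm_def)
    have hE: "has_bochner_integral (gauss n) (\<lambda>y. exp (\<theta> * ?S y)) ((1 - 2*\<theta>) powr (- real p / 2))" if "\<theta> < 1/2" for \<theta>
      using lik_exp_proj[OF elim that, of "\<lambda>_. 0"] by (simp add: l z sq_norm_def)
    have i1: "has_bochner_integral (gauss n) (\<lambda>y. a * exp (t * ?S y) * (m1 / 2)) (m1 / 2)"
    proof -
      let ?P = "(1 - 2*t) powr (- real p / 2)"
      have P: "a * ?P = 1"
        using t unfolding a_def by (simp add: powr_add[symmetric])
      have "has_bochner_integral (gauss n) (\<lambda>y. a * (m1 / 2) * exp (t * ?S y)) (a * (m1 / 2) * ?P)"
        using t by (intro has_bochner_integral_cmult hE) auto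
      moreover have "a * (m1 / 2) * ?P = m1 / 2" using P by (metis mult.commute mult.left_commute mult_1_right)
      moreover have "(\<lambda>y. a * (m1 / 2) * exp (t * ?S y)) = (\<lambda>y. a * exp (t * ?S y) * (m1 / 2))" by (simp add: mult_ac)
      ultimately show ?thesis by (simp only:)
    qed
    have i2: "has_bochner_integral (gauss n) (\<lambda>y. a * exp (t * ?S y) * exp (r * (?S y - hi))) qhi"
    proof -
      have "(\<lambda>y. a * exp (- r * hi) * exp ((t + r) * ?S y)) = (\<lambda>y. a * exp (t * ?S y) * exp (r * (?S y - hi)))"
        by (simp add: mult.assoc exp_add[symmetric] algebra_simps)
      then show ?thesis
        using has_bochner_integral_cmult[OF hE[of "t + r"], of "a * exp (- r * hi)"] r by (simp add: qhi_def)
    qed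
    have i3: "has_bochner_integral (gauss n) (\<lambda>y. a * exp (t * ?S y) * exp (r * (lo - ?S y))) qlo"
    proof -
      have "(\<lambda>y. a * exp (r * lo) * exp ((t - r) * ?S y)) = (\<lambda>y. a * exp (t * ?S y) * exp (r * (lo - ?S y)))"
        by (simp add: mult.assoc exp_add[symmetric] algebra_simps)
      then show ?thesis
        using has_bochner_integral_cmult[OF hE[of "t - r"], of "a * exp (r * lo)"] r t by (simp add: qlo_def)
    qed
    have i4: "has_bochner_integral (gauss n) (\<lambda>y. a * mix_lik n p \<Omega> b X y * exp (- t * ?S y)) (m1X X)"
    proof -
      have "has_bochner_integral (gauss n) (\<lambda>y. \<Sum>\<omega>\<in>\<Omega>. lik n p (b \<omega>) X y * exp ((-t) * ?S y))
          (\<Sum>\<omega>\<in>\<Omega>. (1 - 2*(-t)) powr (- real p / 2) * exp ((-t) / (1 - 2*(-t)) * sq_norm n (?b \<omega> X)))"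
        using t by (intro has_bochner_integral_sum lik_exp_proj elim) auto
      from has_bochner_integral_cmult[OF this, of "a / ?N"]
      show ?thesis
        by (simp add: mix_lik_def m1X_def sum_distrib_left sum_distrib_right sum_divide_distrib mult_ac)
    qed
    have i5: "has_bochner_integral (gauss n) (\<lambda>y. a * (mix_lik n p \<Omega> b X y)\<^sup>2 * exp (- 3 * t * ?S y) / (2 * \<kappa>)) (m2X X / (2 * \<kappa>))"
    proof -
      have "has_bochner_integral (gauss n) (\<lambda>y. \<Sum>\<omega>\<in>\<Omega>. \<Sum>\<omega>'\<in>\<Omega>. lik n p (b \<omega>) X y * lik n p (b \<omega>') X y * exp (- (3*t) * ?S y))
          (\<Sum>\<omega>\<in>\<Omega>. \<Sum>\<omega>'\<in>\<Omega>. (1 + 2*(3*t)) powr (- real p / 2) * exp (1 / (1 + 2*(3*t)) * inner_vec n (?b \<omega> X) (?b \<omega>' X)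
             - 3*t / (1 + 2*(3*t)) * (sq_norm n (?b \<omega> X) + sq_norm n (?b \<omega>' X))))"
        using t by (intro has_bochner_integral_sum lik_lik_exp_proj elim) auto
      from has_bochner_integral_cmult[OF this, of "a / ?N\<^sup>2 / (2 * \<kappa>)"]
      have "has_bochner_integral (gauss n) (\<lambda>y. a / ?N\<^sup>2 / (2 * \<kappa>) * (\<Sum>\<omega>\<in>\<Omega>. \<Sum>\<omega>'\<in>\<Omega>. lik n p (b \<omega>) X y * lik n p (b \<omega>') X y * exp (- (3*t) * ?S y)))
         (m2X X / (2 * \<kappa>))"
        by (simp add: m2X_def h_def sum_distrib_left[symmetric] mult_ac)
      moreover have "a / ?N\<^sup>2 / (2 * \<kappa>) * (\<Sum>\<omega>\<in>\<Omega>. \<Sum>\<omega>'\<in>\<Omega>. lik n p (b \<omega>) X y * lik n p (b \<omega>') X y * exp (- (3*t) * ?S y))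
          = a * (mix_lik n p \<Omega> b X y)\<^sup>2 * exp (- 3 * t * ?S y) / (2 * \<kappa>)" for y
      proof -
        have "(\<Sum>\<omega>\<in>\<Omega>. lik n p (b \<omega>) X y)\<^sup>2 * E = (\<Sum>\<omega>\<in>\<Omega>. \<Sum>\<omega>'\<in>\<Omega>. lik n p (b \<omega>) X y * lik n p (b \<omega>') X y * E)" for E
          unfolding power2_eq_square sum_product by (simp only: sum_distrib_right)
        from this[symmetric] show ?thesis by (simp add: mix_lik_def power_divide)
      qed
      ultimately show ?thesis by simp
    qed
    have i6: "has_bochner_integral (gauss n) (\<lambda>y. min 1 (mix_lik n p \<Omega> b X y) / K) (e X / K)"
      unfolding e_def using integrable_min[of X] by (simp add: has_bochner_integral_iff)
    have R: "has_bochner_integral (gauss n) (\<lambda>y. a * exp (t * ?S y) * (m1 / 2)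
      + \<kappa> / 2 * (min 1 (mix_lik n p \<Omega> b X y) / K + a * exp (t * ?S y) * exp (r * (?S y - hi)) + a * exp (t * ?S y) * exp (r * (lo - ?S y)))
      + a * (mix_lik n p \<Omega> b X y)\<^sup>2 * exp (- 3 * t * ?S y) / (2 * \<kappa>)) (m1 / 2 + \<kappa> / 2 * (e X / K + qhi + qlo) + m2X X / (2 * \<kappa>))"
      by (intro has_bochner_integral_add i1 i5 i6 i2 i3 has_bochner_integral_mult_right)
    have "(\<integral>y. a * mix_lik n p \<Omega> b X y * exp (- t * ?S y) \<partial>gauss n) \<le> (\<integral>y. a * exp (t * ?S y) * (m1 / 2)
      + \<kappa> / 2 * (min 1 (mix_lik n p \<Omega> b X y) / K + a * exp (t * ?S y) * exp (r * (?S y - hi)) + a * exp (t * ?S y) * exp (r * (lo - ?S y)))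
      + a * (mix_lik n p \<Omega> b X y)\<^sup>2 * exp (- 3 * t * ?S y) / (2 * \<kappa>) \<partial>gauss n)"
      using i4 R truncated_second_moment_ineq[OF a t(1) mix_lik_pos m1 \<kappa> r(1)]
      by (intro integral_mono) (auto simp: has_bochner_integral_iff K_def)
    then show ?case using i4 R by (simp add: has_bochner_integral_iff)
  qed
  have int_e: "integrable D e" unfolding e_def[abs_def] by (rule integrable_bayes)
  have h: "integrable D (h \<omega> \<omega>')" "(\<integral>X. h \<omega> \<omega>' X \<partial>D) \<le> exp (C - 6*t / (1 + 6*t) * (real n * \<nu>)) * exp (real n * (1 / (1 + 6*t) * inner_vec p (b \<omega>) (b \<omega>')))"
    if mem: "\<omega> \<in> \<Omega>" "\<omega>' \<in> \<Omega>" for \<omega> \<omega>'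
  proof -
    obtain m where m: "has_bochner_integral D (h \<omega> \<omega>') m"
    and le: "m \<le> exp (real n * (1 / (1 + 6*t) * inner_vec p (b \<omega>) (b \<omega>') - 2 * (3*t / (1 + 6*t)) * \<nu>) + C)"
      using mgf_D[OF bsq bsq, OF mem, of "1 / (1 + 6*t)" "3*t / (1 + 6*t)"] t by (auto simp: h_def[abs_def] field_simps)
    have eq: "real n * (1 / (1 + 6*t) * inner_vec p (b \<omega>) (b \<omega>') - 2 * (3*t / (1 + 6*t)) * \<nu>) + C
       = (C - 6*t / (1 + 6*t) * (real n * \<nu>)) + real n * (1 / (1 + 6*t) * inner_vec p (b \<omega>) (b \<omega>'))"
      by (simp add: algebra_simps)
    show "integrable D (h \<omega> \<omega>')" using m by (simp add: has_bochner_integral_iff)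
    have "(\<integral>X. h \<omega> \<omega>' X \<partial>D) = m" using m by (simp only: has_bochner_integral_iff)
    then show "(\<integral>X. h \<omega> \<omega>' X \<partial>D) \<le> exp (C - 6*t / (1 + 6*t) * (real n * \<nu>)) * exp (real n * (1 / (1 + 6*t) * inner_vec p (b \<omega>) (b \<omega>')))"
      using le unfolding eq exp_add by (simp only:)
  qed
  have int_m2: "integrable D m2X"
    unfolding m2X_def[abs_def] using h(1) by (intro integrable_mult_right integrable_divide integrable_sum) auto
  have m2: "(\<integral>X. m2X X \<partial>D) \<le> M2"
  proof -
    have "(\<integral>X. m2X X \<partial>D) = a * (1 + 6*t) powr (- real p / 2) * ((\<Sum>\<omega>\<in>\<Omega>. \<Sum>\<omega>'\<in>\<Omega>. (\<integral>X. h \<omega> \<omega>' X \<partial>D)) / ?N\<^sup>2)"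
      unfolding m2X_def using h(1) by (simp add: integral_sum integrable_sum)
    also have "\<dots> \<le> a * (1 + 6*t) powr (- real p / 2) * ((\<Sum>\<omega>\<in>\<Omega>. \<Sum>\<omega>'\<in>\<Omega>. exp (C - 6*t / (1 + 6*t) * (real n * \<nu>)) * exp (real n * (1 / (1 + 6*t) * inner_vec p (b \<omega>) (b \<omega>')))) / ?N\<^sup>2)"
      using h(2) a by (intro mult_left_mono divide_right_mono sum_mono) auto
    also have "\<dots> = M2"
      by (simp add: M2_def overlap_def sum_distrib_left[symmetric])
    finally show ?thesis .
  qed
  define \<theta> where "\<theta> = t / (1 + 2*t)"
  have \<theta>: "\<theta> \<ge> 0" using t by (simp add: \<theta>_def)
  have q: "integrable D (\<lambda>X. exp (- \<theta> * sq_norm n (?b \<omega> X)))" "exp (- \<theta> * (real n * \<nu>)) \<le> (\<integral>X. exp (- \<theta> * sq_norm n (?b \<omega> X)) \<partial>D)"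
    if \<omega>: "\<omega> \<in> \<Omega>" for \<omega>
  proof -
    show i: "integrable D (\<lambda>X. exp (- \<theta> * sq_norm n (?b \<omega> X)))"
      by (rule integrable_const_bound[where B=1]) (auto simp: \<theta> sq_norm_nonneg)
    let ?E = "exp (- \<theta> * (real n * \<nu>))"
    note hq = sq_norm_D[OF bsq[OF \<omega>]]
    \<comment> \<open>Jensen's inequality, written as integration of the tangent to the exponential
      at the mean \<open>real n * \<nu>\<close> of the squared norm.\<close>
    have "?E = (\<integral>X. ?E * (1 + \<theta> * (real n * \<nu>)) - ?E * \<theta> * sq_norm n (?b \<omega> X) \<partial>D)"
      using hq by (simp add: has_bochner_integral_iff prob_space algebra_simps)
    also have "\<dots> \<le> (\<integral>X. exp (- \<theta> * sq_norm n (?b \<omega> X)) \<partial>D)"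
    proof (rule integral_mono)
      fix X
      have "?E * (1 + \<theta> * (real n * \<nu>)) - ?E * \<theta> * sq_norm n (?b \<omega> X) = ?E * (1 + (\<theta> * (real n * \<nu>) - \<theta> * sq_norm n (?b \<omega> X)))"
        by (simp add: algebra_simps)
      also have "\<dots> \<le> ?E * exp (\<theta> * (real n * \<nu>) - \<theta> * sq_norm n (?b \<omega> X))"
        by (intro mult_left_mono exp_ge_add_one_self) auto
      also have "\<dots> = exp (- \<theta> * sq_norm n (?b \<omega> X))" by (simp flip: exp_add)
      finally show "?E * (1 + \<theta> * (real n * \<nu>)) - ?E * \<theta> * sq_norm n (?b \<omega> X) \<le> exp (- \<theta> * sq_norm n (?b \<omega> X))" .
    qed (use hq i in \<open>auto simp: has_bochner_integral_iff\<close>)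
    finally show "?E \<le> (\<integral>X. exp (- \<theta> * sq_norm n (?b \<omega> X)) \<partial>D)" .
  qed
  have int_m1: "integrable D m1X"
    unfolding m1X_def[abs_def] \<theta>_def[symmetric] using q(1) by (intro integrable_mult_right integrable_divide integrable_sum) auto
  have "m1 = a * (1 + 2*t) powr (- real p / 2) * ((\<Sum>\<omega>\<in>\<Omega>. exp (- \<theta> * (real n * \<nu>))) / ?N)"
    using N by (simp add: m1_def \<theta>_def)
  also have "\<dots> \<le> a * (1 + 2*t) powr (- real p / 2) * ((\<Sum>\<omega>\<in>\<Omega>. (\<integral>X. exp (- \<theta> * sq_norm n (?b \<omega> X)) \<partial>D)) / ?N)"
    using a q(2) by (intro mult_left_mono divide_right_mono sum_mono) auto
  also have "\<dots> = (\<integral>X. m1X X \<partial>D)"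
    unfolding m1X_def \<theta>_def[symmetric] using q(1) by (simp add: integral_sum integrable_sum)
  also have "\<dots> \<le> (\<integral>X. m1 / 2 + \<kappa> / 2 * (e X / K + qhi + qlo) + m2X X / (2 * \<kappa>) \<partial>D)"
    using int_m1 int_e int_m2 ae by (intro integral_mono_AE) auto
  also have "\<dots> = m1 / 2 + \<kappa> / 2 * ((\<integral>X. e X \<partial>D) / K + qhi + qlo) + (\<integral>X. m2X X \<partial>D) / (2 * \<kappa>)"
    using int_e int_m2 by (simp add: prob_space)
  also have "\<dots> \<le> m1 / 2 + \<kappa> / 2 * ((\<integral>X. e X \<partial>D) / K + qhi + qlo) + M2 / (2 * \<kappa>)"
    using m2 \<kappa> by (simp add: divide_right_mono)
  also have "M2 / (2 * \<kappa>) = m1 / 4" using m1 M2 by (simp add: \<kappa>_def)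
  finally have "m1 / 4 \<le> \<kappa> / 2 * ((\<integral>X. e X \<partial>D) / K + qhi + qlo)" by linarith
  then have "m1\<^sup>2 / (4 * M2) \<le> (\<integral>X. e X \<partial>D) / K + qhi + qlo"
    using m1 M2 by (simp add: \<kappa>_def field_simps power2_eq_square)
  then have "m1\<^sup>2 / (4 * M2) - qhi - qlo \<le> (\<integral>X. e X \<partial>D) / K" by linarith
  then have "K * (m1\<^sup>2 / (4 * M2) - qhi - qlo) \<le> (\<integral>X. e X \<partial>D)"
    using K by (simp add: field_simps)
  then show ?thesis using Risk_ge_bayes unfolding e_def by linarith
qed

end

end

section \<open>The block prior\<close>

definition block_index :: "nat \<Rightarrow> nat \<Rightarrow> (nat \<Rightarrow> nat \<times> real) set" where
  "block_index s m = {..<s} \<rightarrow>\<^sub>E ({..<m} \<times> {-1, 1})"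

text \<open>
  Block \<open>k\<close> is \<open>{k * m..<(k + 1) * m}\<close>, and \<open>\<omega> k = (i, \<tau>)\<close> puts the entry \<open>\<tau> * A\<close> at position \<open>i\<close> of that block. The blocks make
  the overlap of two independent draws a sum of independent terms.
\<close>

definition block_vec :: "nat \<Rightarrow> nat \<Rightarrow> real \<Rightarrow> (nat \<Rightarrow> nat \<times> real) \<Rightarrow> nat \<Rightarrow> real" where
  "block_vec s m A \<omega> j = (if j < s * m \<and> fst (\<omega> (j div m)) = j mod m then A * snd (\<omega> (j div m)) else 0)"

lemma finite_block_index: "finite (block_index s m)"
  unfolding block_index_def by (intro finite_PiE) auto

lemma card_block_index: "card (block_index s m) = (2 * m) ^ s"
proof -
  have "card ({..<m} \<times> {-1, 1::real}) = 2 * m" by (simp add: card_cartesian_product)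
  then show ?thesis unfolding block_index_def by (subst card_PiE) (simp_all only: prod_constant card_lessThan finite_lessThan)
qed

lemma block_indexD:
  assumes "\<omega> \<in> block_index s m" "k < s"
  shows "fst (\<omega> k) < m" "snd (\<omega> k) = -1 \<or> snd (\<omega> k) = 1"
proof -
  have "\<omega> k \<in> {..<m} \<times> {-1, 1}" using assms by (auto simp: block_index_def PiE_iff)
  then show "fst (\<omega> k) < m" "snd (\<omega> k) = -1 \<or> snd (\<omega> k) = 1" by auto
qed

lemma sum_blocks:
  fixes f :: "nat \<Rightarrow> real"
  shows "(\<Sum>j<s * m. f j) = (\<Sum>k<s. \<Sum>i<m. f (k * m + i))"
proof -
  have "(\<Sum>j<s * m. f j) = (\<Sum>k<s. sum f {k * m..<k * m + m})"
    by (rule sum.nat_group[symmetric])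
  moreover have "sum f {k * m..<k * m + m} = (\<Sum>i<m. f (k * m + i))" for k
    using sum.shift_bounds_nat_ivl[of f 0 "k * m" m] by (simp add: lessThan_atLeast0 add.commute)
  ultimately show ?thesis by simp
qed

lemma block_vec_at:
  assumes "k < s" "i < m"
  shows "block_vec s m A \<omega> (k * m + i) = (if fst (\<omega> k) = i then A * snd (\<omega> k) else 0)"
proof -
  have "k * m + i < (k + 1) * m" using assms by simp
  also have "\<dots> \<le> s * m" using assms by (intro mult_le_mono1) simp
  finally show ?thesis using assms by (simp add: block_vec_def)
qed

lemma inner_block_vec:
  assumes w: "\<omega> \<in> block_index s m" and p: "s * m \<le> p"
  shows "inner_vec p (block_vec s m A \<omega>) (block_vec s m A \<omega>')
    = A\<^sup>2 * (\<Sum>k<s. if fst (\<omega> k) = fst (\<omega>' k) then snd (\<omega> k) * snd (\<omega>' k) else 0)"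
proof -
  have "inner_vec p (block_vec s m A \<omega>) (block_vec s m A \<omega>') = inner_vec (s * m) (block_vec s m A \<omega>) (block_vec s m A \<omega>')"
    using p by (intro sum.mono_neutral_right) (auto simp: block_vec_def)
  also have "\<dots> = (\<Sum>k<s. \<Sum>i<m. block_vec s m A \<omega> (k * m + i) * block_vec s m A \<omega>' (k * m + i))"
    by (rule sum_blocks)
  also have "\<dots> = (\<Sum>k<s. A\<^sup>2 * (if fst (\<omega> k) = fst (\<omega>' k) then snd (\<omega> k) * snd (\<omega>' k) else 0))"
  proof (rule sum.cong[OF refl])
    fix k assume "k \<in> {..<s}"
    then have k: "k < s" by simp
    have "(\<Sum>i<m. block_vec s m A \<omega> (k * m + i) * block_vec s m A \<omega>' (k * m + i))
        = (\<Sum>i<m. if fst (\<omega> k) = i then A\<^sup>2 * (if fst (\<omega> k) = fst (\<omega>' k) then snd (\<omega> k) * snd (\<omega>' k) else 0) else 0)"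
      using k by (intro sum.cong refl) (auto simp: block_vec_at power2_eq_square)
    then show "(\<Sum>i<m. block_vec s m A \<omega> (k * m + i) * block_vec s m A \<omega>' (k * m + i))
        = A\<^sup>2 * (if fst (\<omega> k) = fst (\<omega>' k) then snd (\<omega> k) * snd (\<omega>' k) else 0)"
      using block_indexD(1)[OF w k] by simp
  qed
  finally show ?thesis by (simp add: sum_distrib_left)
qed

lemma sq_norm_block_vec:
  assumes w: "\<omega> \<in> block_index s m" and p: "s * m \<le> p"
  shows "sq_norm p (block_vec s m A \<omega>) = real s * A\<^sup>2"
proof -
  have "sq_norm p (block_vec s m A \<omega>) = inner_vec p (block_vec s m A \<omega>) (block_vec s m A \<omega>)"
    by (simp add: sq_norm_def power2_eq_square)
  also have "\<dots> = A\<^sup>2 * (\<Sum>k<s. 1)"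
    unfolding inner_block_vec[OF assms] using block_indexD(2)[OF w]
    by (intro arg_cong[where f="\<lambda>x. A\<^sup>2 * x"] sum.cong refl) fastforce
  finally show ?thesis by simp
qed

lemma block_vec_Xi:
  assumes w: "\<omega> \<in> block_index s m" and p: "s * m \<le> p" and A: "A > 0"
  shows "block_vec s m A \<omega> \<in> Xi p s A"
proof -
  have nz: "snd (\<omega> k) \<noteq> 0" "\<bar>snd (\<omega> k)\<bar> = 1" if "k < s" for k
    using block_indexD(2)[OF w that] by auto
  have dv: "j div m < s" if "j < s * m" for j
    using that by (simp add: less_mult_imp_div_less)
  have "{j. block_vec s m A \<omega> j \<noteq> 0} = (\<lambda>k. k * m + fst (\<omega> k)) ` {..<s}"
  proof (intro set_eqI iffI)
    fix j assume "j \<in> {j. block_vec s m A \<omega> j \<noteq> 0}"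
    then have j: "j < s * m" "fst (\<omega> (j div m)) = j mod m" by (auto simp: block_vec_def split: if_splits)
    then show "j \<in> (\<lambda>k. k * m + fst (\<omega> k)) ` {..<s}"
      using dv[OF j(1)] by (intro image_eqI[of _ _ "j div m"]) simp_all
  next
    fix j assume "j \<in> (\<lambda>k. k * m + fst (\<omega> k)) ` {..<s}"
    then obtain k where k: "k < s" "j = k * m + fst (\<omega> k)" by auto
    then show "j \<in> {j. block_vec s m A \<omega> j \<noteq> 0}"
      using block_vec_at[OF k(1) block_indexD(1)[OF w k(1)], of A \<omega>] nz A by auto
  qed
  moreover have "inj_on (\<lambda>k. k * m + fst (\<omega> k)) {..<s}"
  proof (rule inj_onI)
    fix k l assume kl: "k \<in> {..<s}" "l \<in> {..<s}" "k * m + fst (\<omega> k) = l * m + fst (\<omega> l)"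
    have d: "(k * m + fst (\<omega> k)) div m = k" if "k < s" for k
      using block_indexD(1)[OF w that] by simp
    show "k = l" using d[of k] d[of l] kl by (metis lessThan_iff)
  qed
  ultimately have "card {j. block_vec s m A \<omega> j \<noteq> 0} = s" by (simp add: card_image)
  moreover have "A \<le> \<bar>block_vec s m A \<omega> j\<bar>" if "block_vec s m A \<omega> j \<noteq> 0" for j
    using that nz[of "j div m"] dv[of j] A by (auto simp: block_vec_def abs_mult split: if_splits)
  moreover have "block_vec s m A \<omega> j = 0" if "j \<ge> p" for j
    using that p by (simp add: block_vec_def)
  ultimately show ?thesis by (simp add: Xi_def)
qed

text \<open>In each block two independent draws share their position with probability
  \<open>1 / m\<close>, and the product of their signs is then 1 or -1 equally often, which produces
  \<open>cosh\<close>. The signs cancel the linear term of the exponential; in the regime of the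
  theorem that term would be of order \<open>p powr (1/2 + \<delta> - \<alpha>)\<close> and would
  swamp \<open>p powr (2 * \<delta>)\<close>.\<close>

lemma block_overlap:
  assumes p: "s * m \<le> p" and m: "m > 0"
  shows "(\<Sum>\<omega>\<in>block_index s m. \<Sum>\<omega>'\<in>block_index s m. exp (x * inner_vec p (block_vec s m A \<omega>) (block_vec s m A \<omega>')))
      / (real (card (block_index s m)))\<^sup>2 \<le> exp (real s / real m * (cosh (x * A\<^sup>2) - 1))"
proof -
  let ?y = "x * A\<^sup>2"
  let ?g = "\<lambda>a b. if fst a = fst b then snd a * snd b else (0::real)"
  let ?q = "2 * real m - 2 + 2 * cosh ?y"
  \<comment> \<open>By symmetry of the index set the inner sum is the same for every
    \<open>\<omega>\<close>, so the outer sum merely multiplies by the cardinality.\<close>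
  have row: "(\<Sum>\<omega>'\<in>block_index s m. exp (x * inner_vec p (block_vec s m A \<omega>) (block_vec s m A \<omega>'))) = ?q ^ s"
    if w: "\<omega> \<in> block_index s m" for \<omega>
  proof -
    have "(\<Sum>\<omega>'\<in>block_index s m. exp (x * inner_vec p (block_vec s m A \<omega>) (block_vec s m A \<omega>')))
       = (\<Sum>\<omega>'\<in>block_index s m. \<Prod>k<s. exp (?y * ?g (\<omega> k) (\<omega>' k)))"
      by (simp only: inner_block_vec[OF w p] mult.assoc[symmetric]) (simp add: sum_distrib_left exp_sum)
    also have "\<dots> = (\<Prod>k<s. \<Sum>z\<in>{..<m} \<times> {-1, 1}. exp (?y * ?g (\<omega> k) z))"
      unfolding block_index_def by (rule prod_sum_PiE[symmetric]) auto
    also have "\<dots> = (\<Prod>k<s. ?q)"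
    proof (rule prod.cong[OF refl])
      fix k assume "k \<in> {..<s}"
      then have k: "k < s" by simp
      note wk = block_indexD[OF w k]
      have c: "exp ?y + exp (- ?y) = 2 * cosh ?y" by (simp add: cosh_def)
      have "(\<Sum>z\<in>{..<m} \<times> {-1, 1}. exp (?y * ?g (\<omega> k) z)) = (\<Sum>i<m. \<Sum>\<tau>\<in>{-1, 1}. exp (?y * ?g (\<omega> k) (i, \<tau>)))"
        unfolding sum.cartesian_product by (intro sum.cong refl) auto
      also have "\<dots> = (\<Sum>i<m. 2 + (if i = fst (\<omega> k) then 2 * cosh ?y - 2 else 0))"
        using wk(2) c by (intro sum.cong refl) (auto simp: algebra_simps)
      also have "\<dots> = ?q" using wk(1) by (simp add: sum.distrib)
      finally show "(\<Sum>z\<in>{..<m} \<times> {-1, 1}. exp (?y * ?g (\<omega> k) z)) = ?q" .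
    qed
    finally show ?thesis by simp
  qed
  have m0: "(2 * real m) ^ s \<noteq> 0" using m by simp
  have "(\<Sum>\<omega>\<in>block_index s m. \<Sum>\<omega>'\<in>block_index s m. exp (x * inner_vec p (block_vec s m A \<omega>) (block_vec s m A \<omega>')))
      / (real (card (block_index s m)))\<^sup>2 = (2 * real m) ^ s * ?q ^ s / ((2 * real m) ^ s)\<^sup>2"
    by (simp add: row card_block_index)
  also have "\<dots> = (?q / (2 * real m)) ^ s"
    using m0 by (simp add: power2_eq_square power_divide)
  also have "?q / (2 * real m) = 1 + (cosh ?y - 1) / real m"
    using m by (simp add: field_simps)
  also have "(1 + (cosh ?y - 1) / real m) ^ s \<le> exp ((cosh ?y - 1) / real m) ^ s"
    using cosh_real_ge_1[of ?y] by (intro power_mono exp_ge_add_one_self) simp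
  also have "\<dots> = exp (real s / real m * (cosh ?y - 1))"
    by (simp add: exp_of_nat_mult[symmetric])
  finally show ?thesis .
qed

section \<open>The two design classes\<close>

lemma inner_mat_vec_gram:
  "inner_vec n (mat_vec p X \<beta>) (mat_vec p X \<beta>') = (\<Sum>j<p. \<Sum>k<p. \<beta> j * gram n X j k * \<beta>' k)"
proof -
  have "inner_vec n (mat_vec p X \<beta>) (mat_vec p X \<beta>') = (\<Sum>i<n. \<Sum>j<p. \<Sum>k<p. \<beta> j * (X (i, j) * X (i, k)) * \<beta>' k)"
    by (simp add: mat_vec_def sum_product mult_ac)
  also have "\<dots> = (\<Sum>j<p. \<Sum>k<p. \<beta> j * gram n X j k * \<beta>' k)"
    unfolding gram_def sum_distrib_left sum_distrib_right
    by (subst sum.swap) (simp add: sum.swap[of _ "{..<p}" "{..<n}"])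
  finally show ?thesis .
qed

lemma sq_norm_inner: "sq_norm n v = inner_vec n v v"
  by (simp add: sq_norm_def power2_eq_square)

lemma double_sum_delta:
  fixes c :: real
  shows "(\<Sum>j<p. \<Sum>k<p. \<beta> j * (if j = k then c else 0) * \<beta>' k) = c * inner_vec p \<beta> \<beta>'"
proof -
  have "(\<Sum>j<p. \<Sum>k<p. \<beta> j * (if j = k then c else 0) * \<beta>' k) = (\<Sum>j<p. \<Sum>k<p. if j = k then \<beta> j * c * \<beta>' j else 0)"
    by (intro sum.cong refl) auto
  then show ?thesis by (simp add: sum_distrib_left mult_ac)
qed

lemma design_Orth:
  assumes O: "Orth n p D" and n: "n > 0"
  shows "design n p D \<nu> 0"
proof -
  have ps: "prob_space D" and s[measurable_cong]: "sets D = sets (mat_space n p)"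
    and g: "AE X in D. \<forall>j<p. \<forall>k<p. gram n X j k = (if j = k then real n else 0)"
    using O by (auto simp: Orth_def)
  interpret prob_space D by (rule ps)
  \<comment> \<open>The vectors are quantified inside the almost-sure statement: positive
    definiteness concerns uncountably many of them, so the null set must not depend on them.\<close>
  have inner: "AE X in D. \<forall>\<beta> \<beta>'. inner_vec n (mat_vec p X \<beta>) (mat_vec p X \<beta>') = real n * inner_vec p \<beta> \<beta>'"
    using g
  proof eventually_elim
    case (elim X)
    have "(\<Sum>j<p. \<Sum>k<p. \<beta> j * gram n X j k * \<beta>' k) = (\<Sum>j<p. \<Sum>k<p. \<beta> j * (if j = k then real n else 0) * \<beta>' k)" for \<beta> \<beta>' :: "nat \<Rightarrow> real"
      using elim by (intro sum.cong refl) auto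
    then show ?case by (simp only: inner_mat_vec_gram double_sum_delta) simp
  qed
  show ?thesis
  proof
    show "AE X in D. pos_def p (gram n X)"
      using inner
    proof eventually_elim
      case (elim X)
      show ?case unfolding pos_def_def
      proof (intro allI impI)
        fix v :: "nat \<Rightarrow> real" assume "\<exists>j<p. v j \<noteq> 0"
        then obtain j where j: "j < p" "v j \<noteq> 0" by auto
        have "0 < (v j)\<^sup>2" using j by simp
        also have "\<dots> \<le> sq_norm p v" unfolding sq_norm_def using j by (intro member_le_sum) auto
        finally show "0 < (\<Sum>j<p. \<Sum>k<p. v j * gram n X j k * v k)"
          using elim n unfolding inner_mat_vec_gram[symmetric] by (simp add: sq_norm_inner)
      qed
    qed
    show "has_bochner_integral D (\<lambda>X. sq_norm n (mat_vec p X \<beta>)) (real n * \<nu>)" if "sq_norm p \<beta> = \<nu>" for \<beta>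
    proof -
      have "has_bochner_integral D (\<lambda>X. real n * \<nu>) (real n * \<nu>)"
        by (simp add: has_bochner_integral_iff prob_space)
      moreover have "AE X in D. real n * \<nu> = sq_norm n (mat_vec p X \<beta>)"
        using inner by eventually_elim (use that in \<open>simp add: sq_norm_inner\<close>)
      ultimately show ?thesis
        by (subst has_bochner_integral_cong_AE[symmetric]) auto
    qed
    show "\<exists>m. has_bochner_integral D (\<lambda>X. exp (c * inner_vec n (mat_vec p X \<beta>) (mat_vec p X \<beta>')
              - d * (sq_norm n (mat_vec p X \<beta>) + sq_norm n (mat_vec p X \<beta>')))) m
          \<and> m \<le> exp (real n * (c * inner_vec p \<beta> \<beta>' - 2 * d * \<nu>) + 0)"
      if "sq_norm p \<beta> = \<nu>" "sq_norm p \<beta>' = \<nu>" for \<beta> \<beta>' c d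
    proof -
      let ?m = "exp (real n * (c * inner_vec p \<beta> \<beta>' - 2 * d * \<nu>))"
      have "has_bochner_integral D (\<lambda>X. ?m) ?m"
        by (simp add: has_bochner_integral_iff prob_space)
      moreover have "AE X in D. ?m = exp (c * inner_vec n (mat_vec p X \<beta>) (mat_vec p X \<beta>')
              - d * (sq_norm n (mat_vec p X \<beta>) + sq_norm n (mat_vec p X \<beta>')))"
        using inner by eventually_elim (use that in \<open>simp add: sq_norm_inner algebra_simps\<close>)
      ultimately have "has_bochner_integral D (\<lambda>X. exp (c * inner_vec n (mat_vec p X \<beta>) (mat_vec p X \<beta>')
              - d * (sq_norm n (mat_vec p X \<beta>) + sq_norm n (mat_vec p X \<beta>')))) ?m"
        by (subst has_bochner_integral_cong_AE[symmetric]) auto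
      then show ?thesis by (intro exI[of _ ?m]) simp
    qed
  qed (use ps s in auto)
qed

section \<open>Sub-Gaussian rows\<close>

text \<open>The linearisation used for Gaussian integrals works here too: the exponential of
  \<open>\<eta> * (q x)\<^sup>2\<close> is the average of \<open>exp (c * q x * g)\<close> over a
  standard normal \<open>g\<close>, and Fubini brings in the sub-Gaussian bound. With
  \<open>\<eta> = 1 / (4 * \<sigma>2)\<close> the remaining integrand is
  \<open>exp (g\<^sup>2 / 4)\<close>, whose mean is the square root of 2.\<close>

lemma subgaussian_exp_square:
  fixes q :: "'a \<Rightarrow> real" and R :: "'a measure"
  assumes R: "prob_space R" and q[measurable]: "q \<in> borel_measurable R"
    and i: "\<And>t. integrable R (\<lambda>x. exp (t * q x))"
    and b: "\<And>t. (\<integral>x. exp (t * q x) \<partial>R) \<le> exp (\<sigma>2 * t\<^sup>2 / 2)"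
    and \<sigma>: "\<sigma>2 > 0" and \<eta>: "\<eta> = 1 / (4 * \<sigma>2)"
  shows "integrable R (\<lambda>x. exp (\<eta> * (q x)\<^sup>2))" "(\<integral>x. exp (\<eta> * (q x)\<^sup>2) \<partial>R) \<le> 2"
proof -
  interpret R: prob_space R by (rule R)
  interpret N: prob_space std_normal_distribution by (rule prob_space_std_normal)
  interpret P: pair_sigma_finite R std_normal_distribution ..
  have \<eta>0: "\<eta> > 0" using \<eta> \<sigma> by simp
  define c where "c = sqrt (2 * \<eta>)"
  have c: "c\<^sup>2 = 2 * \<eta>" using \<eta>0 by (simp add: c_def)
  have "(\<integral>\<^sup>+x. exp (\<eta> * (q x)\<^sup>2) \<partial>R) = (\<integral>\<^sup>+x. (\<integral>\<^sup>+g. exp (c * q x * g) \<partial>std_normal_distribution) \<partial>R)"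
  proof (rule nn_integral_cong)
    fix x
    have "has_bochner_integral std_normal_distribution (\<lambda>g. exp (c * q x * g)) (exp ((c * q x)\<^sup>2 / 2))"
      using has_bochner_integral_std_normal_exp_quadratic[of 0 "c * q x"] by simp
    then have "(\<integral>\<^sup>+g. exp (c * q x * g) \<partial>std_normal_distribution) = exp ((c * q x)\<^sup>2 / 2)"
      by (subst nn_integral_eq_integral) (auto simp: has_bochner_integral_iff)
    then show "ennreal (exp (\<eta> * (q x)\<^sup>2)) = (\<integral>\<^sup>+g. exp (c * q x * g) \<partial>std_normal_distribution)"
      by (simp add: power_mult_distrib c)
  qed
  also have "\<dots> = (\<integral>\<^sup>+g. (\<integral>\<^sup>+x. exp (c * q x * g) \<partial>R) \<partial>std_normal_distribution)"
    by (rule P.Fubini'[symmetric]) (auto simp: case_prod_beta)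
  also have "\<dots> \<le> (\<integral>\<^sup>+g. exp (1/4 * g\<^sup>2 + 0 * g) \<partial>std_normal_distribution)"
  proof (rule nn_integral_mono)
    fix g :: real
    have "(\<integral>\<^sup>+x. exp (c * q x * g) \<partial>R) = ennreal (\<integral>x. exp ((c * g) * q x) \<partial>R)"
      using i[of "c * g"] by (subst nn_integral_eq_integral[symmetric]) (auto simp: mult_ac)
    also have "\<dots> \<le> exp (\<sigma>2 * (c * g)\<^sup>2 / 2)" using b by (intro ennreal_leI)
    also have "\<sigma>2 * (c * g)\<^sup>2 / 2 = 1/4 * g\<^sup>2 + 0 * g" using \<sigma> by (simp add: power_mult_distrib c \<eta>)
    finally show "(\<integral>\<^sup>+x. exp (c * q x * g) \<partial>R) \<le> exp (1/4 * g\<^sup>2 + 0 * g)" .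
  qed
  also have "\<dots> = ennreal (1 / sqrt (1/2))"
    using has_bochner_integral_std_normal_exp_quadratic[of "1/4" 0]
    by (subst nn_integral_eq_integral) (auto simp: has_bochner_integral_iff)
  also have "\<dots> \<le> ennreal 2"
    by (intro ennreal_leI) (simp add: real_sqrt_divide real_le_lsqrt)
  finally have nn: "(\<integral>\<^sup>+x. exp (\<eta> * (q x)\<^sup>2) \<partial>R) \<le> ennreal 2" .
  show I: "integrable R (\<lambda>x. exp (\<eta> * (q x)\<^sup>2))"
    by (rule integrableI_bounded) (use le_less_trans[OF nn ennreal_less_top] in auto)
  show "(\<integral>x. exp (\<eta> * (q x)\<^sup>2) \<partial>R) \<le> 2"
    using nn I by (subst (asm) nn_integral_eq_integral) (auto simp flip: ennreal_numeral)
qed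

lemma exp_le_quadratic:
  fixes x :: real
  shows "exp x \<le> 1 + x + x\<^sup>2 / 2 * exp \<bar>x\<bar>"
proof -
  obtain t where t: "\<bar>t\<bar> \<le> \<bar>x\<bar>" "exp x = (\<Sum>m<2. x ^ m / fact m) + exp t / fact 2 * x ^ 2"
    using Maclaurin_exp_le[of x 2] by auto
  have "exp t / fact 2 * x ^ 2 \<le> exp \<bar>x\<bar> / 2 * x\<^sup>2"
    using t(1) by (intro mult_right_mono divide_right_mono) (auto simp: fact_numeral)
  then show ?thesis using t(2) by (simp add: numeral_2_eq_2 mult.commute)
qed

lemma sq_quarter_le_exp:
  fixes y :: real
  assumes "y \<ge> 0" shows "y\<^sup>2 / 4 \<le> exp y"
proof -
  have "(y / 2)\<^sup>2 \<le> (exp (y / 2))\<^sup>2"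
    using assms exp_ge_add_one_self[of "y / 2"] by (intro power_mono) linarith+
  then show ?thesis by (simp add: power_divide flip: exp_double)
qed

text \<open>Second-order Taylor expansion with a remainder that
  \<open>subgaussian_exp_square\<close> can integrate. Since \<open>8 * \<nu> \<le> \<eta>\<close>,
  the factor \<open>exp \<bar>W\<bar>\<close> uses one quarter of the rate \<open>\<eta>\<close>,
  and absorbing the square \<open>W\<^sup>2\<close> uses another. At the resulting rate
  \<open>\<eta> / 2\<close> the product of the two exponentials is split by the arithmetic-geometric
  mean inequality into terms with one projection each, at the full rate
  \<open>\<eta>\<close>.\<close>

lemma exp_quadratic_form_bound:
  fixes p1 p2 \<nu> c d \<eta> :: real
  assumes \<nu>: "\<nu> > 0" "8 * \<nu> \<le> \<eta>" and cd: "0 \<le> c" "c \<le> 1" "0 \<le> d" "d \<le> 1"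
  defines "W \<equiv> c * ((sqrt \<nu> * p1) * (sqrt \<nu> * p2)) - d * ((sqrt \<nu> * p1)\<^sup>2 + (sqrt \<nu> * p2)\<^sup>2)"
  shows "exp W \<le> 1 + W + 64 * \<nu>\<^sup>2 / \<eta>\<^sup>2 * (exp (\<eta> * p1\<^sup>2) + exp (\<eta> * p2\<^sup>2))"
proof -
  define z where "z = p1\<^sup>2 + p2\<^sup>2"
  have z: "z \<ge> 0" by (simp add: z_def)
  have \<eta>: "\<eta> > 0" using \<nu> by linarith
  have W: "W = \<nu> * (c * (p1 * p2) - d * z)"
    using \<nu> by (simp add: W_def z_def power_mult_distrib algebra_simps)
  have "\<bar>p1 * p2\<bar> \<le> z"
  proof -
    have "0 \<le> (p1 - p2)\<^sup>2" "0 \<le> (p1 + p2)\<^sup>2" "0 \<le> p1\<^sup>2" "0 \<le> p2\<^sup>2" by auto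
    then show ?thesis unfolding z_def power2_sum power2_diff abs_le_iff by linarith
  qed
  then have "\<bar>c * (p1 * p2)\<bar> \<le> 1 * z" unfolding abs_mult[of c] using cd by (intro mult_mono) auto
  moreover have "\<bar>d * z\<bar> \<le> 1 * z" unfolding abs_mult using cd z by (intro mult_mono) auto
  ultimately have "\<bar>c * (p1 * p2) - d * z\<bar> \<le> 2 * z" by linarith
  then have aW: "\<bar>W\<bar> \<le> 2 * \<nu> * z"
    unfolding W abs_mult using \<nu> by simp
  have "W\<^sup>2 / 2 * exp \<bar>W\<bar> \<le> (2 * \<nu> * z)\<^sup>2 / 2 * exp (\<eta> / 4 * z)"
  proof (rule mult_mono)
    show "W\<^sup>2 / 2 \<le> (2 * \<nu> * z)\<^sup>2 / 2" using power_mono[OF aW, of 2] by simp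
    have "2 * \<nu> * z \<le> \<eta> / 4 * z" using \<nu> z by (intro mult_right_mono) auto
    then show "exp \<bar>W\<bar> \<le> exp (\<eta> / 4 * z)" using aW by simp
  qed auto
  also have "(2 * \<nu> * z)\<^sup>2 / 2 = 128 * \<nu>\<^sup>2 / \<eta>\<^sup>2 * ((\<eta> / 4 * z)\<^sup>2 / 4)"
    using \<eta> by (simp add: power_mult_distrib power_divide)
  also have "\<dots> * exp (\<eta> / 4 * z) \<le> 128 * \<nu>\<^sup>2 / \<eta>\<^sup>2 * exp (\<eta> / 4 * z) * exp (\<eta> / 4 * z)"
    using z \<eta> by (intro mult_right_mono mult_left_mono sq_quarter_le_exp) auto
  also have "\<dots> = 128 * \<nu>\<^sup>2 / \<eta>\<^sup>2 * (exp (\<eta> / 2 * p1\<^sup>2) * exp (\<eta> / 2 * p2\<^sup>2))"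
    by (simp add: z_def mult.assoc exp_add[symmetric] field_simps)
  also have "\<dots> \<le> 128 * \<nu>\<^sup>2 / \<eta>\<^sup>2 * ((exp (\<eta> * p1\<^sup>2) + exp (\<eta> * p2\<^sup>2)) / 2)"
  proof (rule mult_left_mono)
    have "0 \<le> (exp (\<eta> / 2 * p1\<^sup>2) - exp (\<eta> / 2 * p2\<^sup>2))\<^sup>2" by simp
    then show "exp (\<eta> / 2 * p1\<^sup>2) * exp (\<eta> / 2 * p2\<^sup>2) \<le> (exp (\<eta> * p1\<^sup>2) + exp (\<eta> * p2\<^sup>2)) / 2"
      by (simp add: power2_diff exp_double[symmetric] field_simps)
  qed simp
  finally have "W\<^sup>2 / 2 * exp \<bar>W\<bar> \<le> 64 * \<nu>\<^sup>2 / \<eta>\<^sup>2 * (exp (\<eta> * p1\<^sup>2) + exp (\<eta> * p2\<^sup>2))"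
    by simp
  then show ?thesis using exp_le_quadratic[of W] by linarith
qed

lemma subg_row_second_moment:
  assumes R: "subg_row p \<sigma>2 R"
  shows "has_bochner_integral R (\<lambda>x. (\<Sum>j<p. x j * \<beta> j) * (\<Sum>j<p. x j * \<beta>' j)) (inner_vec p \<beta> \<beta>')"
proof -
  have m: "integrable R (\<lambda>x. x j * x k)" "(\<integral>x. x j * x k \<partial>R) = (if j = k then 1 else 0)" if "j < p" "k < p" for j k
    using R that unfolding subg_row_def by auto
  have "has_bochner_integral R (\<lambda>x. x j * x k) (if j = k then 1 else 0)" if "j < p" "k < p" for j k
    using m[OF that] by (simp only: has_bochner_integral_iff)
  then have "has_bochner_integral R (\<lambda>x. \<Sum>j<p. \<Sum>k<p. \<beta> j * \<beta>' k * (x j * x k)) (\<Sum>j<p. \<Sum>k<p. \<beta> j * \<beta>' k * (if j = k then 1 else 0))"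
    by (intro has_bochner_integral_sum has_bochner_integral_mult_right) auto
  moreover have "(\<Sum>j<p. \<Sum>k<p. \<beta> j * \<beta>' k * (x j * x k)) = (\<Sum>j<p. x j * \<beta> j) * (\<Sum>j<p. x j * \<beta>' j)" for x
    by (simp add: sum_product mult_ac)
  moreover have "(\<Sum>j<p. \<Sum>k<p. \<beta> j * \<beta>' k * (if j = k then 1 else 0)) = inner_vec p \<beta> \<beta>'"
    using double_sum_delta[where p=p and \<beta>=\<beta> and c=1 and \<beta>'=\<beta>'] by (simp add: mult_ac)
  ultimately show ?thesis by simp
qed

lemma subg_row_exp_sq:
  assumes R: "subg_row p \<sigma>2 R" and \<sigma>: "\<sigma>2 > 0" and u: "(\<Sum>j<p. (u j)\<^sup>2) = 1"
  defines "\<eta> \<equiv> 1 / (4 * \<sigma>2)"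
  shows "integrable R (\<lambda>x. exp (\<eta> * (\<Sum>j<p. u j * x j)\<^sup>2))" "(\<integral>x. exp (\<eta> * (\<Sum>j<p. u j * x j)\<^sup>2) \<partial>R) \<le> 2"
proof -
  have ps: "prob_space R" and s[measurable_cong]: "sets R = sets (vec_space p)"
    using R by (auto simp: subg_row_def)
  \<comment> \<open>\<open>subg_row\<close> speaks only of directions that vanish from index
    \<open>p\<close> on.\<close>
  let ?u = "\<lambda>j. if j < p then u j else 0"
  have ueq: "(\<Sum>j<p. ?u j * x j) = (\<Sum>j<p. u j * x j)" for x :: "nat \<Rightarrow> real" by simp
  have u1: "(\<Sum>j<p. (?u j)\<^sup>2) = 1" "\<forall>j\<ge>p. ?u j = 0" using u by simp_all
  have "\<forall>u t. (\<forall>j\<ge>p. u j = 0) \<longrightarrow> (\<Sum>j<p. (u j)\<^sup>2) = 1 \<longrightarrow>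
        integrable R (\<lambda>x. exp (t * (\<Sum>j<p. u j * x j))) \<and>
        ln (\<integral>x. exp (t * (\<Sum>j<p. u j * x j)) \<partial>R) \<le> \<sigma>2 * t\<^sup>2 / 2"
    using R unfolding subg_row_def by (elim conjE)
  from this[THEN spec, of ?u, THEN spec, THEN mp, OF u1(2), THEN mp, OF u1(1), unfolded ueq]
  have sg: "integrable R (\<lambda>x. exp (t * (\<Sum>j<p. u j * x j)))" "ln (\<integral>x. exp (t * (\<Sum>j<p. u j * x j)) \<partial>R) \<le> \<sigma>2 * t\<^sup>2 / 2" for t
    by blast+
  have q[measurable]: "(\<lambda>x. \<Sum>j<p. u j * x j) \<in> borel_measurable R" by measurable
  \<comment> \<open>The logarithm can be inverted only for a positive integral; otherwise the bound
    is trivial.\<close>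
  have b: "(\<integral>x. exp (t * (\<Sum>j<p. u j * x j)) \<partial>R) \<le> exp (\<sigma>2 * t\<^sup>2 / 2)" for t
  proof (cases "(\<integral>x. exp (t * (\<Sum>j<p. u j * x j)) \<partial>R) > 0")
    case True
    then show ?thesis using sg(2)[of t] by (metis exp_le_cancel_iff exp_ln)
  next
    case False
    then show ?thesis using exp_gt_zero[of "\<sigma>2 * t\<^sup>2 / 2"] by linarith
  qed
  note X = subgaussian_exp_square[OF ps q, of \<sigma>2 \<eta>]
  show "integrable R (\<lambda>x. exp (\<eta> * (\<Sum>j<p. u j * x j)\<^sup>2))" "(\<integral>x. exp (\<eta> * (\<Sum>j<p. u j * x j)\<^sup>2) \<partial>R) \<le> 2"
    using X sg(1) b \<sigma> by (auto simp: \<eta>_def)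
qed

text \<open>Isotropy integrates the linear term of the expansion exactly, so the loss is of second
  order in \<open>\<nu>\<close>. Multiplied by \<open>n\<close> rows it is of order
  \<open>(n * \<nu>)\<^sup>2 / n\<close>.\<close>

lemma subg_row_mgf:
  fixes \<nu> :: real
  assumes R: "subg_row p \<sigma>2 R" and \<sigma>: "\<sigma>2 > 0" and \<nu>: "\<nu> > 0" "8 * \<nu> \<le> 1 / (4 * \<sigma>2)"
    and \<beta>: "sq_norm p \<beta> = \<nu>" "sq_norm p \<beta>' = \<nu>" and cd: "0 \<le> c" "c \<le> 1" "0 \<le> d" "d \<le> 1"
  defines "W \<equiv> \<lambda>x. c * ((\<Sum>j<p. x j * \<beta> j) * (\<Sum>j<p. x j * \<beta>' j))
      - d * ((\<Sum>j<p. x j * \<beta> j)\<^sup>2 + (\<Sum>j<p. x j * \<beta>' j)\<^sup>2)"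
  shows "integrable R (\<lambda>x. exp (W x))"
    "(\<integral>x. exp (W x) \<partial>R) \<le> exp (c * inner_vec p \<beta> \<beta>' - 2 * d * \<nu> + 4096 * \<sigma>2\<^sup>2 * \<nu>\<^sup>2)"
proof -
  define \<eta> where "\<eta> = 1 / (4 * \<sigma>2)"
  have ps: "prob_space R" and s[measurable_cong]: "sets R = sets (vec_space p)"
    using R by (auto simp: subg_row_def)
  interpret prob_space R by (rule ps)
  let ?u = "\<lambda>j. \<beta> j / sqrt \<nu>" and ?v = "\<lambda>j. \<beta>' j / sqrt \<nu>"
  have uv: "(\<Sum>j<p. (?u j)\<^sup>2) = 1" "(\<Sum>j<p. (?v j)\<^sup>2) = 1"
    using \<beta> \<nu> by (simp_all add: power_divide sum_divide_distrib[symmetric] sq_norm_def)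
  let ?p = "\<lambda>x. \<Sum>j<p. ?u j * x j" and ?q = "\<lambda>x. \<Sum>j<p. ?v j * x j"
  note e1 = subg_row_exp_sq[OF R \<sigma> uv(1), folded \<eta>_def] and e2 = subg_row_exp_sq[OF R \<sigma> uv(2), folded \<eta>_def]
  have pq: "(\<Sum>j<p. x j * \<beta> j) = sqrt \<nu> * ?p x" "(\<Sum>j<p. x j * \<beta>' j) = sqrt \<nu> * ?q x" for x
    using \<nu> by (simp_all add: sum_distrib_left mult.commute)
  let ?K = "64 * \<nu>\<^sup>2 / \<eta>\<^sup>2"
  have bnd: "exp (W x) \<le> 1 + W x + ?K * (exp (\<eta> * (?p x)\<^sup>2) + exp (\<eta> * (?q x)\<^sup>2))" for x
    unfolding W_def pq using \<nu> cd by (intro exp_quadratic_form_bound) (auto simp: \<eta>_def)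
  have hW: "has_bochner_integral R W (c * inner_vec p \<beta> \<beta>' - d * (\<nu> + \<nu>))"
  proof -
    have h: "has_bochner_integral R (\<lambda>x. (\<Sum>j<p. x j * \<beta> j) * (\<Sum>j<p. x j * \<beta> j)) \<nu>"
      "has_bochner_integral R (\<lambda>x. (\<Sum>j<p. x j * \<beta>' j) * (\<Sum>j<p. x j * \<beta>' j)) \<nu>"
      using subg_row_second_moment[OF R, of \<beta> \<beta>] subg_row_second_moment[OF R, of \<beta>' \<beta>'] \<beta> by (simp_all only: sq_norm_inner)
    show ?thesis
      unfolding W_def power2_eq_square
      by (intro has_bochner_integral_diff has_bochner_integral_add has_bochner_integral_mult_right subg_row_second_moment[OF R] h)
  qed
  have iB: "integrable R (\<lambda>x. 1 + W x + ?K * (exp (\<eta> * (?p x)\<^sup>2) + exp (\<eta> * (?q x)\<^sup>2)))"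
    using hW e1(1) e2(1) by (intro Bochner_Integration.integrable_add integrable_mult_right integrable_const) (auto simp: has_bochner_integral_iff)
  have mW[measurable]: "W \<in> borel_measurable R" unfolding W_def by measurable
  show i: "integrable R (\<lambda>x. exp (W x))"
  proof (rule Bochner_Integration.integrable_bound[OF iB])
    show "AE x in R. norm (exp (W x)) \<le> norm (1 + W x + ?K * (exp (\<eta> * (?p x)\<^sup>2) + exp (\<eta> * (?q x)\<^sup>2)))"
      using bnd by (intro AE_I2) (auto intro: order_trans[OF _ abs_ge_self])
  qed measurable
  have "(\<integral>x. exp (W x) \<partial>R) \<le> (\<integral>x. 1 + W x + ?K * (exp (\<eta> * (?p x)\<^sup>2) + exp (\<eta> * (?q x)\<^sup>2)) \<partial>R)"
    using bnd by (intro integral_mono i iB)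
  also have "\<dots> = 1 + (c * inner_vec p \<beta> \<beta>' - d * (\<nu> + \<nu>)) + ?K * ((\<integral>x. exp (\<eta> * (?p x)\<^sup>2) \<partial>R) + (\<integral>x. exp (\<eta> * (?q x)\<^sup>2) \<partial>R))"
    using hW e1(1) e2(1) by (simp add: has_bochner_integral_iff prob_space)
  also have "\<dots> \<le> 1 + (c * inner_vec p \<beta> \<beta>' - d * (\<nu> + \<nu>)) + ?K * (2 + 2)"
    using e1(2) e2(2) by (intro add_left_mono mult_left_mono add_mono) auto
  \<comment> \<open>With \<open>\<eta> = 1 / (4 * \<sigma>2)\<close> the constant is 64 * 16 *
    4.\<close>
  also have "?K * (2 + 2) = 4096 * \<sigma>2\<^sup>2 * \<nu>\<^sup>2"
    using \<sigma> by (simp add: \<eta>_def power_divide power_mult_distrib)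
  also have "1 + (c * inner_vec p \<beta> \<beta>' - d * (\<nu> + \<nu>)) + 4096 * \<sigma>2\<^sup>2 * \<nu>\<^sup>2 = 1 + (c * inner_vec p \<beta> \<beta>' - 2 * d * \<nu> + 4096 * \<sigma>2\<^sup>2 * \<nu>\<^sup>2)"
    by simp
  also have "\<dots> \<le> exp (c * inner_vec p \<beta> \<beta>' - 2 * d * \<nu> + 4096 * \<sigma>2\<^sup>2 * \<nu>\<^sup>2)"
    by (rule exp_ge_add_one_self)
  finally show "(\<integral>x. exp (W x) \<partial>R) \<le> exp (c * inner_vec p \<beta> \<beta>' - 2 * d * \<nu> + 4096 * \<sigma>2\<^sup>2 * \<nu>\<^sup>2)" .
qed

lemma design_SubG:
  fixes \<nu> :: real
  assumes S: "SubG n p \<sigma>2 D" and \<sigma>: "\<sigma>2 > 0" and \<nu>: "\<nu> > 0" "8 * \<nu> \<le> 1 / (4 * \<sigma>2)"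
  shows "design n p D \<nu> (real n * (4096 * \<sigma>2\<^sup>2 * \<nu>\<^sup>2))"
proof -
  obtain R where R: "subg_row p \<sigma>2 R" and D: "D = iid_rows n p R" and pd: "AE X in D. pos_def p (gram n X)"
    using S by (auto simp: SubG_def)
  have ps: "prob_space R" and s[measurable_cong]: "sets R = sets (vec_space p)"
    using R by (auto simp: subg_row_def)
  interpret R: prob_space R by (rule ps)
  interpret P: product_sigma_finite "\<lambda>_::nat. R"
    by (intro product_sigma_finite.intro R.sigma_finite_measure_axioms)
  let ?P = "PiM {..<n} (\<lambda>_. R)"
  define F where "F rows = (\<lambda>(i, j)\<in>{..<n} \<times> {..<p}. rows i j)" for rows :: "nat \<Rightarrow> nat \<Rightarrow> real"
  have comp: "(\<lambda>rows. rows i j) \<in> borel_measurable ?P" if "i < n" "j < p" for i j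
  proof (rule measurable_compose[of "\<lambda>rows. rows i" _ R])
    show "(\<lambda>rows. rows i) \<in> ?P \<rightarrow>\<^sub>M R" using that by (intro measurable_component_singleton) auto
    show "(\<lambda>x. x j) \<in> borel_measurable R" using that by measurable
  qed
  have F[measurable]: "F \<in> ?P \<rightarrow>\<^sub>M mat_space n p"
    unfolding F_def mat_space_def by (rule measurable_restrict) (auto intro: comp)
  have D': "D = distr ?P (mat_space n p) F"
    unfolding D iid_rows_def F_def ..
  have hbD: "has_bochner_integral D g c" if "g \<in> borel_measurable (mat_space n p)" "has_bochner_integral ?P (\<lambda>x. g (F x)) c"
    for g :: "_ \<Rightarrow> real" and c
    using that unfolding D' by (simp add: has_bochner_integral_iff integrable_distr_eq integral_distr)
  have mv: "mat_vec p (F rows) \<beta> i = (\<Sum>j<p. rows i j * \<beta> j)" if "i < n" for rows \<beta> i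
    unfolding mat_vec_def F_def using that by (intro sum.cong) auto
  show ?thesis
  proof (rule design.intro)
    have "prob_space ?P" by (rule prob_space_PiM) (rule ps)
    then show "prob_space D" unfolding D' by (rule prob_space.prob_space_distr) (rule F)
    show "sets D = sets (mat_space n p)" unfolding D' by simp
    show "AE X in D. pos_def p (gram n X)" by (rule pd)
    show "has_bochner_integral D (\<lambda>X. sq_norm n (mat_vec p X \<beta>)) (real n * \<nu>)" if \<beta>: "sq_norm p \<beta> = \<nu>" for \<beta>
    proof (rule hbD)
      have "has_bochner_integral ?P (\<lambda>rows. \<Sum>i<n. (\<Sum>j<p. rows i j * \<beta> j)\<^sup>2) (\<Sum>i<n. \<nu>)"
      proof (rule has_bochner_integral_sum)
        fix i assume "i \<in> {..<n}"
        then have d: "distr ?P R (\<lambda>rows. rows i) = R"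
          by (intro distr_PiM_component ps) auto
        have c[measurable]: "(\<lambda>rows. rows i) \<in> ?P \<rightarrow>\<^sub>M R" using \<open>i \<in> {..<n}\<close> by (intro measurable_component_singleton)
        have q[measurable]: "(\<lambda>x. (\<Sum>j<p. x j * \<beta> j)\<^sup>2) \<in> borel_measurable R" by measurable
        have "has_bochner_integral R (\<lambda>x. (\<Sum>j<p. x j * \<beta> j)\<^sup>2) \<nu>"
          using subg_row_second_moment[OF R, of \<beta> \<beta>] \<beta> by (simp add: power2_eq_square sq_norm_def)
        then have "has_bochner_integral (distr ?P R (\<lambda>rows. rows i)) (\<lambda>x. (\<Sum>j<p. x j * \<beta> j)\<^sup>2) \<nu>"
          by (simp only: d)
        then show "has_bochner_integral ?P (\<lambda>rows. (\<Sum>j<p. rows i j * \<beta> j)\<^sup>2) \<nu>"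
          by (simp add: has_bochner_integral_iff integrable_distr_eq integral_distr)
      qed
      then show "has_bochner_integral ?P (\<lambda>rows. sq_norm n (mat_vec p (F rows) \<beta>)) (real n * \<nu>)"
        by (simp add: sq_norm_def mv)
    qed measurable
    show "\<exists>m. has_bochner_integral D (\<lambda>X. exp (c * inner_vec n (mat_vec p X \<beta>) (mat_vec p X \<beta>')
              - d * (sq_norm n (mat_vec p X \<beta>) + sq_norm n (mat_vec p X \<beta>')))) m
          \<and> m \<le> exp (real n * (c * inner_vec p \<beta> \<beta>' - 2 * d * \<nu>) + real n * (4096 * \<sigma>2\<^sup>2 * \<nu>\<^sup>2))"
      if \<beta>: "sq_norm p \<beta> = \<nu>" "sq_norm p \<beta>' = \<nu>" and cd: "0 \<le> c" "c \<le> 1" "0 \<le> d" "d \<le> 1" for \<beta> \<beta>' c d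
    proof -
      define W where "W x = c * ((\<Sum>j<p. x j * \<beta> j) * (\<Sum>j<p. x j * \<beta>' j))
          - d * ((\<Sum>j<p. x j * \<beta> j)\<^sup>2 + (\<Sum>j<p. x j * \<beta>' j)\<^sup>2)" for x
      note W = subg_row_mgf[OF R \<sigma> \<nu> \<beta> cd, folded W_def]
      let ?E = "\<integral>x. exp (W x) \<partial>R"
      have "has_bochner_integral ?P (\<lambda>rows. \<Prod>i<n. exp (W (rows i))) (\<Prod>i<n. ?E)"
        using P.product_integrable_prod[of "{..<n}" "\<lambda>_ x. exp (W x)"] P.product_integral_prod[of "{..<n}" "\<lambda>_ x. exp (W x)"] W(1)
        by (simp add: has_bochner_integral_iff)
      moreover have "exp (c * inner_vec n (mat_vec p (F rows) \<beta>) (mat_vec p (F rows) \<beta>')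
              - d * (sq_norm n (mat_vec p (F rows) \<beta>) + sq_norm n (mat_vec p (F rows) \<beta>'))) = (\<Prod>i<n. exp (W (rows i)))" for rows
        by (simp add: exp_sum[symmetric] W_def sq_norm_def mv sum_subtractf sum.distrib sum_distrib_left[symmetric])
      ultimately have "has_bochner_integral D (\<lambda>X. exp (c * inner_vec n (mat_vec p X \<beta>) (mat_vec p X \<beta>')
              - d * (sq_norm n (mat_vec p X \<beta>) + sq_norm n (mat_vec p X \<beta>')))) (?E ^ n)"
        by (intro hbD) auto
      moreover have "?E ^ n \<le> exp (c * inner_vec p \<beta> \<beta>' - 2 * d * \<nu> + 4096 * \<sigma>2\<^sup>2 * \<nu>\<^sup>2) ^ n"
        using W(2) by (intro power_mono) (auto intro: integral_nonneg_AE)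
      ultimately show ?thesis
        by (intro exI[of _ "?E ^ n"]) (simp add: exp_of_nat_mult[symmetric] distrib_left)
    qed
  qed
qed

section \<open>Exponents\<close>

text \<open>This bound and the next three are applied with \<open>y\<close> a multiple of
  \<open>t\<close> and multiplied by \<open>p / 2\<close>. The quadratic term has to be exact,
  because it is of order \<open>x\<close>; in the cubic term any constant will do.\<close>

lemma ln_one_minus_upper:
  fixes y :: real
  assumes "0 \<le> y" "y < 1"
  shows "ln (1 - y) \<le> - y - y\<^sup>2 / 2"
proof -
  define f where "f z = ln (1 - z) + z + z\<^sup>2 / 2" for z :: real
  have "f y \<le> f 0"
  proof (rule DERIV_nonpos_imp_nonincreasing[OF assms(1)])
    fix z assume z: "0 \<le> z" "z \<le> y"
    then have z1: "z < 1" using assms by simp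
    have "(f has_real_derivative (- 1 / (1 - z) + 1 + z)) (at z)"
      unfolding f_def using z1 by (auto intro!: derivative_eq_intros)
    moreover have "- 1 / (1 - z) + 1 + z = - z\<^sup>2 / (1 - z)" using z1 by (simp add: field_simps power2_eq_square)
    moreover have "- z\<^sup>2 / (1 - z) \<le> 0" using z1 by (simp add: divide_nonpos_pos)
    ultimately show "\<exists>d. (f has_real_derivative d) (at z) \<and> d \<le> 0" by metis
  qed
  then show ?thesis by (simp add: f_def)
qed

lemma ln_one_minus_lower:
  fixes y :: real
  assumes "0 \<le> y" "y \<le> 1/2"
  shows "- y - y\<^sup>2 / 2 - y ^ 3 \<le> ln (1 - y)"
proof -
  define f where "f z = ln (1 - z) + z + z\<^sup>2 / 2 + z ^ 3" for z :: real
  have "f 0 \<le> f y"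
  proof (rule DERIV_nonneg_imp_nondecreasing[OF assms(1)])
    fix z assume z: "0 \<le> z" "z \<le> y"
    then have z1: "z < 1" "z \<le> 1/2" using assms by auto
    have "(f has_real_derivative (- 1 / (1 - z) + 1 + z + 3 * z\<^sup>2)) (at z)"
      unfolding f_def using z1 by (auto intro!: derivative_eq_intros)
    moreover have "- 1 / (1 - z) + 1 + z + 3 * z\<^sup>2 = z\<^sup>2 * (2 - 3 * z) / (1 - z)" using z1 by (simp add: field_simps power2_eq_square)
    moreover have "0 \<le> z\<^sup>2 * (2 - 3 * z) / (1 - z)" using z1 by (intro divide_nonneg_nonneg mult_nonneg_nonneg) auto
    ultimately show "\<exists>d. (f has_real_derivative d) (at z) \<and> 0 \<le> d" by metis
  qed
  then show ?thesis by (simp add: f_def)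
qed

lemma ln_one_plus_lower:
  fixes y :: real
  assumes "0 \<le> y"
  shows "y - y\<^sup>2 / 2 \<le> ln (1 + y)"
proof -
  define f where "f z = ln (1 + z) - (z - z\<^sup>2 / 2)" for z :: real
  have "f 0 \<le> f y"
  proof (rule DERIV_nonneg_imp_nondecreasing[OF assms(1)])
    fix z assume z: "0 \<le> z" "z \<le> y"
    have "(f has_real_derivative (1 / (1 + z) - (1 - z))) (at z)"
      unfolding f_def using z by (auto intro!: derivative_eq_intros)
    moreover have "1 / (1 + z) - (1 - z) = z\<^sup>2 / (1 + z)" using z by (simp add: field_simps power2_eq_square)
    moreover have "0 \<le> z\<^sup>2 / (1 + z)" using z by simp
    ultimately show "\<exists>d. (f has_real_derivative d) (at z) \<and> 0 \<le> d" by metis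
  qed
  then show ?thesis by (simp add: f_def)
qed

lemma ln_one_plus_upper:
  fixes y :: real
  assumes "0 \<le> y"
  shows "ln (1 + y) \<le> y - y\<^sup>2 / 2 + y ^ 3"
proof -
  define f where "f z = z - z\<^sup>2 / 2 + z ^ 3 - ln (1 + z)" for z :: real
  have "f 0 \<le> f y"
  proof (rule DERIV_nonneg_imp_nondecreasing[OF assms(1)])
    fix z assume z: "0 \<le> z" "z \<le> y"
    have "(f has_real_derivative (1 - z + 3 * z\<^sup>2 - 1 / (1 + z))) (at z)"
      unfolding f_def using z by (auto intro!: derivative_eq_intros)
    moreover have "1 - z + 3 * z\<^sup>2 - 1 / (1 + z) = z\<^sup>2 * (2 + 3 * z) / (1 + z)" using z by (simp add: field_simps power2_eq_square)
    moreover have "0 \<le> z\<^sup>2 * (2 + 3 * z) / (1 + z)" using z by (intro divide_nonneg_nonneg mult_nonneg_nonneg) auto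
    ultimately show "\<exists>d. (f has_real_derivative d) (at z) \<and> 0 \<le> d" by metis
  qed
  then show ?thesis by (simp add: f_def)
qed

lemma powr_exp_half:
  fixes u :: real
  assumes "u > 0"
  shows "u powr (- real p / 2) = exp (- (real p / 2 * ln u))" "u powr (real p / 2) = exp (real p / 2 * ln u)"
  using assms by (simp_all add: powr_def)

lemma shrink_quotient:
  fixes t c :: real
  assumes "t \<ge> 0" "c \<ge> 0"
  shows "t * (1 - c * t) \<le> t / (1 + c * t)"
proof -
  have "0 < 1 + c * t" using assms by (simp add: add_pos_nonneg)
  moreover have "t * (1 - c * t) * (1 + c * t) \<le> t"
    using assms by (simp add: algebra_simps)
  ultimately show ?thesis by (simp add: pos_le_divide_eq)
qed

section \<open>Explicit exponents of both bounds\<close>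

context design
begin

text \<open>The threshold \<open>p + \<Lambda> / 2\<close> balances the two errors: the leading
  exponents are \<open>- x / 8 + x / 16\<close> and \<open>3 * x / 16 - l * x / 4\<close>, which
  agree for \<open>l = 1\<close>. The factor \<open>l\<close> records the deviation caused by
  rounding the sparsity.\<close>

lemma Risk_le_exp:
  fixes t \<Lambda> x l :: real
  assumes A: "A > 0" and s: "s \<le> p" "\<nu> = real s * A\<^sup>2" "\<nu> > 0"
    and t: "0 \<le> t" "t \<le> 1/4" and pt: "real p * t = \<Lambda> / 4" and t\<Lambda>: "t * \<Lambda> = x / 4" and l: "real n * \<nu> = l * \<Lambda>"
  shows "Risk D n p s A \<le> exp (x * (- 1/16 + t / 4)) + exp (x * (3/16 - l / 4 + t * l / 2) + C)"
proof -
  define \<tau> where "\<tau> = real p + \<Lambda> / 2"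
  have pt2: "real p * t\<^sup>2 = x / 16"
  proof -
    have "real p * t\<^sup>2 = (real p * t) * t" by (simp add: power2_eq_square)
    also have "\<dots> = (t * \<Lambda>) / 4" unfolding pt by simp
    finally show ?thesis unfolding t\<Lambda> by simp
  qed
  have pt3: "real p * t ^ 3 = x * t / 16"
  proof -
    have "real p * t ^ 3 = (real p * t\<^sup>2) * t" by (simp add: power2_eq_square power3_eq_cube)
    then show ?thesis unfolding pt2 by simp
  qed
  have tl: "t * (real n * \<nu>) = l * x / 4"
  proof -
    have "t * (real n * \<nu>) = l * (t * \<Lambda>)" by (simp add: l)
    then show ?thesis unfolding t\<Lambda> by simp
  qed
  have t\<tau>: "t * \<tau> = real p * t + x / 8" using t\<Lambda> by (simp add: \<tau>_def algebra_simps)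
  have a: "real p / 2 * ln (1 - 2*t) \<ge> real p / 2 * (- (2*t) - (2*t)\<^sup>2 / 2 - (2*t)^3)"
    using t by (intro mult_left_mono ln_one_minus_lower) auto
  have b: "real p / 2 * ln (1 + 2*t) \<ge> real p / 2 * (2*t - (2*t)\<^sup>2 / 2)"
    using t by (intro mult_left_mono ln_one_plus_lower) auto
  have c: "real p / 2 * (- (2*t) - (2*t)\<^sup>2 / 2 - (2*t)^3) = - (real p * t) - real p * t\<^sup>2 - 4 * (real p * t ^ 3)"
    "real p / 2 * (2*t - (2*t)\<^sup>2 / 2) = real p * t - real p * t\<^sup>2"
    by (simp_all add: algebra_simps power2_eq_square power3_eq_cube)
  have pw1: "(1 - 2*t) powr (- real p / 2) = exp (- (real p / 2 * ln (1 - 2*t)))"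
    and pw2: "(1 + 2*t) powr (- real p / 2) = exp (- (real p / 2 * ln (1 + 2*t)))"
    by (rule powr_exp_half, use t in simp)+
  have "exp (- t * \<tau>) * (1 - 2*t) powr (- real p / 2) = exp (- (t * \<tau>) - real p / 2 * ln (1 - 2*t))"
    unfolding pw1 mult_exp_exp by simp
  also have "\<dots> \<le> exp (x * (- 1/16 + t / 4))"
    using a unfolding c t\<tau> pt2 pt3 by (simp add: algebra_simps)
  finally have 1: "exp (- t * \<tau>) * (1 - 2*t) powr (- real p / 2) \<le> exp (x * (- 1/16 + t / 4))" .
  have nn: "0 \<le> real n * \<nu>" using s(3) by simp
  have "t * (1 - 2 * t) * (real n * \<nu>) \<le> t / (1 + 2 * t) * (real n * \<nu>)"
    by (rule mult_right_mono[OF shrink_quotient nn]) (use t in auto)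
  moreover have "t * (1 - 2 * t) * (real n * \<nu>) = t * (real n * \<nu>) - 2 * t * (t * (real n * \<nu>))" by (simp add: algebra_simps)
  ultimately have d: "l * x / 4 - 2 * t * (l * x / 4) \<le> t / (1 + 2*t) * (real n * \<nu>)" unfolding tl by simp
  have "exp (t * \<tau>) * (1 + 2*t) powr (- real p / 2) * exp (C - real n * (t / (1 + 2*t)) * \<nu>)
     = exp (t * \<tau> - real p / 2 * ln (1 + 2*t) + (C - t / (1 + 2*t) * (real n * \<nu>)))"
    unfolding pw2 mult_exp_exp by (rule arg_cong[where f=exp]) (simp add: mult_ac)
  also have "\<dots> \<le> exp (x * (3/16 - l / 4 + t * l / 2) + C)"
    using b d unfolding c t\<tau> pt2 by (simp add: algebra_simps)
  finally have 2: "exp (t * \<tau>) * (1 + 2*t) powr (- real p / 2) * exp (C - real n * (t / (1 + 2*t)) * \<nu>)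
     \<le> exp (x * (3/16 - l / 4 + t * l / 2) + C)" .
  have "t < 1/2" using t by simp
  from Risk_le[OF A s t(1) this, of \<tau>] 1 2 show ?thesis by linarith
qed

text \<open>For \<open>l\<close> near 1 and \<open>H\<close> near \<open>x / 2\<close> the leading
  part \<open>x * (l - 1/2) - H\<close> of the first exponent in \<open>B\<close> cancels, which
  says that the second moment matches the squared mean. The tails beyond the half-width
  \<open>\<zeta> * \<Lambda>\<close> decay like \<open>exp (- \<zeta>\<^sup>2 * x / 4)\<close> and
  do not spoil this. The rate \<open>- x / 16\<close> comes from \<open>K\<close>, that is, from the
  size of \<open>w\<close> at the upper end of the interval.\<close>

lemma Risk_ge_exp:
  fixes t \<Lambda> x l \<zeta> :: real
  assumes A: "A > 0" and s: "\<nu> = real s * A\<^sup>2" and m: "m > 0" "s * m \<le> p"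
    and t: "0 < t" "t \<le> 1/16" and pt: "real p * t = \<Lambda> / 4" and t\<Lambda>: "t * \<Lambda> = x / 4" and l: "real n * \<nu> = l * \<Lambda>"
    and \<zeta>: "0 < \<zeta>" "\<zeta> \<le> 1/2"
  defines "H \<equiv> real s / real m * (cosh (real n * A\<^sup>2) - 1)"
  defines "B \<equiv> exp (x * (l - 1/2 - t - 9 * t * l) - H - C) / 4 - 2 * exp (x * (- \<zeta>\<^sup>2 / 4 + 2 * t))"
  assumes B: "B \<ge> 0"
  shows "exp (min 0 (x * (1/4 - l / 4 - \<zeta> / 2 - t / 2) - ln 2) + x * (- 1/16 - \<zeta> / 4)) * B \<le> Risk D n p s A"
proof -
  let ?\<Omega> = "block_index s m" and ?b = "block_vec s m A"
  \<comment> \<open>The minimiser of \<open>real p * r\<^sup>2 - r * \<zeta> * \<Lambda>\<close>,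
    the leading exponent of both tail bounds.\<close>
  define r where "r = 2 * \<zeta> * t"
  define hi where "hi = real p + \<Lambda> / 2 + \<zeta> * \<Lambda>"
  define lo where "lo = real p + \<Lambda> / 2 - \<zeta> * \<Lambda>"
  define L1 where "L1 = real p / 2 * ln (1 - 2*t)"
  define a where "a = (1 - 2*t) powr (real p / 2)"
  define qhi where "qhi = a * exp (- r * hi) * (1 - 2*(t + r)) powr (- real p / 2)"
  define qlo where "qlo = a * exp (r * lo) * (1 - 2*(t - r)) powr (- real p / 2)"
  define m1 where "m1 = a * (1 + 2*t) powr (- real p / 2) * exp (- (t / (1 + 2*t)) * (real n * \<nu>))"
  define ov where "ov = overlap n p ?\<Omega> ?b (1 / (1 + 6*t))"
  define M2 where "M2 = a * (1 + 6*t) powr (- real p / 2) * exp (C - 6*t / (1 + 6*t) * (real n * \<nu>)) * ov"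
  define K where "K = min 1 (m1 / 2 * exp (2 * t * lo)) / (a * exp (t * hi))"
  have card: "finite ?\<Omega>" "?\<Omega> \<noteq> {}"
    using finite_block_index[of s m] card_block_index[of s m] m by auto
  have "\<zeta> * t \<le> 1/2 * t" "0 \<le> \<zeta> * t" using t \<zeta> by (auto intro!: mult_right_mono)
  then have r: "0 \<le> r" "r \<le> t" "t + r < 1/2" using t unfolding r_def by linarith+
  have \<nu>0: "0 \<le> \<nu>" unfolding s by simp
  have bX: "?b \<omega> \<in> Xi p s A" if "\<omega> \<in> ?\<Omega>" for \<omega>
    using block_vec_Xi[OF that m(2) A] .
  have bq: "sq_norm p (?b \<omega>) = \<nu>" if "\<omega> \<in> ?\<Omega>" for \<omega>
    using sq_norm_block_vec[OF that m(2), of A] s by simp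
  have ge: "K * (m1\<^sup>2 / (4 * M2) - qhi - qlo) \<le> Risk D n p s A"
    unfolding K_def m1_def M2_def qhi_def qlo_def a_def ov_def
    by (rule Risk_ge[OF card bX bq]) (use t r \<nu>0 in auto)
  have ax: "a = exp L1" using t by (simp add: a_def L1_def powr_exp_half)
  have pt2: "real p * t\<^sup>2 = x / 16"
  proof -
    have "real p * t\<^sup>2 = (real p * t) * t" by (simp add: power2_eq_square)
    also have "\<dots> = (t * \<Lambda>) / 4" unfolding pt by simp
    finally show ?thesis unfolding t\<Lambda> by simp
  qed
  have pt3: "real p * t ^ 3 = x * t / 16"
  proof -
    have "real p * t ^ 3 = (real p * t\<^sup>2) * t" by (simp add: power2_eq_square power3_eq_cube)
    then show ?thesis unfolding pt2 by simp
  qed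
  have tl: "t * (real n * \<nu>) = l * x / 4"
  proof -
    have "t * (real n * \<nu>) = l * (t * \<Lambda>)" by (simp add: l)
    then show ?thesis unfolding t\<Lambda> by simp
  qed
  have nn: "0 \<le> real n * \<nu>" using \<nu>0 by simp
  have L1_lo: "- (real p * t) - x / 16 - x * t / 4 \<le> L1"
  proof -
    have "real p / 2 * (- (2*t) - (2*t)\<^sup>2 / 2 - (2*t)^3) \<le> L1"
      unfolding L1_def using t by (intro mult_left_mono ln_one_minus_lower) auto
    moreover have "real p / 2 * (- (2*t) - (2*t)\<^sup>2 / 2 - (2*t)^3) = - (real p * t) - real p * t\<^sup>2 - 4 * (real p * t ^ 3)"
      by (simp add: algebra_simps power2_eq_square power3_eq_cube)
    ultimately show ?thesis unfolding pt2 pt3 by linarith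
  qed
  have L1_up: "L1 \<le> - (real p * t) - x / 16"
  proof -
    have "L1 \<le> real p / 2 * (- (2*t) - (2*t)\<^sup>2 / 2)"
      unfolding L1_def using t by (intro mult_left_mono ln_one_minus_upper) auto
    moreover have "real p / 2 * (- (2*t) - (2*t)\<^sup>2 / 2) = - (real p * t) - real p * t\<^sup>2"
      by (simp add: algebra_simps power2_eq_square)
    ultimately show ?thesis unfolding pt2 by linarith
  qed
  define g1 where "g1 = L1 - real p / 2 * ln (1 + 2*t) - t / (1 + 2*t) * (real n * \<nu>)"
  have pw: "(1 + 2*t) powr (- real p / 2) = exp (- (real p / 2 * ln (1 + 2*t)))"
    "(1 + 6*t) powr (- real p / 2) = exp (- (real p / 2 * ln (1 + 6*t)))"
    "(1 - 2*(t + r)) powr (- real p / 2) = exp (- (real p / 2 * ln (1 - 2*(t + r))))"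
    "(1 - 2*(t - r)) powr (- real p / 2) = exp (- (real p / 2 * ln (1 - 2*(t - r))))"
    by (rule powr_exp_half, use t r in simp)+
  have m1x: "m1 = exp g1"
    unfolding m1_def g1_def ax pw mult_exp_exp by simp
  have g1: "- 2 * (real p * t) - x * t / 2 - l * x / 4 \<le> g1"
  proof -
    have "real p / 2 * ln (1 + 2*t) \<le> real p / 2 * (2*t - (2*t)\<^sup>2 / 2 + (2*t)^3)"
      using t by (intro mult_left_mono ln_one_plus_upper) auto
    also have "\<dots> = real p * t - real p * t\<^sup>2 + 4 * (real p * t ^ 3)"
      by (simp add: algebra_simps power2_eq_square power3_eq_cube)
    finally have "real p / 2 * ln (1 + 2*t) \<le> real p * t - x / 16 + x * t / 4" unfolding pt2 pt3 by linarith
    moreover have "t / (1 + 2*t) * (real n * \<nu>) \<le> t * (real n * \<nu>)"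
      using t by (intro mult_right_mono nn) (simp add: field_simps)
    ultimately show ?thesis using L1_lo unfolding g1_def tl by linarith
  qed
  define g2 where "g2 = L1 - real p / 2 * ln (1 + 6*t) + (C - 6*t / (1 + 6*t) * (real n * \<nu>)) + H"
  have ov: "ov \<le> exp H" "ov > 0"
  proof -
    have "ov \<le> exp (real s / real m * (cosh (real n * (1 / (1 + 6*t)) * A\<^sup>2) - 1))"
      using block_overlap[OF m(2,1), of "real n * (1 / (1 + 6*t))" A]
      by (simp add: ov_def overlap_def mult.assoc)
    also have "\<dots> \<le> exp H"
    proof -
      \<comment> \<open>The shrinkage by \<open>1 + 6*t\<close> is given up, since it tends to
        1.\<close>
      have "real n * (1 / (1 + 6*t)) * A\<^sup>2 \<le> real n * 1 * A\<^sup>2" using t by (intro mult_right_mono mult_left_mono) auto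
      then have "cosh (real n * (1 / (1 + 6*t)) * A\<^sup>2) \<le> cosh (real n * A\<^sup>2)"
        using t by (subst cosh_real_nonneg_le_iff) auto
      then show ?thesis unfolding H_def by (simp add: mult_left_mono divide_right_mono)
    qed
    finally show "ov \<le> exp H" .
    show "ov > 0" unfolding ov_def by (rule overlap_pos[OF card bX bq])
  qed
  have M2: "M2 \<le> exp g2" "M2 > 0"
  proof -
    have eq: "a * (1 + 6*t) powr (- real p / 2) * exp (C - 6*t / (1 + 6*t) * (real n * \<nu>)) = exp (g2 - H)"
      unfolding g2_def ax pw mult_exp_exp by simp
    have "M2 \<le> exp (g2 - H) * exp H" unfolding M2_def eq using ov by (intro mult_left_mono) auto
    then show "M2 \<le> exp g2" by (simp flip: exp_add)
    show "M2 > 0" unfolding M2_def eq using ov by simp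
  qed
  have g2: "g2 \<le> - 4 * (real p * t) + x / 2 + C - 6 * (l * x / 4) + 9 * t * l * x + H"
  proof -
    have "real p / 2 * (6*t - (6*t)\<^sup>2 / 2) \<le> real p / 2 * ln (1 + 6*t)"
      using t by (intro mult_left_mono ln_one_plus_lower) auto
    moreover have "real p / 2 * (6*t - (6*t)\<^sup>2 / 2) = 3 * (real p * t) - 9 * (real p * t\<^sup>2)"
      by (simp add: algebra_simps power2_eq_square)
    ultimately have 1: "3 * (real p * t) - 9 * (x / 16) \<le> real p / 2 * ln (1 + 6*t)" unfolding pt2 by simp
    have "6 * (t * (1 - 6 * t)) * (real n * \<nu>) \<le> 6 * (t / (1 + 6 * t)) * (real n * \<nu>)"
      by (intro mult_right_mono[OF _ nn] mult_left_mono shrink_quotient) (use t in auto)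
    moreover have "6 * (t * (1 - 6 * t)) * (real n * \<nu>) = 6 * (t * (real n * \<nu>)) - 36 * t * (t * (real n * \<nu>))" by (simp add: algebra_simps)
    ultimately have "6 * (l * x / 4) - 36 * t * (l * x / 4) \<le> 6 * t / (1 + 6*t) * (real n * \<nu>)" unfolding tl by simp
    then show ?thesis using 1 L1_up unfolding g2_def by (simp add: algebra_simps)
  qed
  have ratio: "exp (x * (l - 1/2 - t - 9 * t * l) - H - C) / 4 \<le> m1\<^sup>2 / (4 * M2)"
  proof -
    have "x * (l - 1/2 - t - 9 * t * l) - H - C \<le> 2 * g1 - g2"
      using g1 g2 by (simp add: algebra_simps)
    then have "exp (x * (l - 1/2 - t - 9 * t * l) - H - C) \<le> exp (2 * g1 - g2)" by simp
    also have "\<dots> = m1\<^sup>2 / exp g2" by (simp add: m1x exp_diff exp_double)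
    also have "\<dots> \<le> m1\<^sup>2 / M2" using M2 by (intro divide_left_mono) auto
    finally show ?thesis by simp
  qed
  have rp: "real p * t * r = \<zeta> * x / 8" "r * \<Lambda> = \<zeta> * x / 2" "real p * r\<^sup>2 = \<zeta>\<^sup>2 * x / 4"
  proof -
    have "real p * t * r = 2 * \<zeta> * (real p * t\<^sup>2)" "r * \<Lambda> = 2 * \<zeta> * (t * \<Lambda>)" "real p * r\<^sup>2 = 4 * \<zeta>\<^sup>2 * (real p * t\<^sup>2)"
      by (simp_all add: r_def power2_eq_square)
    then show "real p * t * r = \<zeta> * x / 8" "r * \<Lambda> = \<zeta> * x / 2" "real p * r\<^sup>2 = \<zeta>\<^sup>2 * x / 4"
      unfolding pt2 t\<Lambda> by simp_all
  qed
  have cub: "real p * (t + r) ^ 3 \<le> x * t / 2" "real p * (t - r) ^ 3 \<le> x * t / 2"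
  proof -
    have "(t + r) ^ 3 \<le> (2 * t) ^ 3" "(t - r) ^ 3 \<le> (2 * t) ^ 3" by (rule power_mono; use r t in simp)+
    then have "real p * (t + r) ^ 3 \<le> real p * (2 * t) ^ 3" "real p * (t - r) ^ 3 \<le> real p * (2 * t) ^ 3" by (auto intro!: mult_left_mono)
    moreover have "real p * (2 * t) ^ 3 = x * t / 2" using pt3 by (simp add: power_mult_distrib)
    ultimately show "real p * (t + r) ^ 3 \<le> x * t / 2" "real p * (t - r) ^ 3 \<le> x * t / 2" by auto
  qed
  have lnb: "real p / 2 * ln (1 - 2*u) \<ge> - (real p * u) - real p * u\<^sup>2 - 2 * x * t"
    if u: "0 \<le> u" "u \<le> 1/4" "real p * u ^ 3 \<le> x * t / 2" for u
  proof -
    have "real p / 2 * (- (2*u) - (2*u)\<^sup>2 / 2 - (2*u)^3) \<le> real p / 2 * ln (1 - 2*u)"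
      using u by (intro mult_left_mono ln_one_minus_lower) auto
    moreover have "real p / 2 * (- (2*u) - (2*u)\<^sup>2 / 2 - (2*u)^3) = - (real p * u) - real p * u\<^sup>2 - 4 * (real p * u ^ 3)"
      by (simp add: algebra_simps power2_eq_square power3_eq_cube)
    ultimately show ?thesis using u(3) by linarith
  qed
  have qhi: "qhi \<le> exp (x * (- \<zeta>\<^sup>2 / 4 + 2 * t))"
  proof -
    have "qhi = exp (L1 - r * hi - real p / 2 * ln (1 - 2*(t + r)))"
      unfolding qhi_def ax pw mult_exp_exp by simp
    moreover have "L1 - r * hi - real p / 2 * ln (1 - 2*(t + r)) \<le> x * (- \<zeta>\<^sup>2 / 4 + 2 * t)"
    proof -
      have "real p / 2 * ln (1 - 2*(t + r)) \<ge> - (real p * (t + r)) - real p * (t + r)\<^sup>2 - 2 * x * t"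
        using r t cub by (intro lnb) auto
      moreover have "real p * (t + r)\<^sup>2 = real p * t\<^sup>2 + 2 * (real p * t * r) + real p * r\<^sup>2"
        by (simp add: power2_eq_square algebra_simps)
      moreover have "r * hi = real p * r + r * \<Lambda> / 2 + \<zeta> * (r * \<Lambda>)" by (simp add: hi_def algebra_simps)
      ultimately show ?thesis using L1_up unfolding rp pt2 by (simp add: algebra_simps power2_eq_square)
    qed
    ultimately show ?thesis by simp
  qed
  have qlo: "qlo \<le> exp (x * (- \<zeta>\<^sup>2 / 4 + 2 * t))"
  proof -
    have "qlo = exp (L1 + r * lo - real p / 2 * ln (1 - 2*(t - r)))"
      unfolding qlo_def ax pw mult_exp_exp by simp
    moreover have "L1 + r * lo - real p / 2 * ln (1 - 2*(t - r)) \<le> x * (- \<zeta>\<^sup>2 / 4 + 2 * t)"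
    proof -
      have "real p / 2 * ln (1 - 2*(t - r)) \<ge> - (real p * (t - r)) - real p * (t - r)\<^sup>2 - 2 * x * t"
        using r t cub by (intro lnb) auto
      moreover have "real p * (t - r)\<^sup>2 = real p * t\<^sup>2 - 2 * (real p * t * r) + real p * r\<^sup>2"
        by (simp add: power2_eq_square algebra_simps)
      moreover have "r * lo = real p * r + r * \<Lambda> / 2 - \<zeta> * (r * \<Lambda>)" by (simp add: lo_def algebra_simps)
      ultimately show ?thesis using L1_up unfolding rp pt2 by (simp add: algebra_simps power2_eq_square)
    qed
    ultimately show ?thesis by simp
  qed
  have K: "exp (min 0 (x * (1/4 - l / 4 - \<zeta> / 2 - t / 2) - ln 2) + x * (- 1/16 - \<zeta> / 4)) \<le> K"
  proof -
    have tlo: "2 * t * lo = 2 * (real p * t) + t * \<Lambda> - 2 * \<zeta> * (t * \<Lambda>)" by (simp add: lo_def algebra_simps)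
    have "m1 / 2 * exp (2 * t * lo) = exp (g1 - ln 2 + 2 * t * lo)" by (simp add: m1x exp_diff exp_add)
    moreover have "x * (1/4 - l / 4 - \<zeta> / 2 - t / 2) - ln 2 \<le> g1 - ln 2 + 2 * t * lo"
      using g1 unfolding tlo t\<Lambda> by (simp add: algebra_simps)
    ultimately have "exp (x * (1/4 - l / 4 - \<zeta> / 2 - t / 2) - ln 2) \<le> m1 / 2 * exp (2 * t * lo)" by simp
    moreover have "exp (min 0 (x * (1/4 - l / 4 - \<zeta> / 2 - t / 2) - ln 2)) = min 1 (exp (x * (1/4 - l / 4 - \<zeta> / 2 - t / 2) - ln 2))"
      by (simp add: min_def)
    ultimately have 1: "exp (min 0 (x * (1/4 - l / 4 - \<zeta> / 2 - t / 2) - ln 2)) \<le> min 1 (m1 / 2 * exp (2 * t * lo))" by simp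
    have thi: "t * hi = real p * t + t * \<Lambda> / 2 + \<zeta> * (t * \<Lambda>)" by (simp add: hi_def algebra_simps)
    have "x * (- 1/16 - \<zeta> / 4) \<le> - L1 - t * hi"
      using L1_up unfolding thi t\<Lambda> by (simp add: algebra_simps)
    then have "exp (x * (- 1/16 - \<zeta> / 4)) \<le> exp (- L1 - t * hi)" by simp
    also have "\<dots> = 1 / (a * exp (t * hi))" unfolding ax mult_exp_exp using exp_minus[of "L1 + t * hi"] by (simp add: inverse_eq_divide)
    finally have 2: "exp (x * (- 1/16 - \<zeta> / 4)) \<le> 1 / (a * exp (t * hi))" .
    have "exp (min 0 (x * (1/4 - l / 4 - \<zeta> / 2 - t / 2) - ln 2)) * exp (x * (- 1/16 - \<zeta> / 4))
        \<le> min 1 (m1 / 2 * exp (2 * t * lo)) * (1 / (a * exp (t * hi)))"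
      using 1 2 by (intro mult_mono) (auto simp: m1x)
    then show ?thesis by (simp add: K_def exp_add)
  qed
  have "exp (min 0 (x * (1/4 - l / 4 - \<zeta> / 2 - t / 2) - ln 2) + x * (- 1/16 - \<zeta> / 4)) * B \<le> K * (m1\<^sup>2 / (4 * M2) - qhi - qlo)"
  proof (rule mult_mono[OF K])
    show "B \<le> m1\<^sup>2 / (4 * M2) - qhi - qlo" using ratio qhi qlo unfolding B_def by linarith
    show "0 \<le> K" using K by (rule order_trans[OF exp_ge_zero])
  qed (rule B)
  with ge show ?thesis by linarith
qed

end

section \<open>Asymptotics\<close>

lemma eventually_le_linear:
  fixes x :: "nat \<Rightarrow> real"
  assumes "filterlim x at_top sequentially" "c > 0"
  shows "eventually (\<lambda>p. K \<le> x p * c) sequentially"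
proof -
  have "eventually (\<lambda>p. K / c \<le> x p) sequentially"
    using assms(1) by (simp add: filterlim_at_top)
  then show ?thesis using assms(2) by (simp add: pos_divide_le_eq)
qed

text \<open>Both exponents tend to \<open>- 1/16\<close> relative to \<open>x\<close>. Uniformity in
  \<open>C\<close> is required because the slack of the design may vary with \<open>p\<close>; it
  and the factor 2 from adding the two errors are absorbed by the growth of
  \<open>x\<close>.\<close>

lemma eventually_upper_exponent:
  fixes x t l :: "nat \<Rightarrow> real"
  assumes x: "filterlim x at_top sequentially" and t: "t \<longlonglongrightarrow> 0" and l: "l \<longlonglongrightarrow> 1" and e: "e > 0"
  shows "eventually (\<lambda>p. \<forall>C\<le>C0. exp (x p * (- 1/16 + t p / 4)) + exp (x p * (3/16 - l p / 4 + t p * l p / 2) + C)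
      \<le> exp (x p * (- 1/16 + e))) sequentially"
proof -
  have "(\<lambda>p. t p / 4) \<longlonglongrightarrow> 0 / 4" by (intro tendsto_intros t) simp
  from order_tendstoD(2)[OF this, of "e / 2"] have 1: "eventually (\<lambda>p. t p / 4 < e / 2) sequentially" using e by simp
  have "(\<lambda>p. 3/16 - l p / 4 + t p * l p / 2) \<longlonglongrightarrow> 3/16 - 1/4 + 0 * 1 / 2" by (intro tendsto_intros t l) auto
  from order_tendstoD(2)[OF this, of "- 1/16 + e / 4"]
  have 2: "eventually (\<lambda>p. 3/16 - l p / 4 + t p * l p / 2 < - 1/16 + e / 4) sequentially" using e by simp
  have 3: "eventually (\<lambda>p. C0 \<le> x p * (e / 4)) sequentially" "eventually (\<lambda>p. ln 2 \<le> x p * (e / 2)) sequentially"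
    "eventually (\<lambda>p. 0 \<le> x p * 1) sequentially"
    by (rule eventually_le_linear[OF x]; use e in simp)+
  from 1 2 3 show ?thesis
  proof eventually_elim
    case (elim p)
    show ?case
    proof (intro allI impI)
      fix C assume C: "C \<le> C0"
      have "x p * (- 1/16 + t p / 4) \<le> x p * (- 1/16 + e / 2)" using elim by (intro mult_left_mono) auto
      moreover have "x p * (3/16 - l p / 4 + t p * l p / 2) \<le> x p * (- 1/16 + e / 4)" using elim by (intro mult_left_mono) auto
      then have "x p * (3/16 - l p / 4 + t p * l p / 2) + C \<le> x p * (- 1/16 + e / 2)" using elim C by (simp add: algebra_simps)
      ultimately have "exp (x p * (- 1/16 + t p / 4)) + exp (x p * (3/16 - l p / 4 + t p * l p / 2) + C)
         \<le> exp (x p * (- 1/16 + e / 2)) + exp (x p * (- 1/16 + e / 2))"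
        by (intro add_mono) simp_all
      also have "\<dots> = exp (ln 2 + x p * (- 1/16 + e / 2))" by (simp add: exp_add)
      also have "\<dots> \<le> exp (x p * (- 1/16 + e))" using elim by (simp add: algebra_simps)
      finally show "exp (x p * (- 1/16 + t p / 4)) + exp (x p * (3/16 - l p / 4 + t p * l p / 2) + C) \<le> exp (x p * (- 1/16 + e))" .
    qed
  qed
qed

text \<open>The positive term of \<open>B\<close> loses at most
  \<open>x * \<zeta>\<^sup>2 / 16\<close> in the exponent, whereas the subtracted tails decay at
  rate at least \<open>\<zeta>\<^sup>2 / 8\<close>. Both tolerances are of order
  \<open>\<zeta>\<^sup>2\<close>, so the limits must be approached to that precision, although the
  final loss is linear in \<open>\<zeta>\<close>.\<close>

lemma eventually_lower_exponent:
  fixes x t l h :: "nat \<Rightarrow> real" and \<zeta> C0 :: real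
  assumes x: "filterlim x at_top sequentially" and t: "t \<longlonglongrightarrow> 0" and l: "l \<longlonglongrightarrow> 1" and h: "h \<longlonglongrightarrow> 1/2"
    and \<zeta>: "0 < \<zeta>" "\<zeta> \<le> 1/2"
  defines "B \<equiv> \<lambda>p H C. exp (x p * (l p - 1/2 - t p - 9 * t p * l p) - H - C) / 4 - 2 * exp (x p * (- \<zeta>\<^sup>2 / 4 + 2 * t p))"
  shows "eventually (\<lambda>p. \<forall>H\<le>x p * h p. \<forall>C\<le>C0. B p H C \<ge> 0 \<and>
      exp (x p * (- 1/16 - \<zeta>)) \<le> exp (min 0 (x p * (1/4 - l p / 4 - \<zeta> / 2 - t p / 2) - ln 2) + x p * (- 1/16 - \<zeta> / 4)) * B p H C) sequentially"
proof -
  have z2: "\<zeta>\<^sup>2 > 0" "\<zeta>\<^sup>2 \<le> \<zeta> / 2" using \<zeta> by (auto simp: power2_eq_square)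
  have "(\<lambda>p. l p - 1/2 - t p - 9 * t p * l p - h p) \<longlonglongrightarrow> 1 - 1/2 - 0 - 9 * 0 * 1 - 1/2" by (intro tendsto_intros t l h)
  from order_tendstoD(1)[OF this, of "- (\<zeta>\<^sup>2 / 32)"]
  have 1: "eventually (\<lambda>p. - (\<zeta>\<^sup>2 / 32) < l p - 1/2 - t p - 9 * t p * l p - h p) sequentially" using z2 by simp
  have 2: "eventually (\<lambda>p. t p < \<zeta>\<^sup>2 / 16) sequentially" using order_tendstoD(2)[OF t, of "\<zeta>\<^sup>2 / 16"] z2 by simp
  have "(\<lambda>p. 1/4 - l p / 4 - t p / 2) \<longlonglongrightarrow> 1/4 - 1 / 4 - 0 / 2" by (intro tendsto_intros t l) auto
  from order_tendstoD(1)[OF this, of "- (\<zeta> / 16)"]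
  have 3: "eventually (\<lambda>p. - (\<zeta> / 16) < 1/4 - l p / 4 - t p / 2) sequentially" using \<zeta> by simp
  have 4: "eventually (\<lambda>p. C0 \<le> x p * (\<zeta>\<^sup>2 / 64)) sequentially" "eventually (\<lambda>p. ln 4 \<le> x p * (\<zeta>\<^sup>2 / 64)) sequentially"
    "eventually (\<lambda>p. ln 2 \<le> x p * (\<zeta> / 16)) sequentially" "eventually (\<lambda>p. 0 \<le> x p * 1) sequentially"
    by (rule eventually_le_linear[OF x]; use \<zeta> in simp)+
  have ln4: "exp (z + ln 4) = exp z * 4" for z :: real by (subst exp_add) simp
  from 1 2 3 4 show ?thesis
  proof eventually_elim
    case (elim p)
    let ?E = "exp (- (x p * (\<zeta>\<^sup>2 / 16)))"
    have x0: "0 \<le> x p" using elim by simp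
    show ?case
    proof (intro allI impI)
      fix H C assume H: "H \<le> x p * h p" and C: "C \<le> C0"
      \<comment> \<open>The exponent 1/16 is 1/32 for the deviation from the limits, plus 1/64 each
        for \<open>C0\<close> and \<open>ln 4\<close>.\<close>
      have a: "?E \<le> exp (x p * (l p - 1/2 - t p - 9 * t p * l p) - H - C) / 4"
      proof -
        have "x p * (- (\<zeta>\<^sup>2 / 32)) \<le> x p * (l p - 1/2 - t p - 9 * t p * l p - h p)"
          using elim x0 by (intro mult_left_mono) auto
        then have "- (x p * (\<zeta>\<^sup>2 / 16)) + ln 4 \<le> x p * (l p - 1/2 - t p - 9 * t p * l p) - H - C"
          using H C elim by (simp add: algebra_simps)
        then have "exp (- (x p * (\<zeta>\<^sup>2 / 16)) + ln 4) \<le> exp (x p * (l p - 1/2 - t p - 9 * t p * l p) - H - C)" by simp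
        then show ?thesis unfolding ln4 by simp
      qed
      \<comment> \<open>Since \<open>t p < \<zeta>\<^sup>2 / 16\<close>, the tail exponent is at
        most \<open>- x p * \<zeta>\<^sup>2 / 8\<close>; half of it stays as \<open>?E\<close>, the
        other half pays for \<open>ln 4\<close>.\<close>
      have b: "2 * exp (x p * (- \<zeta>\<^sup>2 / 4 + 2 * t p)) \<le> ?E / 2"
      proof -
        have "x p * (- \<zeta>\<^sup>2 / 4 + 2 * t p) \<le> x p * (- \<zeta>\<^sup>2 / 8)" using elim x0 by (intro mult_left_mono) auto
        moreover have "ln 4 \<le> x p * (\<zeta>\<^sup>2 / 16)"
        proof -
          have "x p * (\<zeta>\<^sup>2 / 64) \<le> x p * (\<zeta>\<^sup>2 / 16)" using x0 by (intro mult_left_mono) auto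
          then show ?thesis using elim(5) by linarith
        qed
        ultimately have "x p * (- \<zeta>\<^sup>2 / 4 + 2 * t p) + ln 4 \<le> - (x p * (\<zeta>\<^sup>2 / 16))" by (simp add: algebra_simps)
        then have "exp (x p * (- \<zeta>\<^sup>2 / 4 + 2 * t p) + ln 4) \<le> ?E" by simp
        then show ?thesis unfolding ln4 by simp
      qed
      have c: "?E / 2 \<le> B p H C" using a b unfolding B_def by linarith
      have "x p * (- (\<zeta> / 16)) \<le> x p * (1/4 - l p / 4 - t p / 2)"
        using elim x0 by (intro mult_left_mono) auto
      then have "- (x p * (5 * \<zeta> / 8)) \<le> x p * (1/4 - l p / 4 - \<zeta> / 2 - t p / 2) - ln 2"
        using elim by (simp add: algebra_simps)
      moreover have "- (x p * (5 * \<zeta> / 8)) \<le> 0" using x0 \<zeta> by simp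
      ultimately have d: "- (x p * (5 * \<zeta> / 8)) \<le> min 0 (x p * (1/4 - l p / 4 - \<zeta> / 2 - t p / 2) - ln 2)" by simp
      have e: "x p * \<zeta>\<^sup>2 \<le> x p * (\<zeta> / 2)" using z2 x0 by (intro mult_left_mono) auto
      have "0 \<le> x p * \<zeta>" using x0 \<zeta> by simp
      \<comment> \<open>In units of \<open>x p * \<zeta>\<close> the losses are 5/8 and 1/4 from the
        first factor, at most 1/32 from \<open>\<zeta>\<^sup>2 / 16\<close>, and at most 1/16 from
        \<open>ln 2\<close>: together below 1.\<close>
      then have "x p * (- 1/16 - \<zeta>) \<le> (- (x p * (5 * \<zeta> / 8)) + x p * (- 1/16 - \<zeta> / 4)) + (- (x p * (\<zeta>\<^sup>2 / 16)) - ln 2)"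
        using e elim by (simp add: algebra_simps)
      then have "exp (x p * (- 1/16 - \<zeta>)) \<le> exp ((- (x p * (5 * \<zeta> / 8)) + x p * (- 1/16 - \<zeta> / 4)) + (- (x p * (\<zeta>\<^sup>2 / 16)) - ln 2))" by simp
      also have "\<dots> = exp (- (x p * (5 * \<zeta> / 8)) + x p * (- 1/16 - \<zeta> / 4)) * (?E / 2)"
        by (simp add: exp_add exp_diff)
      also have "\<dots> \<le> exp (min 0 (x p * (1/4 - l p / 4 - \<zeta> / 2 - t p / 2) - ln 2) + x p * (- 1/16 - \<zeta> / 4)) * B p H C"
        using c d by (intro mult_mono) auto
      finally show "B p H C \<ge> 0 \<and>
        exp (x p * (- 1/16 - \<zeta>)) \<le> exp (min 0 (x p * (1/4 - l p / 4 - \<zeta> / 2 - t p / 2) - ln 2) + x p * (- 1/16 - \<zeta> / 4)) * B p H C"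
        using c by (auto intro: order_trans[of 0 "?E / 2"])
    qed
  qed
qed

text \<open>Averaging the fourth-order Taylor bounds for \<open>exp y\<close> and
  \<open>exp (- y)\<close> cancels the odd terms. The coefficient of \<open>y\<^sup>2\<close> is
  sharp because it yields the limit 1/2 of the overlap exponent relative to
  \<open>x\<close>.\<close>

lemma cosh_minus_one_le:
  fixes y :: real
  assumes "0 \<le> y" "y \<le> 1"
  shows "cosh y - 1 \<le> y\<^sup>2 / 2 + y ^ 4"
proof -
  have s: "(\<Sum>m<4. z ^ m / fact m) = 1 + z + z\<^sup>2 / 2 + z ^ 3 / 6" for z :: real
    by (simp add: eval_nat_numeral)
  have b: "exp z \<le> 1 + z + z\<^sup>2 / 2 + z ^ 3 / 6 + y ^ 4" if z: "\<bar>z\<bar> = y" for z :: real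
  proof -
    obtain u where u: "\<bar>u\<bar> \<le> \<bar>z\<bar>" "exp z = (\<Sum>m<4. z ^ m / fact m) + exp u / fact 4 * z ^ 4"
      using Maclaurin_exp_le[of z 4] by auto
    have "exp u \<le> exp 1" using u(1) z assms by simp
    also have "\<dots> \<le> 3" by (rule exp_le)
    finally have "exp u / fact 4 \<le> 1" by (simp add: fact_numeral)
    moreover have "z ^ 4 = y ^ 4" using z by (metis power_even_abs_numeral even_numeral)
    moreover have "0 \<le> y ^ 4" by simp
    ultimately have "exp u / fact 4 * z ^ 4 \<le> y ^ 4" by (metis mult_left_le_one_le mult_1 mult_right_mono)
    then show ?thesis using u(2) s by simp
  qed
  have c: "exp y \<le> 1 + y + y\<^sup>2 / 2 + y ^ 3 / 6 + y ^ 4" "exp (- y) \<le> 1 - y + y\<^sup>2 / 2 - y ^ 3 / 6 + y ^ 4"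
    using b[of y] b[of "- y"] assms by simp_all
  have "exp y + exp (- y) \<le> 2 + y\<^sup>2 + 2 * y ^ 4" using add_mono[OF c] by simp
  then have "(exp y + exp (- y)) / 2 \<le> (2 + y\<^sup>2 + 2 * y ^ 4) / 2" by (rule divide_right_mono) simp
  then show ?thesis unfolding cosh_field_def add_divide_distrib by simp
qed

lemma filterlim_nat_powr_at_top:
  fixes a :: real
  assumes "a > 0"
  shows "filterlim (\<lambda>p. real p powr a) at_top sequentially"
proof (rule filterlim_cong[OF refl refl, THEN iffD1])
  show "filterlim (\<lambda>p. exp (a * ln (real p))) at_top sequentially"
    by (intro filterlim_compose[OF exp_at_top] filterlim_tendsto_pos_mult_at_top[OF tendsto_const assms]
        filterlim_compose[OF ln_at_top] filterlim_real_sequentially)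
  show "eventually (\<lambda>p. exp (a * ln (real p)) = real p powr a) sequentially"
    using eventually_gt_at_top[of 0] by eventually_elim (simp add: powr_def)
qed

lemma tendsto_nat_neg_powr:
  fixes a :: real
  assumes "a < 0"
  shows "(\<lambda>p. real p powr a) \<longlonglongrightarrow> 0"
  by (rule tendsto_neg_powr[OF assms filterlim_real_sequentially])

theorem mainTheorem3:
  fixes \<alpha> \<delta> \<sigma>2 :: real
    and n :: "nat \<Rightarrow> nat"
    and D :: "nat \<Rightarrow> (nat \<times> nat \<Rightarrow> real) measure"
  assumes "0 < \<alpha>" and "\<alpha> \<le> 1/2"
    and "0 < \<delta>" and "\<delta> < 1/10" and "\<alpha> - 1/2 + 2 * \<delta> < 0"
    and "0 < \<sigma>2"
    and "filterlim n at_top sequentially"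
    and "((\<forall>p. SubG (n p) p \<sigma>2 (D p)) \<and>
          filterlim (\<lambda>p. real (n p) / (real p powr (7/5) * ln (real p))) at_top sequentially)
         \<or> ((\<forall>p. Orth (n p) p (D p)) \<and> (\<forall>p. n p \<ge> p))"
  shows "((\<lambda>p. ln (Risk (D p) (n p) p (nat (round (real p powr (1 - \<alpha>))))
                   (sqrt (real p powr (\<alpha> - 1/2 + \<delta>) / real (n p))))
               / real p powr (2 * \<delta>)) \<longlongrightarrow> - 1/16) sequentially"
proof -
  define s where "s p = nat (round (real p powr (1 - \<alpha>)))" for p :: nat
  define A where "A p = sqrt (real p powr (\<alpha> - 1/2 + \<delta>) / real (n p))" for p
  define \<Lambda> where "\<Lambda> p = real p powr (1/2 + \<delta>)" for p :: nat
  define x where "x p = real p powr (2 * \<delta>)" for p :: nat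
  define t where "t p = real p powr (\<delta> - 1/2) / 4" for p :: nat
  \<comment> \<open>\<open>l\<close> is the ratio of the rounded to the exact sparsity,
    \<open>y\<close> equals \<open>n * A\<^sup>2\<close> and \<open>w\<close> equals
    \<open>s / p\<close> eventually. The product \<open>x * h\<close> will bound the overlap
    exponent; since \<open>y\<close> and \<open>w\<close> tend to 0 and \<open>l\<close> to 1,
    \<open>h\<close> tends to 1/2, the value at which the second moment matches.\<close>
  define l where "l p = real (s p) * real p powr (\<alpha> - 1)" for p
  define y where "y p = real p powr (\<alpha> - 1/2 + \<delta>)" for p :: nat
  define w where "w p = l p * real p powr (- \<alpha>)" for p
  define h where "h p = (l p)\<^sup>2 / (1 - w p) * (1/2 + (y p)\<^sup>2)" for p
  define m where "m p = p div s p" for p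
  define \<nu> where "\<nu> p = real (s p) * (A p)\<^sup>2" for p
  define R where "R p = Risk (D p) (n p) p (s p) (A p)" for p
  \<comment> \<open>The factor 4 bounds \<open>n * \<nu>\<^sup>2\<close>, because eventually
    \<open>l < 2\<close> and \<open>\<Lambda>\<^sup>2 \<le> n\<close>.\<close>
  define C0 where "C0 = 4096 * \<sigma>2\<^sup>2 * 4"
  have x_lim: "filterlim x at_top sequentially"
    unfolding x_def using assms(3) by (intro filterlim_nat_powr_at_top) simp
  have t_lim: "t \<longlonglongrightarrow> 0"
    using tendsto_divide[OF tendsto_nat_neg_powr tendsto_const, of "\<delta> - 1/2" 4] assms(4) by (simp add: t_def[abs_def])
  have y_lim: "y \<longlonglongrightarrow> 0"
    unfolding y_def[abs_def] using assms(3,5) by (intro tendsto_nat_neg_powr) simp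
  have ev1: "eventually (\<lambda>p::nat. p \<ge> 1) sequentially" by (rule eventually_ge_at_top)
  \<comment> \<open>From 3 on the logarithm is at least 1.\<close>
  have ev3: "eventually (\<lambda>p::nat. p \<ge> 3) sequentially" by (rule eventually_ge_at_top)
  have evn: "eventually (\<lambda>p. n p \<ge> 1) sequentially"
    using assms(7) by (simp add: filterlim_at_top)
  have l_lim: "l \<longlonglongrightarrow> 1"
  proof (rule LIM_zero_cancel, rule Lim_null_comparison)
    have "\<alpha> - 1 < 0" using assms(2) by simp
    then show "(\<lambda>p. real p powr (\<alpha> - 1)) \<longlonglongrightarrow> 0" by (rule tendsto_nat_neg_powr)
    show "eventually (\<lambda>p. norm (l p - 1) \<le> real p powr (\<alpha> - 1)) sequentially"
      using ev1
    proof eventually_elim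
      case (elim p)
      have z: "0 \<le> real p powr (1 - \<alpha>)" by simp
      have "0 \<le> round (real p powr (1 - \<alpha>))" using round_mono[OF z] by simp
      then have "\<bar>real (s p) - real p powr (1 - \<alpha>)\<bar> \<le> 1/2"
        using of_int_round_abs_le[of "real p powr (1 - \<alpha>)"] by (simp add: s_def)
      then have "\<bar>real (s p) - real p powr (1 - \<alpha>)\<bar> * real p powr (\<alpha> - 1) \<le> 1 * real p powr (\<alpha> - 1)"
        by (intro mult_right_mono) auto
      moreover have "real p powr (1 - \<alpha>) * real p powr (\<alpha> - 1) = 1" using elim by (simp flip: powr_add)
      then have "l p - 1 = (real (s p) - real p powr (1 - \<alpha>)) * real p powr (\<alpha> - 1)"
        by (simp add: l_def left_diff_distrib)
      ultimately show ?case by (simp add: abs_mult)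
    qed
  qed
  have w_lim: "w \<longlonglongrightarrow> 0"
    using tendsto_mult[OF l_lim tendsto_nat_neg_powr[of "- \<alpha>"]] assms(1) by (simp add: w_def[abs_def])
  have h_lim: "h \<longlonglongrightarrow> 1/2"
  proof -
    have "h \<longlonglongrightarrow> 1\<^sup>2 / (1 - 0) * (1/2 + 0\<^sup>2)"
      unfolding h_def[abs_def] by (intro tendsto_intros l_lim w_lim y_lim) simp
    then show ?thesis by simp
  qed
  have evl: "eventually (\<lambda>p. 1/2 < l p) sequentially" "eventually (\<lambda>p. l p < 2) sequentially"
    using order_tendstoD(1)[OF l_lim, of "1/2"] order_tendstoD(2)[OF l_lim, of 2] by auto
  have evw: "eventually (\<lambda>p. w p < 1/2) sequentially" using order_tendstoD(2)[OF w_lim, of "1/2"] by simp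
  have evt: "eventually (\<lambda>p. t p < 1/16) sequentially" using order_tendstoD(2)[OF t_lim, of "1/16"] by simp
  have evy: "eventually (\<lambda>p. y p < 1) sequentially" using order_tendstoD(2)[OF y_lim, of 1] by simp
  have basic: "eventually (\<lambda>p. A p > 0 \<and> s p \<ge> 1 \<and> s p \<le> p \<and> m p > 0 \<and> s p * m p \<le> p \<and> 0 < t p \<and> t p \<le> 1/16
      \<and> real p * t p = \<Lambda> p / 4 \<and> t p * \<Lambda> p = x p / 4 \<and> real (n p) * \<nu> p = l p * \<Lambda> p \<and> \<nu> p > 0
      \<and> real (s p) / real (m p) * (cosh (real (n p) * (A p)\<^sup>2) - 1) \<le> x p * h p) sequentially"
    using ev1 evn evl evw evt evy
  proof eventually_elim
    case (elim p)
    have p: "real p > 0" using elim by simp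
    have A: "A p > 0" unfolding A_def using elim by simp
    have nA: "real (n p) * (A p)\<^sup>2 = y p" unfolding A_def y_def using elim by simp
    have s1: "s p \<ge> 1"
    proof (rule ccontr)
      assume "\<not> s p \<ge> 1"
      then have "l p = 0" by (simp add: l_def)
      then show False using elim by simp
    qed
    have sw: "real (s p) = w p * real p"
    proof -
      have "real p powr (\<alpha> - 1) * real p powr (- \<alpha>) * real p powr 1 = real p powr ((\<alpha> - 1) + (- \<alpha>) + 1)"
        by (simp only: powr_add)
      then have "real p powr (\<alpha> - 1) * real p powr (- \<alpha>) * real p = 1" using p by simp
      then show ?thesis by (simp add: w_def l_def mult.assoc)
    qed
    have "real (s p) \<le> 1 * real p" unfolding sw using elim p by (intro mult_right_mono) auto
    then have sp: "s p \<le> p" by simp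
    have m: "m p > 0" unfolding m_def using s1 sp by (simp add: div_greater_zero_iff)
    have sm: "s p * m p \<le> p" unfolding m_def by (rule times_div_less_eq_dividend)
    have t0: "0 < t p" using p by (simp add: t_def)
    have pt: "real p * t p = \<Lambda> p / 4"
    proof -
      have "real p powr 1 * real p powr (\<delta> - 1/2) = real p powr (1 + (\<delta> - 1/2))" by (simp only: powr_add)
      then show ?thesis using p by (simp add: t_def \<Lambda>_def add.commute)
    qed
    have t\<Lambda>: "t p * \<Lambda> p = x p / 4"
    proof -
      have "real p powr (\<delta> - 1/2) * real p powr (1/2 + \<delta>) = real p powr ((\<delta> - 1/2) + (1/2 + \<delta>))" by (simp only: powr_add)
      then show ?thesis by (simp add: t_def \<Lambda>_def x_def)
    qed
    have ly: "l p * \<Lambda> p = real (s p) * y p"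
    proof -
      have "real p powr (\<alpha> - 1) * real p powr (1/2 + \<delta>) = real p powr ((\<alpha> - 1) + (1/2 + \<delta>))" by (simp only: powr_add)
      then show ?thesis by (simp add: l_def \<Lambda>_def y_def algebra_simps)
    qed
    have n\<nu>: "real (n p) * \<nu> p = l p * \<Lambda> p" unfolding ly nA[symmetric] \<nu>_def by simp
    have \<nu>0: "\<nu> p > 0" using s1 A by (simp add: \<nu>_def)
    have y0: "0 \<le> y p" by (simp add: y_def)
    have H: "real (s p) / real (m p) * (cosh (y p) - 1) \<le> x p * h p"
    proof -
      have px: "(\<Lambda> p)\<^sup>2 = x p * real p"
      proof -
        have "real p powr (1/2 + \<delta>) * real p powr (1/2 + \<delta>) = real p powr ((1/2 + \<delta>) + (1/2 + \<delta>))" by (simp only: powr_add)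
        also have "(1/2 + \<delta>) + (1/2 + \<delta>) = 2 * \<delta> + 1" by simp
        also have "real p powr (2 * \<delta> + 1) = real p powr (2 * \<delta>) * real p powr 1" by (simp only: powr_add)
        finally show ?thesis using p by (simp add: \<Lambda>_def x_def power2_eq_square)
      qed
      \<comment> \<open>Rounding \<open>p / s\<close> down to the block length leaves fewer than
        \<open>s p\<close> coordinates over, so the blocks cover at least
        \<open>p * (1 - w p)\<close> of them.\<close>
      have "p = m p * s p + p mod s p" unfolding m_def by simp
      moreover have "p mod s p \<le> s p" using s1 by (simp add: less_imp_le)
      ultimately have "p \<le> m p * s p + s p" by linarith
      then have "real p \<le> real (m p) * real (s p) + real (s p)" by (simp flip: of_nat_mult of_nat_add)
      then have "real p - real (s p) \<le> real (m p) * real (s p)" by simp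
      then have mw: "real p * (1 - w p) \<le> real (m p) * real (s p)" unfolding sw by (simp add: algebra_simps)
      have w1: "0 < real p * (1 - w p)" using elim p by simp
      have "real (s p) / real (m p) = (real (s p))\<^sup>2 / (real (m p) * real (s p))" using s1 by (simp add: power2_eq_square)
      also have "\<dots> \<le> (real (s p))\<^sup>2 / (real p * (1 - w p))"
        using mw w1 by (intro divide_left_mono) auto
      finally have 1: "real (s p) / real (m p) \<le> (real (s p))\<^sup>2 / (real p * (1 - w p))" .
      have 2: "cosh (y p) - 1 \<le> (y p)\<^sup>2 * (1/2 + (y p)\<^sup>2)"
        using cosh_minus_one_le[of "y p"] y0 elim by (simp add: algebra_simps eval_nat_numeral)
      have "real (s p) / real (m p) * (cosh (y p) - 1) \<le> (real (s p))\<^sup>2 / (real p * (1 - w p)) * ((y p)\<^sup>2 * (1/2 + (y p)\<^sup>2))"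
        using 1 2 w1 cosh_real_ge_1[of "y p"] by (intro mult_mono) auto
      also have "\<dots> = (real (s p) * y p)\<^sup>2 / (real p * (1 - w p)) * (1/2 + (y p)\<^sup>2)" by (simp add: power_mult_distrib)
      also have "(real (s p) * y p)\<^sup>2 = (l p)\<^sup>2 * (x p * real p)" unfolding ly[symmetric] px[symmetric] by (simp add: power_mult_distrib)
      also have "(l p)\<^sup>2 * (x p * real p) / (real p * (1 - w p)) * (1/2 + (y p)\<^sup>2) = x p * h p"
        using p by (simp add: h_def)
      finally show ?thesis .
    qed
    show ?case using A s1 sp m sm t0 pt t\<Lambda> n\<nu> \<nu>0 H elim unfolding nA by simp
  qed
  have des: "eventually (\<lambda>p. \<exists>C\<le>C0. design (n p) p (D p) (\<nu> p) C) sequentially"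
    using assms(8)
  proof
    assume O: "(\<forall>p. Orth (n p) p (D p)) \<and> (\<forall>p. n p \<ge> p)"
    show ?thesis using evn
    proof eventually_elim
      case (elim p)
      then have "design (n p) p (D p) (\<nu> p) 0" using O by (intro design_Orth) auto
      then show ?case by (intro exI[of _ 0]) (simp add: C0_def)
    qed
  next
    assume S: "(\<forall>p. SubG (n p) p \<sigma>2 (D p)) \<and>
          filterlim (\<lambda>p. real (n p) / (real p powr (7/5) * ln (real p))) at_top sequentially"
    then have "eventually (\<lambda>p. 1 \<le> real (n p) / (real p powr (7/5) * ln (real p))) sequentially"
      by (simp add: filterlim_at_top)
    with ev3 have n75: "eventually (\<lambda>p. real p powr (7/5) \<le> real (n p)) sequentially"
    proof eventually_elim
      case (elim p)
      have "exp 1 \<le> real p" using exp_le elim(1) by linarith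
      then have ln1: "1 \<le> ln (real p)" using elim(1) by (simp add: ln_ge_iff)
      have "0 < real p powr (7/5) * ln (real p)" using ln1 elim(1) by simp
      then have "real p powr (7/5) * ln (real p) \<le> real (n p)" using elim(2) by (simp add: pos_le_divide_eq)
      moreover have "real p powr (7/5) * 1 \<le> real p powr (7/5) * ln (real p)" using ln1 by (intro mult_left_mono) auto
      ultimately show ?case by simp
    qed
    \<comment> \<open>The exponent is \<open>(1/2 + \<delta>) - 7/5\<close>: this makes
      \<open>\<Lambda> / n\<close> small, and with it the squared length \<open>\<nu>\<close>, as
      the row expansion requires.\<close>
    have "(\<lambda>p. real p powr (\<delta> - 9/10)) \<longlonglongrightarrow> 0" using assms(4) by (intro tendsto_nat_neg_powr) simp
    from order_tendstoD(2)[OF this, of "1 / (64 * \<sigma>2)"]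
    have small: "eventually (\<lambda>p. real p powr (\<delta> - 9/10) < 1 / (64 * \<sigma>2)) sequentially" using assms(6) by simp
    from basic n75 small ev1 evl show ?thesis
    proof eventually_elim
      case (elim p)
      have p: "real p \<ge> 1" using elim by simp
      have n0: "real (n p) > 0"
      proof -
        have "0 < real p powr (7/5)" using p by simp
        then show ?thesis using elim(2) by linarith
      qed
      have q: "\<Lambda> p = real p powr (\<delta> - 9/10) * real p powr (7/5)"
        unfolding powr_add[symmetric] \<Lambda>_def by (simp add: add.commute)
      have "\<Lambda> p \<le> real p powr (\<delta> - 9/10) * real (n p)"
        unfolding q using elim(2) by (intro mult_left_mono) auto
      then have \<Lambda>1: "\<Lambda> p \<le> 1 / (64 * \<sigma>2) * real (n p)"
        using elim(3) n0 by (meson less_imp_le mult_right_mono order_trans)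
      have \<Lambda>0: "0 \<le> \<Lambda> p" by (simp add: \<Lambda>_def)
      have n\<nu>: "real (n p) * \<nu> p = l p * \<Lambda> p" and \<nu>0: "\<nu> p > 0" using elim(1) by auto
      have "real (n p) * \<nu> p \<le> 2 * \<Lambda> p" unfolding n\<nu> using elim \<Lambda>0 by (intro mult_right_mono) auto
      also have "\<dots> \<le> 2 * (1 / (64 * \<sigma>2) * real (n p))" using \<Lambda>1 by simp
      finally have "real (n p) * (8 * \<nu> p) \<le> real (n p) * (1 / (4 * \<sigma>2))" by (simp add: field_simps)
      then have \<nu>8: "8 * \<nu> p \<le> 1 / (4 * \<sigma>2)" using n0 by (simp only: mult_le_cancel_left_pos)
      \<comment> \<open>From \<open>\<delta> < 1/10\<close> the exponent
        \<open>1 + 2 * \<delta>\<close> is below 6/5, so the growth of \<open>n\<close> keeps the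
        second-order error of all rows together bounded.\<close>
      have "(\<Lambda> p)\<^sup>2 = real p powr (2 * (1/2 + \<delta>))" by (simp add: \<Lambda>_def power2_eq_square powr_add[symmetric])
      also have "\<dots> \<le> real p powr (7/5)" using p assms(4) by (intro powr_mono) auto
      also have "\<dots> \<le> real (n p)" by (rule elim(2))
      finally have \<Lambda>2: "(\<Lambda> p)\<^sup>2 \<le> real (n p)" .
      have "real (n p) * (real (n p) * (\<nu> p)\<^sup>2) = (l p)\<^sup>2 * (\<Lambda> p)\<^sup>2"
        using arg_cong[OF n\<nu>, of "\<lambda>z. z\<^sup>2"] by (simp add: power2_eq_square mult_ac)
      also have "\<dots> \<le> 2\<^sup>2 * real (n p)" using \<Lambda>2 elim by (intro mult_mono power_mono) auto
      finally have "real (n p) * (real (n p) * (\<nu> p)\<^sup>2) \<le> real (n p) * 4" by simp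
      then have "real (n p) * (\<nu> p)\<^sup>2 \<le> 4" using n0 by (simp only: mult_le_cancel_left_pos)
      then have "4096 * \<sigma>2\<^sup>2 * (real (n p) * (\<nu> p)\<^sup>2) \<le> C0" unfolding C0_def by (intro mult_left_mono) auto
      then have "real (n p) * (4096 * \<sigma>2\<^sup>2 * (\<nu> p)\<^sup>2) \<le> C0" by (simp add: mult_ac)
      moreover have "design (n p) p (D p) (\<nu> p) (real (n p) * (4096 * \<sigma>2\<^sup>2 * (\<nu> p)\<^sup>2))"
        using S by (intro design_SubG[OF _ assms(6) \<nu>0 \<nu>8]) auto
      ultimately show ?case by blast
    qed
  qed
  have lower: "eventually (\<lambda>p. exp (x p * (- 1/16 - \<zeta>)) \<le> R p) sequentially" if \<zeta>: "0 < \<zeta>" "\<zeta> \<le> 1/2" for \<zeta>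
    using basic des eventually_lower_exponent[OF x_lim t_lim l_lim h_lim \<zeta>, of C0]
  proof eventually_elim
    case (elim p)
    then obtain C where C: "C \<le> C0" and d: "design (n p) p (D p) (\<nu> p) C" by blast
    interpret design "n p" p "D p" "\<nu> p" C by (rule d)
    note b = elim(1)
    let ?H = "real (s p) / real (m p) * (cosh (real (n p) * (A p)\<^sup>2) - 1)"
    have L: "exp (x p * (l p - 1/2 - t p - 9 * t p * l p) - ?H - C) / 4 - 2 * exp (x p * (- \<zeta>\<^sup>2 / 4 + 2 * t p)) \<ge> 0"
      "exp (x p * (- 1/16 - \<zeta>)) \<le> exp (min 0 (x p * (1/4 - l p / 4 - \<zeta> / 2 - t p / 2) - ln 2) + x p * (- 1/16 - \<zeta> / 4)) *
        (exp (x p * (l p - 1/2 - t p - 9 * t p * l p) - ?H - C) / 4 - 2 * exp (x p * (- \<zeta>\<^sup>2 / 4 + 2 * t p)))"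
      using elim(3) C b by blast+
    have "exp (min 0 (x p * (1/4 - l p / 4 - \<zeta> / 2 - t p / 2) - ln 2) + x p * (- 1/16 - \<zeta> / 4)) *
        (exp (x p * (l p - 1/2 - t p - 9 * t p * l p) - ?H - C) / 4 - 2 * exp (x p * (- \<zeta>\<^sup>2 / 4 + 2 * t p))) \<le> R p"
      unfolding R_def using b L(1) \<zeta> by (intro Risk_ge_exp[where \<Lambda>="\<Lambda> p"]) (auto simp: \<nu>_def)
    then show ?case using L(2) by linarith
  qed
  have upper: "eventually (\<lambda>p. R p \<le> exp (x p * (- 1/16 + e))) sequentially" if e: "0 < e" for e
    using basic des eventually_upper_exponent[OF x_lim t_lim l_lim e, of C0]
  proof eventually_elim
    case (elim p)
    then obtain C where C: "C \<le> C0" and d: "design (n p) p (D p) (\<nu> p) C" by blast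
    interpret design "n p" p "D p" "\<nu> p" C by (rule d)
    note b = elim(1)
    have "R p \<le> exp (x p * (- 1/16 + t p / 4)) + exp (x p * (3/16 - l p / 4 + t p * l p / 2) + C)"
      unfolding R_def using b by (intro Risk_le_exp[where \<Lambda>="\<Lambda> p"]) (auto simp: \<nu>_def)
    also have "\<dots> \<le> exp (x p * (- 1/16 + e))" using elim(3) C by blast
    finally show ?case .
  qed
  have "(\<lambda>p. ln (R p) / x p) \<longlonglongrightarrow> - 1/16"
  proof (rule tendstoI)
    fix e :: real assume e: "0 < e"
    define \<zeta> where "\<zeta> = min (1/2) (e / 2)"
    have \<zeta>: "0 < \<zeta>" "\<zeta> \<le> 1/2" "\<zeta> < e" using e by (auto simp: \<zeta>_def)
    have x0: "eventually (\<lambda>p. 0 < x p) sequentially"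
      using ev1 by eventually_elim (simp add: x_def)
    from lower[OF \<zeta>(1,2)] upper[OF \<zeta>(1)] x0 show "eventually (\<lambda>p. dist (ln (R p) / x p) (- 1/16) < e) sequentially"
    proof eventually_elim
      case (elim p)
      have R0: "0 < R p" using elim(1) exp_gt_zero[of "x p * (- 1/16 - \<zeta>)"] by linarith
      have "x p * (- 1/16 - \<zeta>) \<le> ln (R p)" using elim(1) R0 by (simp add: ln_ge_iff)
      then have 1: "- 1/16 - \<zeta> \<le> ln (R p) / x p" using elim(3) by (simp add: pos_le_divide_eq mult.commute)
      have "ln (R p) \<le> x p * (- 1/16 + \<zeta>)" using elim(2) R0 by (metis ln_exp ln_le_cancel_iff exp_gt_zero)
      then have 2: "ln (R p) / x p \<le> - 1/16 + \<zeta>" using elim(3) by (simp add: pos_divide_le_eq mult.commute)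
      show ?case using 1 2 \<zeta>(3) by (simp add: dist_real_def abs_less_iff)
    qed
  qed
  then show ?thesis by (simp add: R_def s_def A_def x_def)
qed

end
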